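(* There are fixed constants $\delta_0,c>0$ such that $$S(p^5,\delta_0,p) \ge \mathrm{twr}(c\log(1/p)).$$ Furthermore, one can decompose the edge set of a complete bipartite graph into $1/p$ graphs of density $p$ so that each of them witnesses this inequality, i.e., for each such graph $G$, every graph obtained from $G$ by adding/removing at most $\delta_0|E(G)|$ edges has no $p^5$-regular equipartition of order less than $\mathrm{twr}(c\log(1/p))$.
   Context: All graphs are finite and simple. $e_G(A,B)$ is the number of ordered pairs $(u,v)\in A\times B$ with $uv\in E(G)$, $d_G(A,B)=e_G(A,B)/(|A||B|)$. A pair $(A,B)$ is $\epsilon$-regular if $|d_G(A,B)-d_G(A',B')|\le\epsilon$ whenever $A'\subseteq A$, $B'\subseteq B$, $|A'|\ge\epsilon|A|$, $|B'|\ge\epsilon|B|$. An equipartition is a vertex partition whose part sizes differ by at most $1$; its order is its number of parts; an equipartition $\{Z_1,\dots,Z_k\}$ is $\epsilon$-regular if all pairs $(Z_i,Z_j)$ but at most $\epsilon k^2$ are $\epsilon$-regular. The density of $G=(V,E)$ is $2|E|/|V|^2$. $S(\epsilon,\delta,p)$ is the smallest integer $S$ such that for every graph $G$ of density at least $p$ and every equipartition $\mathcal P_0$ of $V(G)$ of order at most $1/\epsilon$, one can add/remove at most $\delta|E(G)|$ edges so that the resulting graph has an $\epsilon$-regular equipartition refining $\mathcal P_0$ of order at most $S$. $\mathrm{twr}(x)$ is a tower of $2$'s of height $x$: $\mathrm{twr}(0)=1$, $\mathrm{twr}(x+1)=2^{\mathrm{twr}(x)}$, non-integer heights rounded up.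
   Formalization: The inequality is proved for 0 < p ≤ 1/2 (it fails for p near 1, where a single part is already p^5-regular); in the decomposition p = 1/m with m ≥ 2, and "density p" means bipartite density, since density 2|E|/|V|^2 would be impossible there. *)

theory Defs
  imports Complex_Main "HOL-Library.Extended_Nat"
begin

text \<open>Finite simple graphs: vertex set V :: nat set (finite), edge set E :: nat set set
  of 2-element subsets of V. Every finite graph is isomorphic to one on natural numbers.\<close>

definition simple_graph :: "nat set \<Rightarrow> nat set set \<Rightarrow> bool" where
  "simple_graph V E \<longleftrightarrow> finite V \<and>
     (\<forall>e\<in>E. \<exists>u v. u \<noteq> v \<and> u \<in> V \<and> v \<in> V \<and> e = {u, v})"

definition e_G :: "nat set set \<Rightarrow> nat set \<Rightarrow> nat set \<Rightarrow> nat" where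
  "e_G E A B = card {(u, v). u \<in> A \<and> v \<in> B \<and> {u, v} \<in> E}"

definition d_G :: "nat set set \<Rightarrow> nat set \<Rightarrow> nat set \<Rightarrow> real" where
  "d_G E A B = real (e_G E A B) / (real (card A) * real (card B))"

definition eps_regular_pair :: "real \<Rightarrow> nat set set \<Rightarrow> nat set \<Rightarrow> nat set \<Rightarrow> bool" where
  "eps_regular_pair \<epsilon> E A B \<longleftrightarrow>
     (\<forall>A' B'. A' \<subseteq> A \<and> B' \<subseteq> B \<and> real (card A') \<ge> \<epsilon> * real (card A)
        \<and> real (card B') \<ge> \<epsilon> * real (card B)
        \<longrightarrow> \<bar>d_G E A B - d_G E A' B'\<bar> \<le> \<epsilon>)"

definition equipartition :: "nat set \<Rightarrow> nat set set \<Rightarrow> bool" where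
  "equipartition V P \<longleftrightarrow> finite P \<and> \<Union>P = V \<and> {} \<notin> P \<and>
     (\<forall>X\<in>P. \<forall>Y\<in>P. X \<noteq> Y \<longrightarrow> X \<inter> Y = {}) \<and>
     (\<forall>X\<in>P. \<forall>Y\<in>P. card X \<le> card Y + 1)"

definition eps_regular_partition :: "real \<Rightarrow> nat set set \<Rightarrow> nat set set \<Rightarrow> bool" where
  "eps_regular_partition \<epsilon> E P \<longleftrightarrow>
     real (card {(X, Y). X \<in> P \<and> Y \<in> P \<and> \<not> eps_regular_pair \<epsilon> E X Y})
       \<le> \<epsilon> * real (card P) ^ 2"

definition refines :: "nat set set \<Rightarrow> nat set set \<Rightarrow> bool" where
  "refines P Q \<longleftrightarrow> (\<forall>X\<in>P. \<exists>Y\<in>Q. X \<subseteq> Y)"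

definition graph_density :: "nat set \<Rightarrow> nat set set \<Rightarrow> real" where
  "graph_density V E = 2 * real (card E) / real (card V) ^ 2"

definition S_admissible :: "real \<Rightarrow> real \<Rightarrow> real \<Rightarrow> nat \<Rightarrow> bool" where
  "S_admissible \<epsilon> \<delta> p S \<longleftrightarrow>
     (\<forall>V E P0. simple_graph V E \<and> graph_density V E \<ge> p \<and> equipartition V P0
        \<and> real (card P0) \<le> 1 / \<epsilon> \<longrightarrow>
        (\<exists>E' P. simple_graph V E' \<and> real (card (E - E' \<union> (E' - E))) \<le> \<delta> * real (card E)
           \<and> equipartition V P \<and> refines P P0 \<and> eps_regular_partition \<epsilon> E' P
           \<and> card P \<le> S))"

text \<open>S(eps,delta,p): the smallest admissible S (infinity if none exists).\<close>
definition reg_S :: "real \<Rightarrow> real \<Rightarrow> real \<Rightarrow> enat" where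
  "reg_S \<epsilon> \<delta> p = (INF S \<in> {S. S_admissible \<epsilon> \<delta> p S}. enat S)"

fun twr :: "nat \<Rightarrow> nat" where
  "twr 0 = 1"
| "twr (Suc n) = 2 ^ twr n"

definition twr_real :: "real \<Rightarrow> nat" where
  "twr_real x = twr (nat \<lceil>x\<rceil>)"

definition complete_bipartite :: "nat set \<Rightarrow> nat set \<Rightarrow> nat set set" where
  "complete_bipartite A B = {{u, v} | u v. u \<in> A \<and> v \<in> B}"

end

(* The witnesses refine a tower of pairs of vertex classes U_0, U_1, U_2, ...: U_(t+2) is U_t times an
   exponentially large code whose coordinates are the cells of U_(t+1) joined to a given cell of U_t,
   and the codeword decides which half of these cells keeps each colour, so that every step doubles
   the number of colours.  Codewords are pairwise far apart, so two cells of U_(t+2) differ on a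
   constant fraction of their neighbourhoods.  Suppose a regular partition already follows most of
   U_(t+1) but not U_(t+2).  Then many regular pairs of parts have large empty subrectangles in G,
   while regularity makes the modified graph fill them at the density of the pair; this costs a constant
   fraction of all edges, more than the allowed modification.  The loss would grow geometrically
   with t were the bipartite graphs not expanding: orthogonality of the code coordinates gives a
   spectral gap, so the few exceptional cells on one side spoil far fewer cells on the other.  Hence
   the partition follows U_s for s of order log(1/p), and U_s has tower size.

   The densities are made exactly 1/m by assigning to each of the m graphs a block of finest colours
   inside one colour of level s and padding with a negligible number of further edges. *)

theory Submission
  imports Defs "HOL-Analysis.Convex" "HOL-Library.Disjoint_Sets"
begin

section \<open>Regular partitions and wasted edges\<close>

text \<open>The constants form a loop that closes at every level. If at most n/32 vertices of one
  side are unusable, the waste argument bounds the badness of the next level by n/64, and a badness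
  of n/64 makes at most n/32 vertices unusable. Plain double counting would not close it: it allows
  n/32 unusable vertices to fill D/16 of the D neighbours of n/2 vertices on the other side. The
  second moment bound from the spectral gap replaces n/2 by n/256. Orthogonality concerns the
  coordinates of the code and is not provided by a greedy choice of far apart words; a union of
  translates of Hadamard words has both properties. Separation speaks of level r, whereas the graph
  consists of colours of the finest level S. What bridges the two is exactness: every codeword
  halves every fibre without error, so a finest colour is equidistributed over the cells of level r
  that carry its prefix. In the main case the power p^5 serves to make \<epsilon> n^2 small against
  the n^2/m edges of one graph, and \<epsilon> small against the 2^17 cells of level 1.\<close>

text \<open>Regularity says nothing about a share of a part smaller than \<open>\<epsilon>\<close>, so a vertex is only useful
  when its part meets its own cell substantially.\<close>

definition nongood :: "nat set set \<Rightarrow> nat set \<Rightarrow> (nat \<Rightarrow> nat) \<Rightarrow> real \<Rightarrow> nat set" where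
  "nongood P B c \<epsilon> = {v\<in>B. \<exists>Z\<in>P. v \<in> Z \<and> real (card {v'\<in>Z \<inter> B. c v' = c v}) < \<epsilon> * real (card Z)}"

text \<open>The summand of u is the probability that a random vertex of the part of u lies outside
  the cell of u. The sum vanishes exactly when every part that meets A lies inside a single cell of
  A.\<close>

definition badness :: "nat set set \<Rightarrow> nat set \<Rightarrow> (nat \<Rightarrow> nat) \<Rightarrow> real" where
  "badness P A c = (\<Sum>Z\<in>P. \<Sum>u\<in>Z \<inter> A. real (card {u'\<in>Z. u' \<notin> A \<or> c u' \<noteq> c u}) / real (card Z))"

lemma equipartition_parts:
  assumes P: "equipartition V P" and V: "finite V"
  shows "finite P" and "\<And>Z. Z \<in> P \<Longrightarrow> finite Z \<and> Z \<noteq> {} \<and> Z \<subseteq> V \<and> card Z > 0"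
    and "disjoint_family_on (\<lambda>Z. Z) P" and "\<Union>P = V"
proof -
  show "finite P" "\<Union>P = V" using P unfolding equipartition_def by auto
  then show "finite Z \<and> Z \<noteq> {} \<and> Z \<subseteq> V \<and> card Z > 0" if "Z \<in> P" for Z
    using P V that unfolding equipartition_def by (metis Union_upper card_gt_0_iff finite_subset)
  show "disjoint_family_on (\<lambda>Z. Z) P" using P unfolding equipartition_def disjoint_family_on_def by blast
qed

lemma sum_over_parts:
  fixes f :: "nat \<Rightarrow> real"
  assumes P: "equipartition V P" and V: "finite V" and "A \<subseteq> V"
  shows "(\<Sum>Z\<in>P. \<Sum>u\<in>Z \<inter> A. f u) = (\<Sum>u\<in>A. f u)"
proof -
  note parts = equipartition_parts[OF P V]
  have "(\<Sum>Z\<in>P. \<Sum>u\<in>Z \<inter> A. f u) = (\<Sum>u\<in>(\<Union>Z\<in>P. Z \<inter> A). f u)"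
    by (rule sum.UNION_disjoint[symmetric]) (use parts in \<open>auto simp: disjoint_family_on_def\<close>)
  also have "(\<Union>Z\<in>P. Z \<inter> A) = A" using parts(4) \<open>A \<subseteq> V\<close> by auto
  finally show ?thesis .
qed

lemma sum_card_parts:
  assumes P: "equipartition V P" and V: "finite V"
  shows "(\<Sum>Z\<in>P. real (card Z)) = real (card V)"
proof -
  have "(\<Sum>Z\<in>P. real (card Z)) = (\<Sum>Z\<in>P. \<Sum>u\<in>Z \<inter> V. 1)"
    using equipartition_parts[OF P V] by (intro sum.cong refl) (simp add: Int_absorb2)
  also have "\<dots> = (\<Sum>u\<in>V. 1)" by (rule sum_over_parts[OF P V]) simp
  finally show ?thesis by simp
qed

lemma part_size_le:
  assumes P: "equipartition V P" and V: "finite V" and Z: "Z \<in> P"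
  shows "real (card P) * real (card Z) \<le> 2 * real (card V)"
proof -
  note parts = equipartition_parts[OF P V]
  have "real (card P) * real (card Z) = (\<Sum>Z'\<in>P. real (card Z))" by simp
  also have "\<dots> \<le> (\<Sum>Z'\<in>P. 2 * real (card Z'))"
  proof (rule sum_mono)
    fix Z' assume Z': "Z' \<in> P"
    have "card Z \<le> card Z' + 1" using P Z Z' unfolding equipartition_def by blast
    \<comment> \<open>A part is nonempty, so the additive slack 1 costs at most a factor 2.\<close>
    then show "real (card Z) \<le> 2 * real (card Z')" using parts(2)[OF Z'] by linarith
  qed
  also have "\<dots> = 2 * real (card V)" using sum_card_parts[OF P V] by (simp flip: sum_distrib_left)
  finally show ?thesis .
qed

lemma card_filter_sum: "finite X \<Longrightarrow> real (card {x\<in>X. Q x}) = (\<Sum>x\<in>X. of_bool (Q x))"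
proof -
  assume "finite X"
  have "{x\<in>X. Q x} = X \<inter> {x. Q x}" by auto
  then show ?thesis using \<open>finite X\<close> by simp
qed

lemma card_pairs_sum:
  assumes "finite X" "finite Y"
  shows "real (card {(u,v). u \<in> X \<and> v \<in> Y \<and> Q u v}) = (\<Sum>u\<in>X. \<Sum>v\<in>Y. of_bool (Q u v))"
proof -
  have "{(u,v). u \<in> X \<and> v \<in> Y \<and> Q u v} = {p\<in>X \<times> Y. Q (fst p) (snd p)}" by auto
  then have "real (card {(u,v). u \<in> X \<and> v \<in> Y \<and> Q u v}) = (\<Sum>p\<in>X \<times> Y. of_bool (Q (fst p) (snd p)))"
    using assms by (simp only: card_filter_sum finite_cartesian_product)
  then show ?thesis by (simp add: sum.cartesian_product case_prod_unfold)
qed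

lemma e_G_eq_d_G:
  assumes "finite X" "finite Y"
  shows "real (e_G E X Y) = d_G E X Y * (real (card X) * real (card Y))"
proof (cases "X = {} \<or> Y = {}")
  case True
  then have "{(u, v). u \<in> X \<and> v \<in> Y \<and> {u, v} \<in> E} = {}" by auto
  then show ?thesis using True unfolding e_G_def by auto
next
  case False then show ?thesis using assms unfolding d_G_def by simp
qed

lemma e_G_le:
  assumes "finite X" "finite Y"
  shows "real (e_G E X Y) \<le> real (card X) * real (card Y)"
proof -
  have "e_G E X Y \<le> card (X \<times> Y)" unfolding e_G_def
    by (rule card_mono) (use assms in auto)
  then show ?thesis by (simp add: card_cartesian_product flip: of_nat_mult)
qed

text \<open>If the bad vertices are not a tiny share of Z1, regularity gives them nearly the same
  density to C as all of Z1, at a cost of \<epsilon> for each of the two comparisons with (Z1, Z2).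
  None of their edges to C is in J, so they waste their proportional share of the E-edges. A smaller
  bad set has share below \<epsilon> and disappears in the error term.\<close>

lemma regular_pair_waste:
  assumes reg: "eps_regular_pair \<epsilon> E Z1 Z2" and fin: "finite Z1" "finite Z2" and eps: "0 < \<epsilon>" "\<epsilon> \<le> 1"
    and C: "C \<subseteq> Z2" "real (card C) \<ge> \<epsilon> * real (card Z2)" and Z1: "Z1 \<noteq> {}"
    and empty: "\<And>u v. u \<in> Z1 \<Longrightarrow> bad u \<Longrightarrow> v \<in> C \<Longrightarrow> \<not> J u v"
  shows "real (card {u\<in>Z1. bad u}) / real (card Z1) * real (e_G E Z1 C)
    \<le> real (card {(u,v). u \<in> Z1 \<and> v \<in> C \<and> {u,v} \<in> E \<and> \<not> J u v}) + 2 * \<epsilon> * (real (card Z1) * real (card C))"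
proof -
  define M where "M = {u\<in>Z1. bad u}"
  have finC: "finite C" using C(1) fin(2) finite_subset by blast
  have finM: "finite M" and MZ: "M \<subseteq> Z1" unfolding M_def using fin by auto
  have c1: "real (card Z1) > 0" using Z1 fin by (simp add: card_gt_0_iff)
  let ?X = "real (card {(u,v). u \<in> Z1 \<and> v \<in> C \<and> {u,v} \<in> E \<and> \<not> J u v})"
  show ?thesis
  proof (cases "real (card M) < \<epsilon> * real (card Z1)")
    case True
    then have "real (card M) / real (card Z1) \<le> \<epsilon>" using c1 by (simp add: pos_divide_le_eq)
    then have "real (card M) / real (card Z1) * real (e_G E Z1 C) \<le> \<epsilon> * (real (card Z1) * real (card C))"
      using e_G_le[OF fin(1) finC, of E] eps by (intro mult_mono) auto
    also have "\<dots> \<le> 2 * \<epsilon> * (real (card Z1) * real (card C))" using eps by (simp add: mult_right_mono)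
    finally show ?thesis unfolding M_def[symmetric] by linarith
  next
    case False
    have "\<epsilon> * real (card Z1) \<le> real (card Z1)" using eps by (simp add: mult_left_le_one_le)
    then have "\<bar>d_G E Z1 Z2 - d_G E Z1 C\<bar> \<le> \<epsilon>"
      using reg C unfolding eps_regular_pair_def by blast
    moreover have "\<bar>d_G E Z1 Z2 - d_G E M C\<bar> \<le> \<epsilon>"
      using reg C False MZ unfolding eps_regular_pair_def by (meson linorder_not_less)
    ultimately have d: "d_G E Z1 C \<le> d_G E M C + 2 * \<epsilon>" by linarith
    have "real (card M) / real (card Z1) * real (e_G E Z1 C) = d_G E Z1 C * (real (card M) * real (card C))"
      unfolding e_G_eq_d_G[OF fin(1) finC] using c1 by simp
    also have "\<dots> \<le> (d_G E M C + 2 * \<epsilon>) * (real (card M) * real (card C))"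
      using d by (intro mult_right_mono) auto
    also have "\<dots> = real (e_G E M C) + 2 * \<epsilon> * (real (card M) * real (card C))"
      unfolding e_G_eq_d_G[OF finM finC] by (simp add: algebra_simps)
    also have "real (e_G E M C) \<le> ?X"
    proof -
      have "e_G E M C \<le> card {(u,v). u \<in> Z1 \<and> v \<in> C \<and> {u,v} \<in> E \<and> \<not> J u v}"
        unfolding e_G_def
      proof (rule card_mono)
        show "finite {(u,v). u \<in> Z1 \<and> v \<in> C \<and> {u,v} \<in> E \<and> \<not> J u v}"
          by (rule finite_subset[of _ "Z1 \<times> C"]) (use fin finC in auto)
      qed (use empty in \<open>auto simp: M_def\<close>)
      then show ?thesis by simp
    qed
    also have "2 * \<epsilon> * (real (card M) * real (card C)) \<le> 2 * \<epsilon> * (real (card Z1) * real (card C))"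
      using eps card_mono[OF fin(1) MZ] by (intro mult_left_mono mult_right_mono) auto
    finally show ?thesis unfolding M_def[symmetric] by linarith
  qed
qed

text \<open>One round of the argument for an abstract graph J, with D in the role of its degree. R
  is a coarse relation containing J that sees v only through its cell, so a pair outside R is an
  empty rectangle of J. The quantity T counts J-edges uv, weighted by the share of the part of u
  that R does not relate to the cell of v. It is large because cells are well separated, and small
  because such edges either are missing from E or force edges of E outside J.\<close>

lemma regularity_step:
  fixes A B V :: "nat set" and J R :: "nat \<Rightarrow> nat \<Rightarrow> bool" and cX cY :: "nat \<Rightarrow> nat" and n D :: nat
  assumes V: "V = A \<union> B" "A \<inter> B = {}" "finite A" "finite B" "card A = n" "card B = n"
    and P: "equipartition V P" "eps_regular_partition \<epsilon> E P" and eps: "0 < \<epsilon>" "\<epsilon> \<le> 1"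
    and JR: "\<And>u v. u \<in> V \<Longrightarrow> v \<in> B \<Longrightarrow> J u v \<Longrightarrow> R u (cY v)"
    and overload: "\<And>S. S \<subseteq> B \<Longrightarrow> 32 * card S \<le> n \<Longrightarrow> 256 * card {u\<in>A. D \<le> 16 * card {v\<in>S. J u v}} \<le> n"
    and dist: "\<And>u u'. u \<in> A \<Longrightarrow> u' \<in> V \<Longrightarrow> u' \<notin> A \<or> cX u' \<noteq> cX u \<Longrightarrow>
      D \<le> 8 * card {v\<in>B. J u v \<and> \<not> R u' (cY v)}"
    and diff: "real (card {(u,v). u \<in> V \<and> v \<in> B \<and> {u,v} \<in> E \<and> \<not> J u v})
      + real (card {(u,v). u \<in> A \<and> v \<in> B \<and> J u v \<and> {u,v} \<notin> E}) \<le> F"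
    and ng: "32 * card (nongood P B cY \<epsilon>) \<le> n"
  shows "real D / 16 * (badness P A cX - real n / 256) \<le> F + 24 * \<epsilon> * (real n)^2"
proof -
  have finV: "finite V" and cardV: "card V = 2*n" using V by (auto simp: card_Un_disjoint)
  note parts = equipartition_parts[OF P(1) finV]
  have AV: "A \<subseteq> V" "B \<subseteq> V" using V by auto
  define S where "S = nongood P B cY \<epsilon>"
  have SB: "S \<subseteq> B" unfolding S_def nongood_def by auto
  have finS: "finite S" using SB V finite_subset by blast
  define Ov where "Ov = {u\<in>A. D \<le> 16 * card {v\<in>S. J u v}}"
  have Ov: "real (card Ov) \<le> real n / 256" using overload[OF SB] ng unfolding Ov_def S_def by simp
  \<comment> \<open>A share of Z without any J-edge into the cell y of B.\<close>
  define \<phi> where "\<phi> Z y = real (card {u'\<in>Z. \<not> R u' y}) / real (card Z)" for Z y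
  have \<phi>: "0 \<le> \<phi> Z y \<and> \<phi> Z y \<le> 1" if "Z \<in> P" for Z y
  proof -
    have "card {u'\<in>Z. \<not> R u' y} \<le> card Z" using parts(2)[OF that] by (intro card_mono) auto
    then show ?thesis unfolding \<phi>_def using parts(2)[OF that] by simp
  qed
  define bad where "bad Z u = real (card {u'\<in>Z. u' \<notin> A \<or> cX u' \<noteq> cX u}) / real (card Z)" for Z u
  have bad1: "bad Z u \<le> 1" if "Z \<in> P" for Z u
  proof -
    have "card {u'\<in>Z. u' \<notin> A \<or> cX u' \<noteq> cX u} \<le> card Z" using parts(2)[OF that] by (intro card_mono) auto
    then show ?thesis unfolding bad_def using parts(2)[OF that] by simp
  qed
  define in_sum where "in_sum Z u = (\<Sum>v\<in>B - S. of_bool (J u v) * \<phi> Z (cY v))" for Z u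
  have in_nonneg: "in_sum Z u \<ge> 0" if "Z \<in> P" for Z u
    unfolding in_sum_def using \<phi>[OF that] by (intro sum_nonneg) auto
  define T where "T = (\<Sum>Z\<in>P. \<Sum>u\<in>Z \<inter> A. in_sum Z u)"

  have inner: "real D / 16 * (bad Z u - (of_bool (u \<in> Ov) :: real)) \<le> in_sum Z u" if Z: "Z \<in> P" and u: "u \<in> Z \<inter> A" for Z u
  proof (cases "u \<in> Ov")
    case True
    then have "real D / 16 * (bad Z u - (of_bool (u \<in> Ov) :: real)) \<le> 0"
      using bad1[OF Z, of u] by (simp add: mult_nonneg_nonpos)
    then show ?thesis using in_nonneg[OF Z, of u] by linarith
  next
    case False
    then have o: "16 * card {v\<in>S. J u v} \<le> D" using u unfolding Ov_def by auto
    have finZ: "finite Z" and cZ: "real (card Z) > 0" using parts(2)[OF Z] by auto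
    have "in_sum Z u = (\<Sum>v\<in>B - S. \<Sum>u'\<in>Z. of_bool (J u v) * of_bool (\<not> R u' (cY v)) / real (card Z))"
      unfolding in_sum_def \<phi>_def card_filter_sum[OF finZ] by (simp only: sum_distrib_left sum_divide_distrib times_divide_eq_right)
    also have "\<dots> = (\<Sum>u'\<in>Z. \<Sum>v\<in>B - S. of_bool (J u v) * of_bool (\<not> R u' (cY v)) / real (card Z))" by (rule sum.swap)
    also have "\<dots> = (\<Sum>u'\<in>Z. real (card {v\<in>B - S. J u v \<and> \<not> R u' (cY v)}) / real (card Z))"
    proof -
      have "finite (B - S)" using V by simp
      from card_filter_sum[OF this] show ?thesis by (simp only: of_bool_conj sum_divide_distrib)
    qed
    finally have eq: "in_sum Z u = (\<Sum>u'\<in>Z. real (card {v\<in>B - S. J u v \<and> \<not> R u' (cY v)}) / real (card Z))" .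
    have "real D / 16 * bad Z u = (\<Sum>u'\<in>Z. of_bool (u' \<notin> A \<or> cX u' \<noteq> cX u) * (real D / 16) / real (card Z))"
      unfolding bad_def card_filter_sum[OF finZ]
      by (simp only: sum_distrib_left sum_divide_distrib times_divide_eq_right mult.commute)
    also have "\<dots> \<le> in_sum Z u" unfolding eq
    proof (intro sum_mono divide_right_mono)
      fix u' assume u': "u' \<in> Z"
      show "of_bool (u' \<notin> A \<or> cX u' \<noteq> cX u) * (real D / 16) \<le> real (card {v\<in>B - S. J u v \<and> \<not> R u' (cY v)})"
      proof (cases "u' \<notin> A \<or> cX u' \<noteq> cX u")
        case True
        have "u' \<in> V" using u' parts(2)[OF Z] by auto
        then have D8: "D \<le> 8 * card {v\<in>B. J u v \<and> \<not> R u' (cY v)}" using dist[of u u'] u True by auto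
        have "card {v\<in>B. J u v \<and> \<not> R u' (cY v)} \<le> card ({v\<in>B - S. J u v \<and> \<not> R u' (cY v)} \<union> {v\<in>S. J u v})"
          using V(4) finS by (intro card_mono) auto
        also have "\<dots> \<le> card {v\<in>B - S. J u v \<and> \<not> R u' (cY v)} + card {v\<in>S. J u v}" by (rule card_Un_le)
        finally have "card {v\<in>B. J u v \<and> \<not> R u' (cY v)} \<le> card {v\<in>B - S. J u v \<and> \<not> R u' (cY v)} + card {v\<in>S. J u v}" .
        \<comment> \<open>At least D/8 neighbours of u tell u' apart from u, and at most D/16 of
          them lie in S because u is not overloaded.\<close>
        then have "D \<le> 16 * card {v\<in>B - S. J u v \<and> \<not> R u' (cY v)}" using D8 o by linarith
        then show ?thesis using True by simp
      qed simp
    qed simp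
    finally show ?thesis using False by simp
  qed
  have "real D / 16 * (badness P A cX - real n / 256) \<le> real D / 16 * (badness P A cX - real (card Ov))"
    using Ov by (intro mult_left_mono) auto
  also have "real (card Ov) = (\<Sum>Z\<in>P. \<Sum>u\<in>Z \<inter> A. (of_bool (u \<in> Ov) :: real))"
  proof -
    have "{u\<in>A. u \<in> Ov} = Ov" unfolding Ov_def by auto
    then have "real (card Ov) = (\<Sum>u\<in>A. (of_bool (u \<in> Ov) :: real))" using card_filter_sum[OF V(3), of "\<lambda>u. u \<in> Ov"] by (simp only:)
    then show ?thesis by (simp only: sum_over_parts[OF P(1) finV AV(1)])
  qed
  also have "real D / 16 * (badness P A cX - (\<Sum>Z\<in>P. \<Sum>u\<in>Z \<inter> A. (of_bool (u \<in> Ov) :: real)))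
     = (\<Sum>Z\<in>P. \<Sum>u\<in>Z \<inter> A. real D / 16 * (bad Z u - (of_bool (u \<in> Ov) :: real)))"
    unfolding badness_def bad_def by (simp only: sum_subtractf sum_distrib_left right_diff_distrib)
  also have "\<dots> \<le> T" unfolding T_def by (intro sum_mono inner)
  finally have lower: "real D / 16 * (badness P A cX - real n / 256) \<le> T" .

  define F1 where "F1 = real (card {(u,v). u \<in> A \<and> v \<in> B \<and> J u v \<and> {u,v} \<notin> E})"
  define F2 where "F2 = real (card {(u,v). u \<in> V \<and> v \<in> B \<and> {u,v} \<in> E \<and> \<not> J u v})"
  define t where "t Z1 Z2 = (\<Sum>u\<in>Z1 \<inter> A. \<Sum>v\<in>Z2 \<inter> (B - S). of_bool ({u,v} \<in> E) * \<phi> Z1 (cY v))" for Z1 Z2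
  have BSV: "B - S \<subseteq> V" using AV by auto
  \<comment> \<open>Weights are at most 1, so a J-edge missing from E may be charged in full to F1;
    the remaining ones are E-edges, to which regularity applies.\<close>
  have "T \<le> (\<Sum>Z\<in>P. \<Sum>u\<in>Z \<inter> A. \<Sum>v\<in>B - S. of_bool ({u,v} \<in> E) * \<phi> Z (cY v) + (of_bool (J u v \<and> {u,v} \<notin> E) :: real))"
    unfolding T_def in_sum_def
  proof (intro sum_mono)
    fix Z u v assume "Z \<in> P"
    from \<phi>[OF this, of "cY v"] show "of_bool (J u v) * \<phi> Z (cY v) \<le> of_bool ({u,v} \<in> E) * \<phi> Z (cY v) + (of_bool (J u v \<and> {u,v} \<notin> E) :: real)"
      by (auto simp: of_bool_def)
  qed
  also have "\<dots> = (\<Sum>Z\<in>P. \<Sum>u\<in>Z \<inter> A. \<Sum>v\<in>B - S. of_bool ({u,v} \<in> E) * \<phi> Z (cY v))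
      + (\<Sum>Z\<in>P. \<Sum>u\<in>Z \<inter> A. \<Sum>v\<in>B - S. (of_bool (J u v \<and> {u,v} \<notin> E) :: real))"
    by (simp only: sum.distrib)
  also have "(\<Sum>Z\<in>P. \<Sum>u\<in>Z \<inter> A. \<Sum>v\<in>B - S. (of_bool (J u v \<and> {u,v} \<notin> E) :: real)) = (\<Sum>u\<in>A. \<Sum>v\<in>B - S. (of_bool (J u v \<and> {u,v} \<notin> E) :: real))"
    by (rule sum_over_parts[OF P(1) finV AV(1)])
  also have "\<dots> \<le> (\<Sum>u\<in>A. \<Sum>v\<in>B. (of_bool (J u v \<and> {u,v} \<notin> E) :: real))"
    using V(4) by (intro sum_mono sum_mono2) auto
  also have "\<dots> = F1" unfolding F1_def by (rule card_pairs_sum[OF V(3,4), symmetric])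
  also have "(\<Sum>Z\<in>P. \<Sum>u\<in>Z \<inter> A. \<Sum>v\<in>B - S. of_bool ({u,v} \<in> E) * \<phi> Z (cY v)) = (\<Sum>Z1\<in>P. \<Sum>Z2\<in>P. t Z1 Z2)"
  proof (rule sum.cong[OF refl])
    fix Z
    have "(\<Sum>u\<in>Z \<inter> A. \<Sum>v\<in>B - S. of_bool ({u,v} \<in> E) * \<phi> Z (cY v))
      = (\<Sum>u\<in>Z \<inter> A. \<Sum>Z2\<in>P. \<Sum>v\<in>Z2 \<inter> (B - S). of_bool ({u,v} \<in> E) * \<phi> Z (cY v))"
      by (simp only: sum_over_parts[OF P(1) finV BSV])
    also have "\<dots> = (\<Sum>Z2\<in>P. t Z Z2)" unfolding t_def by (rule sum.swap)
    finally show "(\<Sum>u\<in>Z \<inter> A. \<Sum>v\<in>B - S. of_bool ({u,v} \<in> E) * \<phi> Z (cY v)) = (\<Sum>Z2\<in>P. t Z Z2)" .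
  qed
  finally have upper: "T \<le> (\<Sum>Z1\<in>P. \<Sum>Z2\<in>P. t Z1 Z2) + F1" by simp

  define X where "X Z1 Z2 = (\<Sum>u\<in>Z1. \<Sum>v\<in>Z2 \<inter> B. (of_bool ({u,v} \<in> E \<and> \<not> J u v) :: real))" for Z1 Z2
  define irr where "irr Z1 Z2 = (\<not> eps_regular_pair \<epsilon> E Z1 Z2)" for Z1 Z2
  have tle: "t Z1 Z2 \<le> X Z1 Z2 + 2 * \<epsilon> * (real (card Z1) * real (card Z2)) + of_bool (irr Z1 Z2) * (real (card Z1) * real (card Z2))"
    if Z1: "Z1 \<in> P" and Z2: "Z2 \<in> P" for Z1 Z2
  proof -
    have fin: "finite Z1" "finite Z2" "Z1 \<noteq> {}" and ZV: "Z1 \<subseteq> V" using parts(2)[OF Z1] parts(2)[OF Z2] by auto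
    have X0: "X Z1 Z2 \<ge> 0" unfolding X_def by (intro sum_nonneg) auto
    have pcol: "2 * \<epsilon> * (real (card Z1) * real (card Z2)) \<ge> 0" using eps by simp
    show ?thesis
    proof (cases "irr Z1 Z2")
      case True
      have "t Z1 Z2 \<le> (\<Sum>u\<in>Z1 \<inter> A. \<Sum>v\<in>Z2 \<inter> (B - S). 1)"
        unfolding t_def using \<phi>[OF Z1] by (intro sum_mono) (auto simp: of_bool_def)
      also have "\<dots> = real (card (Z1 \<inter> A)) * real (card (Z2 \<inter> (B - S)))" by simp
      also have "\<dots> \<le> real (card Z1) * real (card Z2)"
        using fin by (intro mult_mono) (auto intro!: card_mono)
      finally show ?thesis using True X0 pcol by simp
    next
      case False
      then have reg: "eps_regular_pair \<epsilon> E Z1 Z2" unfolding irr_def by simp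
      define Y where "Y = cY ` (Z2 \<inter> (B - S))"
      define C where "C y = {v\<in>Z2 \<inter> B. cY v = y}" for y
      have finY: "finite Y" unfolding Y_def using fin by simp
      have finC: "finite (C y)" for y unfolding C_def using fin by simp
      \<comment> \<open>One usable vertex in the cell suffices: it certifies that the whole class
        fills an \<epsilon> share of Z2.\<close>
      have big: "real (card (C y)) \<ge> \<epsilon> * real (card Z2)" if y: "y \<in> Y" for y
      proof -
        obtain v where v: "v \<in> Z2" "v \<in> B" "v \<notin> S" "cY v = y" using y unfolding Y_def by auto
        then show ?thesis using Z2 unfolding S_def nongood_def C_def by fastforce
      qed
      have "t Z1 Z2 = (\<Sum>v\<in>Z2 \<inter> (B - S). \<Sum>u\<in>Z1 \<inter> A. of_bool ({u,v} \<in> E) * \<phi> Z1 (cY v))"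
        unfolding t_def by (rule sum.swap)
      also have "\<dots> = (\<Sum>y\<in>Y. \<Sum>v\<in>{v\<in>Z2 \<inter> (B - S). cY v = y}. \<Sum>u\<in>Z1 \<inter> A. of_bool ({u,v} \<in> E) * \<phi> Z1 (cY v))"
        by (rule sum.group[symmetric]) (use fin finY in \<open>auto simp: Y_def\<close>)
      also have "\<dots> \<le> (\<Sum>y\<in>Y. (\<Sum>u\<in>Z1. \<Sum>v\<in>C y. (of_bool ({u,v} \<in> E \<and> \<not> J u v) :: real)) + 2 * \<epsilon> * (real (card Z1) * real (card (C y))))"
      proof (rule sum_mono)
        fix y assume y: "y \<in> Y"
        have "(\<Sum>v\<in>{v\<in>Z2 \<inter> (B - S). cY v = y}. \<Sum>u\<in>Z1 \<inter> A. of_bool ({u,v} \<in> E) * \<phi> Z1 (cY v))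
          = (\<Sum>v\<in>{v\<in>Z2 \<inter> (B - S). cY v = y}. \<Sum>u\<in>Z1 \<inter> A. of_bool ({u,v} \<in> E) * \<phi> Z1 y)"
          by (intro sum.cong) auto
        also have "\<dots> \<le> (\<Sum>v\<in>C y. \<Sum>u\<in>Z1 \<inter> A. of_bool ({u,v} \<in> E) * \<phi> Z1 y)"
          unfolding C_def using fin \<phi>[OF Z1] by (intro sum_mono2) (auto intro!: sum_nonneg)
        also have "\<dots> \<le> (\<Sum>v\<in>C y. \<Sum>u\<in>Z1. of_bool ({u,v} \<in> E) * \<phi> Z1 y)"
          using fin \<phi>[OF Z1] by (intro sum_mono sum_mono2) auto
        also have "\<dots> = \<phi> Z1 y * (\<Sum>u\<in>Z1. \<Sum>v\<in>C y. of_bool ({u,v} \<in> E))"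
          by (subst sum.swap) (simp only: sum_distrib_left mult.commute)
        also have "\<dots> = \<phi> Z1 y * real (e_G E Z1 (C y))"
          unfolding e_G_def using card_pairs_sum[OF fin(1) finC, where Q="\<lambda>u v. {u,v} \<in> E"] by (simp only:)
        also have "\<dots> \<le> real (card {(u,v). u \<in> Z1 \<and> v \<in> C y \<and> {u,v} \<in> E \<and> \<not> J u v}) + 2 * \<epsilon> * (real (card Z1) * real (card (C y)))"
          unfolding \<phi>_def
        proof (rule regular_pair_waste[OF reg fin(1,2) eps _ big[OF y] fin(3)])
          fix u v assume "u \<in> Z1" "\<not> R u y" "v \<in> C y"
          then show "\<not> J u v" using JR[of u v] ZV unfolding C_def by auto
        qed (auto simp: C_def)
        also have "real (card {(u,v). u \<in> Z1 \<and> v \<in> C y \<and> {u,v} \<in> E \<and> \<not> J u v}) = (\<Sum>u\<in>Z1. \<Sum>v\<in>C y. (of_bool ({u,v} \<in> E \<and> \<not> J u v) :: real))"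
          by (rule card_pairs_sum[OF fin(1) finC])
        finally show "(\<Sum>v\<in>{v\<in>Z2 \<inter> (B - S). cY v = y}. \<Sum>u\<in>Z1 \<inter> A. of_bool ({u,v} \<in> E) * \<phi> Z1 (cY v))
          \<le> (\<Sum>u\<in>Z1. \<Sum>v\<in>C y. (of_bool ({u,v} \<in> E \<and> \<not> J u v) :: real)) + 2 * \<epsilon> * (real (card Z1) * real (card (C y)))" .
      qed
      also have "\<dots> = (\<Sum>u\<in>Z1. \<Sum>y\<in>Y. \<Sum>v\<in>C y. (of_bool ({u,v} \<in> E \<and> \<not> J u v) :: real)) + 2 * \<epsilon> * (real (card Z1) * (\<Sum>y\<in>Y. real (card (C y))))"
        by (simp only: sum.distrib sum_distrib_left) (subst (1) sum.swap, rule refl)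
      also have "\<dots> \<le> X Z1 Z2 + 2 * \<epsilon> * (real (card Z1) * real (card Z2))"
      proof -
        have un: "(\<Sum>y\<in>Y. \<Sum>v\<in>C y. f v) = (\<Sum>v\<in>(\<Union>y\<in>Y. C y). f v)" for f :: "nat \<Rightarrow> real"
          by (rule sum.UNION_disjoint[symmetric]) (use finY finC in \<open>auto simp: C_def\<close>)
        have sub: "(\<Union>y\<in>Y. C y) \<subseteq> Z2 \<inter> B" unfolding C_def by auto
        have "(\<Sum>u\<in>Z1. \<Sum>y\<in>Y. \<Sum>v\<in>C y. (of_bool ({u,v} \<in> E \<and> \<not> J u v) :: real)) \<le> X Z1 Z2"
          unfolding X_def un using fin sub by (intro sum_mono sum_mono2) auto
        moreover have "(\<Sum>y\<in>Y. real (card (C y))) \<le> real (card Z2)"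
        proof -
          have "(\<Sum>y\<in>Y. real (card (C y))) = (\<Sum>v\<in>(\<Union>y\<in>Y. C y). 1)" using un[of "\<lambda>_. 1"] by simp
          also have "\<dots> \<le> (\<Sum>v\<in>Z2. 1)" using sub fin by (intro sum_mono2) auto
          finally show ?thesis by simp
        qed
        ultimately show ?thesis using eps by (intro add_mono mult_left_mono) auto
      qed
      finally show ?thesis using False by simp
    qed
  qed
  have "(\<Sum>Z1\<in>P. \<Sum>Z2\<in>P. t Z1 Z2) \<le> (\<Sum>Z1\<in>P. \<Sum>Z2\<in>P. X Z1 Z2 + 2 * \<epsilon> * (real (card Z1) * real (card Z2)) + of_bool (irr Z1 Z2) * (real (card Z1) * real (card Z2)))"
    by (intro sum_mono tle)
  also have "\<dots> = (\<Sum>Z1\<in>P. \<Sum>Z2\<in>P. X Z1 Z2) + 2 * \<epsilon> * (\<Sum>Z1\<in>P. \<Sum>Z2\<in>P. real (card Z1) * real (card Z2))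
     + (\<Sum>Z1\<in>P. \<Sum>Z2\<in>P. of_bool (irr Z1 Z2) * (real (card Z1) * real (card Z2)))"
    by (simp only: sum.distrib sum_distrib_left)
  also have "(\<Sum>Z1\<in>P. \<Sum>Z2\<in>P. X Z1 Z2) = F2"
  proof -
    have "(\<Sum>Z1\<in>P. \<Sum>Z2\<in>P. X Z1 Z2) = (\<Sum>Z1\<in>P. \<Sum>u\<in>Z1. \<Sum>Z2\<in>P. \<Sum>v\<in>Z2 \<inter> B. (of_bool ({u,v} \<in> E \<and> \<not> J u v) :: real))"
      unfolding X_def by (intro sum.cong refl sum.swap)
    also have "\<dots> = (\<Sum>Z1\<in>P. \<Sum>u\<in>Z1. \<Sum>v\<in>B. (of_bool ({u,v} \<in> E \<and> \<not> J u v) :: real))"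
      by (simp only: sum_over_parts[OF P(1) finV AV(2)])
    also have "\<dots> = (\<Sum>Z1\<in>P. \<Sum>u\<in>Z1 \<inter> V. \<Sum>v\<in>B. (of_bool ({u,v} \<in> E \<and> \<not> J u v) :: real))"
      using parts(2) by (intro sum.cong) auto
    also have "\<dots> = (\<Sum>u\<in>V. \<Sum>v\<in>B. (of_bool ({u,v} \<in> E \<and> \<not> J u v) :: real))"
      by (rule sum_over_parts[OF P(1) finV]) simp
    also have "\<dots> = F2" unfolding F2_def by (rule card_pairs_sum[OF finV V(4), symmetric])
    finally show ?thesis .
  qed
  also have "(\<Sum>Z1\<in>P. \<Sum>Z2\<in>P. real (card Z1) * real (card Z2)) = 4 * (real n)^2"
    using sum_card_parts[OF P(1) finV] unfolding sum_product[symmetric] cardV by (simp add: power2_eq_square)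
  \<comment> \<open>With k parts, a part has at most 4n/k vertices, and at most \<epsilon> k^2 pairs
    are irregular. Together with 2 \<epsilon> times (2n)^2 from the regular pairs this gives the
    24.\<close>
  also have "(\<Sum>Z1\<in>P. \<Sum>Z2\<in>P. of_bool (irr Z1 Z2) * (real (card Z1) * real (card Z2))) \<le> 16 * \<epsilon> * (real n)^2"
  proof (cases "P = {}")
    case False
    then have k: "real (card P) > 0" using parts(1) by (simp add: card_gt_0_iff)
    define m where "m = 4 * real n / real (card P)"
    have m: "real (card Z) \<le> m" if "Z \<in> P" for Z
      using part_size_le[OF P(1) finV that] k unfolding m_def cardV by (simp add: pos_le_divide_eq mult.commute)
    have "(\<Sum>Z1\<in>P. \<Sum>Z2\<in>P. of_bool (irr Z1 Z2) * (real (card Z1) * real (card Z2)))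
      \<le> (\<Sum>Z1\<in>P. \<Sum>Z2\<in>P. of_bool (irr Z1 Z2) * (m * m))"
    proof (intro sum_mono mult_left_mono mult_mono)
      show "0 \<le> m" unfolding m_def by simp
    qed (use m in auto)
    also have "\<dots> = real (card {(Z1,Z2). Z1 \<in> P \<and> Z2 \<in> P \<and> irr Z1 Z2}) * (m * m)"
      by (simp only: sum_distrib_right card_pairs_sum[OF parts(1) parts(1)])
    also have "\<dots> \<le> (\<epsilon> * (real (card P))^2) * (m * m)"
      using P(2) unfolding eps_regular_partition_def irr_def by (intro mult_right_mono) auto
    also have "\<dots> = 16 * \<epsilon> * (real n)^2" unfolding m_def using k by (simp add: power2_eq_square field_simps)
    finally show ?thesis .
  qed (use eps in simp)
  finally have "(\<Sum>Z1\<in>P. \<Sum>Z2\<in>P. t Z1 Z2) \<le> F2 + 24 * \<epsilon> * (real n)^2" by simp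
  then show ?thesis using lower upper diff unfolding F1_def F2_def by linarith
qed

text \<open>A vertex whose cell fills less than half of its part contributes at least 1/2 to the
  badness.\<close>

lemma nongood_le_badness:
  assumes P: "equipartition V P" and V: "finite V" "A \<subseteq> V" and eps: "\<epsilon> \<le> 1/2"
  shows "real (card (nongood P A c \<epsilon>)) \<le> 2 * badness P A c"
proof -
  note parts = equipartition_parts[OF P V(1)]
  have finA: "finite A" using V finite_subset by blast
  have "{u\<in>A. u \<in> nongood P A c \<epsilon>} = nongood P A c \<epsilon>" unfolding nongood_def by auto
  then have "real (card (nongood P A c \<epsilon>)) = (\<Sum>u\<in>A. (of_bool (u \<in> nongood P A c \<epsilon>) :: real))"
    using card_filter_sum[OF finA, of "\<lambda>u. u \<in> nongood P A c \<epsilon>"] by (simp only:)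
  also have "\<dots> = (\<Sum>Z\<in>P. \<Sum>u\<in>Z \<inter> A. (of_bool (u \<in> nongood P A c \<epsilon>) :: real))"
    by (rule sum_over_parts[OF P V, symmetric])
  also have "\<dots> \<le> (\<Sum>Z\<in>P. \<Sum>u\<in>Z \<inter> A. 2 * (real (card {u'\<in>Z. u' \<notin> A \<or> c u' \<noteq> c u}) / real (card Z)))"
  proof (intro sum_mono)
    fix Z u assume Z: "Z \<in> P" and u: "u \<in> Z \<inter> A"
    have finZ: "finite Z" and cZ: "real (card Z) > 0" using parts(2)[OF Z] by auto
    show "(of_bool (u \<in> nongood P A c \<epsilon>) :: real) \<le> 2 * (real (card {u'\<in>Z. u' \<notin> A \<or> c u' \<noteq> c u}) / real (card Z))"
    proof (cases "u \<in> nongood P A c \<epsilon>")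
      case True
      then obtain Z' where Z': "Z' \<in> P" "u \<in> Z'" "real (card {v'\<in>Z' \<inter> A. c v' = c u}) < \<epsilon> * real (card Z')"
        unfolding nongood_def by auto
      have "Z' = Z" using Z Z' u parts(3) unfolding disjoint_family_on_def by blast
      then have small: "real (card {v'\<in>Z \<inter> A. c v' = c u}) \<le> 1/2 * real (card Z)"
        using Z'(3) mult_right_mono[OF eps, of "real (card Z)"] by simp
      have "card Z = card ({v'\<in>Z \<inter> A. c v' = c u} \<union> {u'\<in>Z. u' \<notin> A \<or> c u' \<noteq> c u})"
        by (rule arg_cong[where f=card]) auto
      also have "\<dots> \<le> card {v'\<in>Z \<inter> A. c v' = c u} + card {u'\<in>Z. u' \<notin> A \<or> c u' \<noteq> c u}" by (rule card_Un_le)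
      finally have "real (card Z) \<le> 2 * real (card {u'\<in>Z. u' \<notin> A \<or> c u' \<noteq> c u})" using small by linarith
      then show ?thesis using cZ True by (simp add: pos_le_divide_eq)
    qed simp
  qed
  also have "\<dots> = 2 * badness P A c" unfolding badness_def by (simp only: sum_distrib_left)
  finally show ?thesis .
qed

text \<open>Inside one part and one cell the unusable vertices number less than \<epsilon> times the
  part. Summing over q cells is a good bound only while q is far below 1/\<epsilon>; it starts the
  induction over the levels.\<close>

lemma nongood_few_cells:
  assumes P: "equipartition V P" and V: "finite V" "B \<subseteq> V" and eps: "\<epsilon> \<ge> 0" and cells: "card (c ` B) \<le> q"
  shows "real (card (nongood P B c \<epsilon>)) \<le> \<epsilon> * real q * real (card V)"
proof -
  note parts = equipartition_parts[OF P V(1)]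
  have finB: "finite B" using V finite_subset by blast
  define I where "I = {(Z,y). Z \<in> P \<and> y \<in> c ` B \<and> real (card {v'\<in>Z \<inter> B. c v' = y}) < \<epsilon> * real (card Z)}"
  define C where "C = (\<lambda>(Z,y). {v'\<in>Z \<inter> B. c v' = (y::nat)})"
  have I: "I \<subseteq> P \<times> c ` B" unfolding I_def by auto
  have finI: "finite I" by (rule finite_subset[OF I]) (use parts(1) finB in auto)
  have "nongood P B c \<epsilon> \<subseteq> (\<Union>i\<in>I. C i)" unfolding nongood_def I_def C_def by fastforce
  moreover have "finite (\<Union>i\<in>I. C i)" using finI finB unfolding C_def by auto
  ultimately have "card (nongood P B c \<epsilon>) \<le> card (\<Union>i\<in>I. C i)" by (intro card_mono)
  also have "\<dots> \<le> (\<Sum>i\<in>I. card (C i))" by (rule card_UN_le[OF finI])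
  finally have "real (card (nongood P B c \<epsilon>)) \<le> (\<Sum>i\<in>I. real (card (C i)))" by (metis of_nat_le_iff of_nat_sum)
  also have "\<dots> \<le> (\<Sum>(Z,y)\<in>I. \<epsilon> * real (card Z))" unfolding I_def C_def by (intro sum_mono) auto
  also have "\<dots> \<le> (\<Sum>(Z,y)\<in>P \<times> c ` B. \<epsilon> * real (card Z))"
    by (rule sum_mono2) (use I parts(1) finB eps in auto)
  also have "\<dots> = \<epsilon> * real (card (c ` B)) * (\<Sum>Z\<in>P. real (card Z))"
    by (simp add: sum.cartesian_product[symmetric] sum_distrib_left mult_ac)
  also have "\<dots> = \<epsilon> * real (card (c ` B)) * real (card V)" using sum_card_parts[OF P V(1)] by simp
  also have "\<dots> \<le> \<epsilon> * real q * real (card V)"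
    using cells eps by (intro mult_right_mono mult_left_mono) auto
  finally show ?thesis .
qed

text \<open>By averaging, some vertex has a cell that covers more than half of its part. That part
  then has at most 2q vertices, and in an equipartition one small part makes all parts
  small.\<close>

lemma card_parts_ge:
  assumes P: "equipartition V P" and V: "finite V" "A \<subseteq> V" "A \<noteq> {}"
    and bad: "2 * badness P A c < real (card A)" and cells: "\<And>y. card {u\<in>A. c u = y} \<le> q"
  shows "card V \<le> card P * (2*q+1)"
proof -
  note parts = equipartition_parts[OF P V(1)]
  have finA: "finite A" using V finite_subset by blast
  have "\<exists>Z\<in>P. \<exists>u\<in>Z \<inter> A. 2 * (real (card {u'\<in>Z. u' \<notin> A \<or> c u' \<noteq> c u}) / real (card Z)) < 1"
  proof (rule ccontr)
    assume "\<not> ?thesis"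
    then have "(\<Sum>Z\<in>P. \<Sum>u\<in>Z \<inter> A. 1) \<le> (\<Sum>Z\<in>P. \<Sum>u\<in>Z \<inter> A. 2 * (real (card {u'\<in>Z. u' \<notin> A \<or> c u' \<noteq> c u}) / real (card Z)))"
      by (intro sum_mono) (meson linorder_not_less)
    also have "\<dots> = 2 * badness P A c" unfolding badness_def by (simp only: sum_distrib_left)
    also have "(\<Sum>Z\<in>P. \<Sum>u\<in>Z \<inter> A. 1) = real (card A)" using sum_over_parts[OF P V(1,2), of "\<lambda>_. 1"] by simp
    finally show False using bad by simp
  qed
  then obtain Z u where Z: "Z \<in> P" and u: "u \<in> Z \<inter> A"
    and b: "2 * (real (card {u'\<in>Z. u' \<notin> A \<or> c u' \<noteq> c u}) / real (card Z)) < 1" by auto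
  have finZ: "finite Z" and cZ: "real (card Z) > 0" using parts(2)[OF Z] by auto
  have b': "2 * real (card {u'\<in>Z. u' \<notin> A \<or> c u' \<noteq> c u}) < real (card Z)"
    using b cZ by (simp add: pos_divide_less_eq)
  have "card Z \<le> card ({u'\<in>A. c u' = c u} \<union> {u'\<in>Z. u' \<notin> A \<or> c u' \<noteq> c u})"
    using finA finZ by (intro card_mono) auto
  also have "\<dots> \<le> card {u'\<in>A. c u' = c u} + card {u'\<in>Z. u' \<notin> A \<or> c u' \<noteq> c u}" by (rule card_Un_le)
  finally have "card Z \<le> 2 * q" using b' cells[of "c u"] by linarith
  then have q: "card Z \<le> 2 * q" .
  have le: "card Z' \<le> 2*q+1" if "Z' \<in> P" for Z'
  proof -
    have "card Z' \<le> card Z + 1" using P Z that unfolding equipartition_def by blast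
    then show ?thesis using q by simp
  qed
  have "card V \<le> (\<Sum>Z\<in>P. card Z)" using card_UN_le[OF parts(1), of "\<lambda>Z. Z"] parts(4) by simp
  also have "\<dots> \<le> (\<Sum>Z\<in>P. 2*q+1)" by (intro sum_mono le)
  finally show ?thesis by simp
qed

section \<open>A balanced, orthogonal code with large distance\<close>

lemma sum_divmod:
  fixes F :: "nat \<Rightarrow> nat \<Rightarrow> 'a::comm_monoid_add"
  assumes "K > 0"
  shows "(\<Sum>z<a*K. F (z div K) (z mod K)) = (\<Sum>x<a. \<Sum>j<K. F x j)"
proof -
  have "(\<Sum>z<a*K. F (z div K) (z mod K)) = (\<Sum>(x,j)\<in>{..<a}\<times>{..<K}. F x j)"
  proof (rule sum.reindex_bij_witness[where i="\<lambda>(x,j). x*K+j" and j="\<lambda>z. (z div K, z mod K)"])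
    fix b assume "b \<in> {..<a}\<times>{..<K}"
    then obtain x j where b: "b=(x,j)" "x<a" "j<K" by auto
    have "x*K+j < (x+1)*K" using b by simp
    also have "\<dots> \<le> a*K" using b by (intro mult_right_mono) auto
    finally show "(case b of (x, j) \<Rightarrow> x * K + j) \<in> {..<a * K}" using b by simp
  qed (use assms in \<open>auto simp: less_mult_imp_div_less\<close>)
  then show ?thesis by (simp add: sum.cartesian_product)
qed

lemma card_eq_sum_of_bool:
  "card {z::nat. z < n \<and> Q z} = (\<Sum>z<n. of_bool (Q z))"
proof -
  have "{z. z < n \<and> Q z} = {..<n} \<inter> {z. Q z}" by auto
  then show ?thesis by (simp add: sum.inter_restrict Int_commute)
qed

lemma card_divmod:
  assumes "K > (0::nat)"
  shows "card {z. z < a*K \<and> Q (z div K) (z mod K)} = (\<Sum>x<a. card {j. j<K \<and> Q x j})"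
  unfolding card_eq_sum_of_bool by (rule sum_divmod[OF assms, of "\<lambda>x j. of_bool (Q x j)"])

lemma card_compl_half:
  assumes "2 * card {z::nat. z < n \<and> Q z} = n"
  shows "2 * card {z. z < n \<and> \<not> Q z} = n"
proof -
  have "card {z. z < n \<and> Q z} + card {z. z < n \<and> \<not> Q z} = card ({z. z < n \<and> Q z} \<union> {z. z < n \<and> \<not> Q z})"
    by (rule card_Un_disjoint[symmetric]) auto
  also have "{z. z < n \<and> Q z} \<union> {z. z < n \<and> \<not> Q z} = {..<n}" by auto
  finally show ?thesis using assms by simp
qed

section \<open>Hadamard words: inner products of binary digit vectors modulo 2\<close>

fun bit_inner :: "nat \<Rightarrow> nat \<Rightarrow> nat \<Rightarrow> bool" where
  "bit_inner 0 q v = False"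
| "bit_inner (Suc n) q v = ((odd q \<and> odd v) \<noteq> bit_inner n (q div 2) (v div 2))"

lemma bit_inner_sym: "bit_inner n q v = bit_inner n v q"
  by (induction n arbitrary: q v) auto

text \<open>The two inner products differ exactly where q has inner product 1 with the nonzero
  vector v + v', and a nonzero linear functional is balanced. The induction splits off the lowest
  digit.\<close>

lemma bit_inner_half:
  "v < 2^n \<Longrightarrow> v' < 2^n \<Longrightarrow> v \<noteq> v' \<Longrightarrow> 2 * card {q. q < 2^n \<and> bit_inner n q v \<noteq> bit_inner n q v'} = 2^n"
proof (induction n arbitrary: v v')
  case (Suc n)
  define Q where "Q = (\<lambda>(q::nat) (e::nat). ((odd e \<and> odd v) \<noteq> bit_inner n q (v div 2)) \<noteq> ((odd e \<and> odd v') \<noteq> bit_inner n q (v' div 2)))"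
  have "card {q. q < 2^Suc n \<and> bit_inner (Suc n) q v \<noteq> bit_inner (Suc n) q v'}
      = card {q. q < 2^n*2 \<and> Q (q div 2) (q mod 2)}"
    by (rule arg_cong[where f=card]) (auto simp: Q_def mult.commute)
  also have "\<dots> = (\<Sum>x<(2::nat)^n. card {j. j<2 \<and> Q x j})" by (rule card_divmod) simp
  also have "\<dots> = (\<Sum>x<(2::nat)^n. of_bool (Q x 0) + of_bool (Q x 1))"
    unfolding card_eq_sum_of_bool by (simp add: numeral_2_eq_2)
  also have "\<dots> = card {x. x < 2^n \<and> Q x 0} + card {x. x < 2^n \<and> Q x 1}"
    unfolding card_eq_sum_of_bool by (simp add: sum.distrib)
  finally have eq: "card {q. q < 2^Suc n \<and> bit_inner (Suc n) q v \<noteq> bit_inner (Suc n) q v'}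
      = card {x. x < 2^n \<and> Q x 0} + card {x. x < 2^n \<and> Q x 1}" .
  show ?case
  proof (cases "v div 2 = v' div 2")
    case True
    then have "odd v \<noteq> odd v'" using Suc.prems by (metis dvd_mult_div_cancel odd_two_times_div_two_succ)
    then have "{x. x < 2^n \<and> Q x 0} = {}" "{x. x < 2^n \<and> Q x 1} = {..<2^n}"
      unfolding Q_def using True by auto
    then show ?thesis unfolding eq by simp
  next
    case False
    have IH: "2 * card {q. q < 2^n \<and> bit_inner n q (v div 2) \<noteq> bit_inner n q (v' div 2)} = 2^n"
      using Suc.prems by (intro Suc.IH False) auto
    have 0: "2 * card {x. x < 2^n \<and> Q x 0} = 2^n" using IH unfolding Q_def by simp
    have 1: "2 * card {x. x < 2^n \<and> Q x 1} = 2^n"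
    proof (cases "odd v = odd v'")
      case True
      then have "Q x 1 = (bit_inner n x (v div 2) \<noteq> bit_inner n x (v' div 2))" for x unfolding Q_def by auto
      then show ?thesis using IH by simp
    next
      case False
      then have "Q x 1 = (\<not>(bit_inner n x (v div 2) \<noteq> bit_inner n x (v' div 2)))" for x unfolding Q_def by auto
      then show ?thesis using card_compl_half[OF IH] by simp
    qed
    show ?thesis unfolding eq using 0 1 by simp
  qed
qed simp

text \<open>Affine functions of the digits of k: \<open>q div 2\<close> is the linear part and the
  parity of q the constant term. These are the rows of a Hadamard matrix and their complements, that
  is, the first-order Reed-Muller code.\<close>

definition hadamard :: "nat \<Rightarrow> nat \<Rightarrow> nat \<Rightarrow> bool" where
  "hadamard r q k = (odd q \<noteq> bit_inner r (q div 2) k)"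

lemma card_lt_2: "card {j::nat. j < 2 \<and> Q j} = of_bool (Q 0) + of_bool (Q 1)"
  unfolding card_eq_sum_of_bool by (simp add: numeral_2_eq_2)

lemma hadamard_balanced: "card {q. q < 2^r*2 \<and> hadamard r q k = b} = 2^r"
proof -
  define Q where "Q = (\<lambda>(x::nat) (e::nat). (odd e \<noteq> bit_inner r x k) = b)"
  have "card {q. q < 2^r*2 \<and> hadamard r q k = b} = card {q. q < 2^r*2 \<and> Q (q div 2) (q mod 2)}"
    by (rule arg_cong[where f=card]) (auto simp: Q_def hadamard_def)
  also have "\<dots> = (\<Sum>x<(2::nat)^r. card {j. j<2 \<and> Q x j})" by (rule card_divmod) simp
  also have "\<dots> = (\<Sum>x<(2::nat)^r. 1)" unfolding card_lt_2 by (rule sum.cong) (auto simp: Q_def)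
  finally show ?thesis by simp
qed

lemma hadamard_orthogonal:
  assumes "k < 2^r" "k' < 2^r" "k \<noteq> k'"
  shows "card {q. q < 2^r*2 \<and> hadamard r q k \<noteq> hadamard r q k'} = 2^r"
proof -
  define Q where "Q = (\<lambda>(x::nat) (e::nat). bit_inner r x k \<noteq> bit_inner r x k')"
  have "card {q. q < 2^r*2 \<and> hadamard r q k \<noteq> hadamard r q k'} = card {q. q < 2^r*2 \<and> Q (q div 2) (q mod 2)}"
    by (rule arg_cong[where f=card]) (auto simp: Q_def hadamard_def)
  also have "\<dots> = (\<Sum>x<(2::nat)^r. card {j. j<2 \<and> Q x j})" by (rule card_divmod) simp
  also have "\<dots> = (\<Sum>x<(2::nat)^r. 2 * of_bool (bit_inner r x k \<noteq> bit_inner r x k'))" unfolding card_lt_2 by (rule sum.cong) (auto simp: Q_def)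
  also have "\<dots> = 2 * card {x. x < 2^r \<and> bit_inner r x k \<noteq> bit_inner r x k'}"
    unfolding card_eq_sum_of_bool by (simp only: sum_distrib_left)
  finally show ?thesis using bit_inner_half[OF assms] by simp
qed

text \<open>Words with equal linear part are complementary; otherwise their sum is a nonconstant
  affine function, which is balanced.\<close>

lemma hadamard_distance:
  assumes "q < 2^r*2" "q' < 2^r*2" "q \<noteq> q'"
  shows "2 * card {k. k < 2^r \<and> hadamard r q k \<noteq> hadamard r q' k} \<ge> 2^r"
proof (cases "q div 2 = q' div 2")
  case True
  then have "odd q \<noteq> odd q'" using assms by (metis dvd_mult_div_cancel odd_two_times_div_two_succ)
  then have "{k. k < 2^r \<and> hadamard r q k \<noteq> hadamard r q' k} = {..<2^r}"
    using True by (auto simp: hadamard_def)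
  then show ?thesis by simp
next
  case False
  have H: "2 * card {k. k < 2^r \<and> bit_inner r k (q div 2) \<noteq> bit_inner r k (q' div 2)} = 2^r"
    using assms by (intro bit_inner_half False) auto
  have "2 * card {k. k < 2^r \<and> hadamard r q k \<noteq> hadamard r q' k} = 2^r"
  proof (cases "odd q = odd q'")
    case True
    then have "hadamard r q k \<noteq> hadamard r q' k \<longleftrightarrow> (bit_inner r k (q div 2) \<noteq> bit_inner r k (q' div 2))" for k
      unfolding hadamard_def using bit_inner_sym[of r k] by auto
    then show ?thesis using H by simp
  next
    case False
    then have "hadamard r q k \<noteq> hadamard r q' k \<longleftrightarrow> \<not> (bit_inner r k (q div 2) \<noteq> bit_inner r k (q' div 2))" for k
      unfolding hadamard_def using bit_inner_sym[of r k] by auto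
    then show ?thesis using card_compl_half[OF H] by simp
  qed
  then show ?thesis by simp
qed

section \<open>Volume of a Hamming ball\<close>

lemma sum_subsets_power:
  "(\<Sum>T\<in>Pow {..<h}. (8::nat)^(h - card T)) = 9^h"
proof -
  have "(\<Sum>T\<in>Pow {..<h}. (8::nat)^(h - card T)) = (\<Sum>k\<le>h. \<Sum>T\<in>{T\<in>Pow {..<h}. card T = k}. 8^(h - card T))"
    by (rule sum.group[symmetric]) (auto simp: card_mono[of "{..<h}", simplified])
  also have "\<dots> = (\<Sum>k\<le>h. (h choose k) * 8^(h-k))"
    by (rule sum.cong) (use n_subsets[of "{..<h}"] in auto)
  also have "\<dots> = (1+8)^h" using binomial[of 1 8 h] by simp
  finally show ?thesis by simp
qed

text \<open>Under the weight 8^(8g - |T|) all subsets together weigh 9^(8g), while each set in the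
  ball of radius g weighs at least 8^(7g). The base 8 is close to the optimal choice 7 for relative
  radius 1/8.\<close>

lemma hamming_ball_card:
  "card {T. T \<subseteq> {..<8*g} \<and> 8 * card T < 8*g} * (8^7)^g \<le> (9^8)^g"
proof -
  let ?B = "{T. T \<subseteq> {..<8*g} \<and> 8 * card T < 8*g}"
  have "card ?B * (8^7)^g = (\<Sum>T\<in>?B. 8^(7*g))" by (simp add: power_mult)
  also have "\<dots> \<le> (\<Sum>T\<in>?B. 8^(8*g - card T))"
    by (intro sum_mono power_increasing) auto
  also have "\<dots> \<le> (\<Sum>T\<in>Pow {..<8*g}. 8^(8*g - card T))"
    by (intro sum_mono2) auto
  also have "\<dots> = (9^8)^g" unfolding sum_subsets_power by (rule power_mult)
  finally show ?thesis .
qed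

text \<open>Since 9^8 is at most 21 * 8^7, the ball has at most 21^g elements. There will be 4^g
  codewords and 16g Hadamard words, with 16g < 3^g, and 4 * 3 * 21 = 252 stays below 2^8.\<close>

lemma hamming_ball_small:
  assumes "g \<ge> 5"
  shows "4^g * (16*g) * card {T. T \<subseteq> {..<8*g} \<and> 8 * card T < 8*g} < (2::nat)^(8*g)"
proof -
  let ?V = "card {T. T \<subseteq> {..<8*g} \<and> 8 * card T < 8*g}"
  have "?V * (8^7)^g \<le> (21*8^7)^g"
    by (rule order.trans[OF hamming_ball_card]) (intro power_mono, auto)
  then have "?V * (8^7)^g \<le> 21^g * (8^7)^g" by (simp only: power_mult_distrib)
  then have V: "?V \<le> 21^g" by simp
  have g3: "16*g < 3^g" using assms by (induction g rule: dec_induct) auto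
  have "4^g * (16*g) * ?V \<le> 4^g * (16*g) * 21^g" using V by (intro mult_left_mono) auto
  also have "\<dots> < 4^g * 3^g * 21^g" using g3 by simp
  also have "\<dots> = (4*3*21)^g" by (simp only: power_mult_distrib)
  also have "\<dots> \<le> (2^8)^g" by (intro power_mono) auto
  finally show ?thesis by (simp only: power_mult)
qed

text \<open>The conditions on columns (balance, pairwise orthogonality) will give exact degrees and
  the spectral gap; the condition on rows (relative distance 1/8 at rate 1/4) will give the
  separation of cells.\<close>

definition code_ok :: "nat \<Rightarrow> (nat \<Rightarrow> nat \<Rightarrow> bool) \<Rightarrow> bool" where
  "code_ok h w \<longleftrightarrow>
    (\<forall>k<h. 2 * card {j. j < 2^(h div 4) \<and> w j k} = 2^(h div 4)) \<and>
    (\<forall>k<h. \<forall>k'<h. k \<noteq> k' \<longrightarrow> 2 * card {j. j < 2^(h div 4) \<and> w j k \<noteq> w j k'} = 2^(h div 4)) \<and>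
    (\<forall>j<2^(h div 4). \<forall>j'<2^(h div 4). j \<noteq> j' \<longrightarrow> h \<le> 8 * card {k. k < h \<and> w j k \<noteq> w j' k})"

text \<open>A Gilbert--Varshamov choice.  The words \<open>b q\<close> will be Hadamard words: translating a code by
  all of them makes its coordinates orthogonal, and it must keep its distance.\<close>

lemma greedy_words:
  fixes b :: "nat \<Rightarrow> nat set"
  assumes sub: "\<And>q. q < M \<Longrightarrow> b q \<subseteq> {..<h}"
    and small: "N * M * M * card {T. T \<subseteq> {..<h} \<and> 8 * card T < h} < 2^h"
  shows "\<exists>a. (\<forall>i<N. a i \<subseteq> {..<h}) \<and>
    (\<forall>i<N. \<forall>i'<N. i \<noteq> i' \<longrightarrow> (\<forall>q<M. \<forall>q'<M. h \<le> 8 * card (sym_diff (a i) (sym_diff (a i') (sym_diff (b q) (b q'))))))"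
  using small
proof (induction N)
  case (Suc N)
  let ?V = "{T. T \<subseteq> {..<h} \<and> 8 * card T < h}"
  have le: "N * M * M * card ?V \<le> Suc N * M * M * card ?V" by (intro mult_right_mono) auto
  then obtain a where a: "\<forall>i<N. a i \<subseteq> {..<h}"
    "\<forall>i<N. \<forall>i'<N. i \<noteq> i' \<longrightarrow> (\<forall>q<M. \<forall>q'<M. h \<le> 8 * card (sym_diff (a i) (sym_diff (a i') (sym_diff (b q) (b q')))))"
    using Suc.IH[OF le_less_trans[OF le Suc.prems]] by blast
  \<comment> \<open>The new word has to avoid the ball around every old word shifted by the
    difference of two words \<open>b q\<close>, since both words of a pair will be translated
    independently.\<close>
  define cen where "cen = (\<lambda>(i,q,q'). sym_diff (a i) (sym_diff (b q) (b q')))"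
  define I where "I = {..<N} \<times> {..<M} \<times> {..<M}"
  have finI: "finite I" and cardI: "card I = N * M * M" unfolding I_def by (simp_all add: card_cartesian_product)
  define F where "F = (\<Union>x\<in>I. (\<lambda>T. sym_diff T (cen x)) ` ?V)"
  have finV: "finite ?V" by (rule finite_subset[of _ "Pow {..<h}"]) auto
  have "card F \<le> (\<Sum>x\<in>I. card ((\<lambda>T. sym_diff T (cen x)) ` ?V))"
    unfolding F_def by (rule card_UN_le[OF finI])
  also have "\<dots> \<le> (\<Sum>x\<in>I. card ?V)" by (intro sum_mono card_image_le finV)
  also have "\<dots> = N * M * M * card ?V" by (simp add: cardI)
  also have "\<dots> < 2^h" using le_less_trans[OF le Suc.prems] .
  finally have "card F < card (Pow {..<h})" by (simp add: card_Pow)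
  moreover have "finite F" unfolding F_def using finI finV by auto
  ultimately obtain c where c: "c \<subseteq> {..<h}" "c \<notin> F"
    by (metis (no_types, lifting) card_mono linorder_not_less PowD subsetI)
  have far: "h \<le> 8 * card (sym_diff c (sym_diff (a i) (sym_diff (b q) (b q'))))"
    if "i < N" "q < M" "q' < M" for i q q'
  proof (rule ccontr)
    assume "\<not> ?thesis"
    moreover have "cen (i,q,q') \<subseteq> {..<h}" using a(1) that sub[of q] sub[of q'] unfolding cen_def by auto
    ultimately have "sym_diff c (cen (i,q,q')) \<in> ?V" using c(1) unfolding cen_def by auto
    moreover have "c = sym_diff (sym_diff c (cen (i,q,q'))) (cen (i,q,q'))" by auto
    ultimately have "c \<in> F" unfolding F_def I_def using that by blast
    then show False using c by simp
  qed
  have far': "h \<le> 8 * card (sym_diff (a i) (sym_diff c (sym_diff (b q) (b q'))))"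
    if "i < N" "q < M" "q' < M" for i q q'
  proof -
    have "sym_diff (a i) (sym_diff c (sym_diff (b q) (b q'))) = sym_diff c (sym_diff (a i) (sym_diff (b q) (b q')))"
      by auto
    then show ?thesis using far[OF that] by simp
  qed
  show ?case
  proof (intro exI[of _ "a(N := c)"] conjI allI impI)
    fix i assume "i < Suc N" then show "(a(N:=c)) i \<subseteq> {..<h}" using a(1) c(1) by (auto simp: less_Suc_eq)
  next
    fix i i' q q' assume "i < Suc N" "i' < Suc N" "i \<noteq> i'" "q < M" "q' < M"
    then show "h \<le> 8 * card (sym_diff ((a(N := c)) i) (sym_diff ((a(N := c)) i') (sym_diff (b q) (b q'))))"
      using a(2) far far' by (cases "i = N"; cases "i' = N") (simp_all add: less_Suc_eq)
  qed
qed simp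

text \<open>Codeword j is the word \<open>a (j div M)\<close> translated by Hadamard word
  \<open>j mod M\<close>. For each fixed a the translates alone balance every coordinate and make
  any two orthogonal, whatever a is. Distances come from the Hadamard words within one a, and from
  the greedy choice across different ones.\<close>

lemma code_exists:
  assumes "r \<ge> 8"
  shows "\<exists>w. code_ok (2^r) w"
proof -
  define h g :: nat where "h = 2^r" and "g = 2^(r-3)"
  have "r = 3 + (r-3)" using assms by simp
  then have "(2::nat)^r = 2^3 * 2^(r-3)" by (metis power_add)
  then have hg: "h = 8*g" unfolding h_def g_def by simp
  have "(2::nat)^5 \<le> g" unfolding g_def using assms by (intro power_increasing) auto
  then have g5: "g \<ge> 5" by simp
  define M where "M = 2^r*(2::nat)"
  have M: "M = 16*g" using hg unfolding M_def h_def by simp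
  have hd4: "h div 4 = 2*g" using hg by simp
  have rl: "r + 1 \<le> 2*g"
  proof -
    have "x + 4 \<le> 2*2^(x::nat)" if "x \<ge> 2" for x using that by (induction x rule: dec_induct) auto
    from this[of "r-3"] show ?thesis using assms unfolding g_def by simp
  qed
  define N where "N = (2::nat)^(2*g - (r+1))"
  have "N * M = 2^(2*g - (r+1)) * 2^(r+1)" unfolding N_def M_def by simp
  also have "\<dots> = 2^(h div 4)" unfolding hd4 power_add[symmetric] using rl by simp
  finally have NM: "N * M = 2^(h div 4)" .
  define b where "b q = {k. k < h \<and> hadamard r q k}" for q
  have "N * M * M * card {T. T \<subseteq> {..<h} \<and> 8 * card T < h} < 2^h"
    using hamming_ball_small[OF g5] unfolding NM hd4 unfolding M hg by (simp add: power_mult)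
  from greedy_words[of M b h N, OF _ this] obtain a where a: "\<And>i. i<N \<Longrightarrow> a i \<subseteq> {..<h}"
    "\<And>i i' q q'. \<lbrakk>i<N; i'<N; i \<noteq> i'; q<M; q'<M\<rbrakk> \<Longrightarrow> h \<le> 8 * card (sym_diff (a i) (sym_diff (a i') (sym_diff (b q) (b q'))))"
    unfolding b_def by (smt (verit, ccfv_threshold) lessThan_iff mem_Collect_eq subsetI)
  define w where "w j k = ((k \<in> a (j div M)) \<noteq> hadamard r (j mod M) k)" for j k
  have M0: "M > 0" unfolding M_def by simp
  have dm: "j div M < N \<and> j mod M < M" if "j < N * M" for j
    using that M0 by (simp add: less_mult_imp_div_less)
  have "code_ok h w"
    unfolding code_ok_def NM[symmetric]
  proof (intro conjI allI impI)
    fix k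
    have "card {j. j < N*M \<and> w j k} = (\<Sum>x<N. card {q. q < M \<and> ((k \<in> a x) \<noteq> hadamard r q k)})"
      unfolding w_def by (rule card_divmod[OF M0])
    also have "\<dots> = (\<Sum>x<N. 2^r)"
    proof (rule sum.cong)
      fix x
      have "{q. q < M \<and> ((k \<in> a x) \<noteq> hadamard r q k)} = {q. q < 2^r*2 \<and> hadamard r q k = (k \<notin> a x)}"
        unfolding M_def by auto
      then show "card {q. q < M \<and> ((k \<in> a x) \<noteq> hadamard r q k)} = 2^r" by (simp only: hadamard_balanced)
    qed simp
    finally show "2 * card {j. j < N*M \<and> w j k} = N * M" by (simp add: M_def)
  next
    fix k k' assume k: "k < h" "k' < h" "k \<noteq> k'"
    have "card {j. j < N*M \<and> w j k \<noteq> w j k'} = (\<Sum>x<N. card {q. q < M \<and> ((k \<in> a x) \<noteq> hadamard r q k) \<noteq> ((k' \<in> a x) \<noteq> hadamard r q k')})"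
      unfolding w_def by (rule card_divmod[OF M0])
    also have "\<dots> = (\<Sum>x<N. 2^r)"
    proof (rule sum.cong)
      fix x
      note O = hadamard_orthogonal[OF k[unfolded h_def]]
      have O2: "card {q. q < 2^r*2 \<and> hadamard r q k = hadamard r q k'} = 2^r"
        using card_compl_half[of "2^r*2" "\<lambda>q. hadamard r q k \<noteq> hadamard r q k'"] O by simp
      show "card {q. q < M \<and> ((k \<in> a x) \<noteq> hadamard r q k) \<noteq> ((k' \<in> a x) \<noteq> hadamard r q k')} = 2^r"
      proof (cases "(k \<in> a x) = (k' \<in> a x)")
        case True
        then have "{q. q < M \<and> ((k \<in> a x) \<noteq> hadamard r q k) \<noteq> ((k' \<in> a x) \<noteq> hadamard r q k')} = {q. q < 2^r*2 \<and> hadamard r q k \<noteq> hadamard r q k'}"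
          unfolding M_def by auto
        then show ?thesis using O by simp
      next
        case False
        then have "{q. q < M \<and> ((k \<in> a x) \<noteq> hadamard r q k) \<noteq> ((k' \<in> a x) \<noteq> hadamard r q k')} = {q. q < 2^r*2 \<and> hadamard r q k = hadamard r q k'}"
          unfolding M_def by auto
        then show ?thesis using O2 by simp
      qed
    qed simp
    finally show "2 * card {j. j < N*M \<and> w j k \<noteq> w j k'} = N * M" by (simp add: M_def)
  next
    fix j j' assume j: "j < N*M" "j' < N*M" "j \<noteq> j'"
    show "h \<le> 8 * card {k. k < h \<and> w j k \<noteq> w j' k}"
    proof (cases "j div M = j' div M")
      case True
      then have "j mod M \<noteq> j' mod M" using j(3) by (metis div_mult_mod_eq)
      with dm[OF j(1)] dm[OF j(2)] have "2^r \<le> 2 * card {k. k < 2^r \<and> hadamard r (j mod M) k \<noteq> hadamard r (j' mod M) k}"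
        unfolding M_def by (intro hadamard_distance) auto
      also have "{k. k < 2^r \<and> hadamard r (j mod M) k \<noteq> hadamard r (j' mod M) k} = {k. k < h \<and> w j k \<noteq> w j' k}"
        unfolding w_def h_def using True by auto
      finally show ?thesis unfolding h_def by simp
    next
      case False
      have "sym_diff (a (j div M)) (sym_diff (a (j' div M)) (sym_diff (b (j mod M)) (b (j' mod M)))) = {k. k < h \<and> w j k \<noteq> w j' k}"
        unfolding w_def b_def using a(1)[of "j div M"] a(1)[of "j' div M"] dm[OF j(1)] dm[OF j(2)] by auto
      then show ?thesis using a(2)[of "j div M" "j' div M" "j mod M" "j' mod M"] False dm[OF j(1)] dm[OF j(2)] by simp
    qed
  qed
  then show ?thesis unfolding h_def by blast
qed

section \<open>Paired codewords and ranks\<close>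

definition word :: "nat \<Rightarrow> nat \<Rightarrow> nat \<Rightarrow> bool" where
  "word h = (SOME w. code_ok h w)"

lemma word_ok: "r \<ge> 8 \<Longrightarrow> code_ok (2^r) (word (2^r))"
  unfolding word_def by (rule someI_ex[OF code_exists])

text \<open>Every letter is doubled into a pair of opposite bits, so that each word splits every run
  of whole pairs into equal halves.\<close>

definition pword :: "nat \<Rightarrow> nat \<Rightarrow> nat \<Rightarrow> bool" where
  "pword h j \<rho> = (word h j (\<rho> div 2) \<noteq> odd \<rho>)"

definition sign :: "bool \<Rightarrow> real" where
  "sign b = (if b then 1 else -1)"

lemma sign_square [simp]: "sign b * sign b = 1"
  by (simp add: sign_def)

lemma pword_balanced:
  assumes ok: "code_ok h (word h)" and "\<rho> < 2*h"
  shows "2 * card {j. j < 2^(h div 4) \<and> pword h j \<rho> = b} = 2^(h div 4)"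
proof -
  have "\<rho> div 2 < h" using assms by auto
  then have 1: "2 * card {j. j < 2^(h div 4) \<and> word h j (\<rho> div 2)} = 2^(h div 4)"
    using ok unfolding code_ok_def by blast
  note 2 = card_compl_half[OF 1]
  show ?thesis unfolding pword_def using 1 2 by (cases b; cases "odd \<rho>") simp_all
qed

text \<open>In a pair where the words differ, exactly one of the two positions has bit b in the
  first word, and there the second word has the other bit. So the full distance is seen from either
  bit value.\<close>

lemma pword_distance:
  assumes ok: "code_ok h (word h)" and j: "j < 2^(h div 4)" "j' < 2^(h div 4)" "j \<noteq> j'"
  shows "h \<le> 8 * card {\<rho>. \<rho> < 2*h \<and> pword h j \<rho> = b \<and> pword h j' \<rho> \<noteq> b}"
proof -
  define Q where "Q = (\<lambda>k (e::nat). (word h j k \<noteq> odd e) = b \<and> (word h j' k \<noteq> odd e) \<noteq> b)"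
  have "card {\<rho>. \<rho> < 2*h \<and> pword h j \<rho> = b \<and> pword h j' \<rho> \<noteq> b} = card {\<rho>. \<rho> < h*2 \<and> Q (\<rho> div 2) (\<rho> mod 2)}"
    by (rule arg_cong[where f=card]) (auto simp: Q_def pword_def)
  also have "\<dots> = (\<Sum>x<h. card {e. e < 2 \<and> Q x e})" by (rule card_divmod) simp
  also have "\<dots> = (\<Sum>x<h. of_bool (word h j x \<noteq> word h j' x))"
    unfolding card_lt_2 by (rule sum.cong) (auto simp: Q_def)
  also have "\<dots> = card {k. k < h \<and> word h j k \<noteq> word h j' k}" by (simp only: card_eq_sum_of_bool)
  finally have eq: "card {\<rho>. \<rho> < 2*h \<and> pword h j \<rho> = b \<and> pword h j' \<rho> \<noteq> b} = card {k. k < h \<and> word h j k \<noteq> word h j' k}" .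
  have "\<forall>j<2^(h div 4). \<forall>j'<2^(h div 4). j \<noteq> j' \<longrightarrow> h \<le> 8 * card {k. k < h \<and> word h j k \<noteq> word h j' k}"
    using ok unfolding code_ok_def by (elim conjE)
  then show ?thesis using j unfolding eq by blast
qed

text \<open>Two balanced positions that agree on exactly half of the words show all four bit
  patterns equally often.\<close>

lemma pword_orthogonal:
  assumes ok: "code_ok h (word h)" and r: "\<rho> < 2*h" "\<rho>' < 2*h" "\<rho> div 2 \<noteq> \<rho>' div 2"
  shows "4 * card {j. j < 2^(h div 4) \<and> pword h j \<rho> = b \<and> pword h j \<rho>' \<noteq> b} = 2^(h div 4)"
proof -
  let ?K = "2^(h div 4) :: nat"
  define k k' where "k = \<rho> div 2" and "k' = \<rho>' div 2"
  have k: "k < h" "k' < h" "k \<noteq> k'" using r unfolding k_def k'_def by auto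
  have o: "2 * card {j. j < ?K \<and> word h j k \<noteq> word h j k'} = ?K"
    using ok k unfolding code_ok_def by blast
  have o': "2 * card {j. j < ?K \<and> pword h j \<rho> \<noteq> pword h j \<rho>'} = ?K"
  proof (cases "odd \<rho> = odd \<rho>'")
    case True
    then have "pword h j \<rho> \<noteq> pword h j \<rho>' \<longleftrightarrow> word h j k \<noteq> word h j k'" for j unfolding pword_def k_def k'_def by auto
    then show ?thesis using o by simp
  next
    case False
    then have "pword h j \<rho> \<noteq> pword h j \<rho>' \<longleftrightarrow> \<not> (word h j k \<noteq> word h j k')" for j unfolding pword_def k_def k'_def by auto
    then show ?thesis using card_compl_half[OF o] by simp
  qed
  let ?A = "{j. j < ?K \<and> pword h j \<rho> = b \<and> pword h j \<rho>' \<noteq> b}"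
  let ?B = "{j. j < ?K \<and> pword h j \<rho> \<noteq> b \<and> pword h j \<rho>' = b}"
  let ?C = "{j. j < ?K \<and> pword h j \<rho> = b \<and> pword h j \<rho>' = b}"
  have "card {j. j < ?K \<and> pword h j \<rho> = b} = card (?A \<union> ?C)" by (rule arg_cong[where f=card]) auto
  also have "\<dots> = card ?A + card ?C" by (rule card_Un_disjoint) auto
  finally have 1: "card {j. j < ?K \<and> pword h j \<rho> = b} = card ?A + card ?C" .
  have "card {j. j < ?K \<and> pword h j \<rho>' = b} = card (?B \<union> ?C)" by (rule arg_cong[where f=card]) auto
  also have "\<dots> = card ?B + card ?C" by (rule card_Un_disjoint) auto
  finally have 2: "card {j. j < ?K \<and> pword h j \<rho>' = b} = card ?B + card ?C" .
  have "card {j. j < ?K \<and> pword h j \<rho> \<noteq> pword h j \<rho>'} = card (?A \<union> ?B)" by (rule arg_cong[where f=card]) auto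
  also have "\<dots> = card ?A + card ?B" by (rule card_Un_disjoint) auto
  finally have 3: "card {j. j < ?K \<and> pword h j \<rho> \<noteq> pword h j \<rho>'} = card ?A + card ?B" .
  show ?thesis using 1 2 3 o' pword_balanced[OF ok r(1), of b] pword_balanced[OF ok r(2), of b] by linarith
qed

lemma sum_pw_pairs:
  "(\<Sum>\<rho><2*h. sign (pword h j \<rho>) * g \<rho>) = (\<Sum>k<h. sign (word h j k) * (g (2*k) - g (2*k+1)))"
proof -
  have "(\<Sum>\<rho><h*2. sign (pword h j \<rho>) * g \<rho>) = (\<Sum>\<rho><h*2. sign (word h j (\<rho> div 2) \<noteq> odd (\<rho> mod 2)) * g (2 * (\<rho> div 2) + \<rho> mod 2))"
    by (rule sum.cong) (auto simp: pword_def)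
  also have "\<dots> = (\<Sum>k<h. \<Sum>e<2. sign (word h j k \<noteq> odd e) * g (2*k+e))"
    by (rule sum_divmod[of 2 "\<lambda>k e. sign (word h j k \<noteq> odd e) * g (2*k+e)"]) simp
  also have "\<dots> = (\<Sum>k<h. sign (word h j k) * (g (2*k) - g (2*k+1)))"
    by (rule sum.cong) (auto simp: numeral_2_eq_2 sign_def algebra_simps)
  finally show ?thesis by (simp only: mult.commute)
qed

lemma sum_pairs_square_le:
  fixes g :: "nat \<Rightarrow> real"
  shows "(\<Sum>k<h. (g (2*k) - g (2*k+1))^2) \<le> 2 * (\<Sum>\<rho><2*h. g \<rho>^2)"
    and "(\<Sum>k<h. (g (2*k) + g (2*k+1))^2) \<le> 2 * (\<Sum>\<rho><2*h. g \<rho>^2)"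
proof -
  have "(\<Sum>\<rho><h*2. (g \<rho>)^2) = (\<Sum>\<rho><h*2. (g (2 * (\<rho> div 2) + \<rho> mod 2))^2)"
    by (rule sum.cong) auto
  also have "\<dots> = (\<Sum>k<h. \<Sum>e<2. (g (2*k+e))^2)"
    by (rule sum_divmod[of 2 "\<lambda>k e. (g (2*k+e))^2"]) simp
  also have "\<dots> = (\<Sum>k<h. (g (2*k))^2 + (g (2*k+1))^2)" by (simp add: numeral_2_eq_2)
  finally have eq: "2 * (\<Sum>\<rho><2*h. g \<rho>^2) = (\<Sum>k<h. 2 * ((g (2*k))^2 + (g (2*k+1))^2))"
    by (simp only: mult.commute sum_distrib_left)
  have a: "(x - y)^2 \<le> 2 * (x^2+y^2)" "(x + y)^2 \<le> 2 * (x^2+y^2)" for x y :: real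
    using zero_le_power2[of "x+y"] zero_le_power2[of "x-y"] by (auto simp: power2_eq_square algebra_simps)
  show "(\<Sum>k<h. (g (2*k) - g (2*k+1))^2) \<le> 2 * (\<Sum>\<rho><2*h. g \<rho>^2)"
    "(\<Sum>k<h. (g (2*k) + g (2*k+1))^2) \<le> 2 * (\<Sum>\<rho><2*h. g \<rho>^2)"
    unfolding eq by (intro sum_mono a)+
qed

lemma sum_sign:
  "(\<Sum>j<n. sign (Q j)) = 2 * real (card {j. j < n \<and> Q j}) - real n"
proof -
  have "(\<Sum>j<n. sign (Q j)) = (\<Sum>j<n. 2 * real (of_bool (Q j)) - 1)" by (rule sum.cong) (auto simp: sign_def)
  then show ?thesis unfolding card_eq_sum_of_bool by (simp add: sum_subtractf sum_distrib_left)
qed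

lemma word_sum_zero:
  assumes "code_ok h (word h)" "k < h"
  shows "(\<Sum>j<2^(h div 4). sign (word h j k)) = 0"
proof -
  have "2 * card {j. j < 2^(h div 4) \<and> word h j k} = 2^(h div 4)" using assms unfolding code_ok_def by blast
  then have "real (2 * card {j. j < 2^(h div 4) \<and> word h j k}) = real (2^(h div 4))" by (simp only:)
  then show ?thesis unfolding sum_sign by simp
qed

lemma word_sum_orthogonal:
  assumes "code_ok h (word h)" "k < h" "k' < h"
  shows "(\<Sum>j<2^(h div 4). sign (word h j k) * sign (word h j k')) = (if k = k' then 2^(h div 4) else 0)"
proof (cases "k = k'")
  case False
  have "2 * card {j. j < 2^(h div 4) \<and> word h j k \<noteq> word h j k'} = 2^(h div 4)"
    using assms False unfolding code_ok_def by blast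
  then have "real (2 * card {j. j < 2^(h div 4) \<and> word h j k \<noteq> word h j k'}) = real (2^(h div 4))" by (simp only:)
  then have "(\<Sum>j<2^(h div 4). sign (word h j k \<noteq> word h j k')) = 0" unfolding sum_sign by simp
  moreover have "sign a * sign b = - sign (a \<noteq> b)" for a b by (auto simp: sign_def)
  ultimately show ?thesis using False by (simp add: sum_negf)
qed simp

lemma pword_sum_zero:
  assumes "code_ok h (word h)"
  shows "(\<Sum>j<2^(h div 4). \<Sum>\<rho><2*h. sign (pword h j \<rho>) * g \<rho>) = 0"
proof -
  have "(\<Sum>j<2^(h div 4). \<Sum>\<rho><2*h. sign (pword h j \<rho>) * g \<rho>)
      = (\<Sum>k<h. (\<Sum>j<2^(h div 4). sign (word h j k)) * (g (2*k) - g (2*k+1)))"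
    unfolding sum_pw_pairs by (subst sum.swap) (simp only: sum_distrib_right)
  also have "\<dots> = 0" by (rule sum.neutral) (simp add: word_sum_zero[OF assms])
  finally show ?thesis .
qed

text \<open>Parseval for the orthogonal coordinates of the code; the pairing turns g into the
  differences of its values on pairs, whose squares cost the factor 2. This is the source of the
  spectral gap.\<close>

lemma pword_sum_square:
  assumes ok: "code_ok h (word h)"
  shows "(\<Sum>j<2^(h div 4). (\<Sum>\<rho><2*h. sign (pword h j \<rho>) * g \<rho>)^2) \<le> 2 * 2^(h div 4) * (\<Sum>\<rho><2*h. g \<rho>^2)"
proof -
  let ?K = "2^(h div 4) :: nat"
  define G where "G k = g (2*k) - g (2*k+1)" for k
  have "(\<Sum>j<?K. (\<Sum>\<rho><2*h. sign (pword h j \<rho>) * g \<rho>)^2)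
      = (\<Sum>j<?K. \<Sum>k<h. \<Sum>k'<h. (sign (word h j k) * sign (word h j k')) * (G k * G k'))"
    unfolding sum_pw_pairs power2_eq_square sum_product G_def by (intro sum.cong refl) simp
  also have "\<dots> = (\<Sum>k<h. \<Sum>k'<h. \<Sum>j<?K. (sign (word h j k) * sign (word h j k')) * (G k * G k'))"
    by (subst sum.swap, rule sum.cong[OF refl], rule sum.swap)
  also have "\<dots> = (\<Sum>k<h. \<Sum>k'<h. (if k = k' then 2^(h div 4) else 0) * (G k * G k'))"
    unfolding sum_distrib_right[symmetric]
    by (intro sum.cong refl arg_cong2[where f="(*)"]) (simp add: word_sum_orthogonal[OF ok])
  also have "\<dots> = (\<Sum>k<h. 2^(h div 4) * (G k * G k))"
  proof (rule sum.cong[OF refl])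
    fix k assume "k \<in> {..<h}"
    have "(\<Sum>k'<h. (if k = k' then 2^(h div 4) else 0) * (G k * G k')) = (\<Sum>k'<h. if k' = k then 2^(h div 4) * (G k * G k') else 0)"
      by (rule sum.cong) auto
    then show "(\<Sum>k'<h. (if k = k' then 2^(h div 4) else 0) * (G k * G k')) = 2^(h div 4) * (G k * G k)"
      using \<open>k \<in> {..<h}\<close> by simp
  qed
  also have "\<dots> = 2^(h div 4) * (\<Sum>k<h. (G k)^2)" by (simp only: sum_distrib_left power2_eq_square)
  also have "\<dots> \<le> 2^(h div 4) * (2 * (\<Sum>\<rho><2*h. g \<rho>^2))"
    unfolding G_def by (intro mult_left_mono sum_pairs_square_le) auto
  finally show ?thesis by (simp only: mult_ac)
qed

section \<open>Ranks and exact halving\<close>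

definition rank :: "nat set \<Rightarrow> nat \<Rightarrow> nat" where
  "rank S y = card {y'\<in>S. y' < y}"

lemma rank_less:
  assumes "finite S" "y \<in> S" "y < y'"
  shows "rank S y < rank S y'"
  unfolding rank_def by (rule psubset_card_mono) (use assms in auto)

lemma rank_bij:
  assumes "finite S" "l \<le> m"
  shows "bij_betw (rank S) {y\<in>S. l \<le> y \<and> y < m} {rank S l..<rank S m}"
proof -
  have inj: "inj_on (rank S) {y\<in>S. l \<le> y \<and> y < m}"
  proof (rule inj_onI)
    fix x y assume "x \<in> {y\<in>S. l \<le> y \<and> y < m}" "y \<in> {y\<in>S. l \<le> y \<and> y < m}" "rank S x = rank S y"
    then show "x = y" using rank_less[OF assms(1), of x y] rank_less[OF assms(1), of y x] by (cases x y rule: linorder_cases) auto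
  qed
  have sub: "rank S ` {y\<in>S. l \<le> y \<and> y < m} \<subseteq> {rank S l..<rank S m}"
  proof safe
    fix y assume "y \<in> S" "l \<le> y" "y < m"
    moreover have "rank S l \<le> rank S y" unfolding rank_def using assms(1) \<open>l \<le> y\<close> by (intro card_mono) auto
    ultimately show "rank S y \<in> {rank S l..<rank S m}" using rank_less[OF assms(1)] by simp
  qed
  have "rank S m = card ({y\<in>S. y < l} \<union> {y\<in>S. l \<le> y \<and> y < m})"
    unfolding rank_def using assms(2) by (intro arg_cong[where f=card]) auto
  also have "\<dots> = rank S l + card {y\<in>S. l \<le> y \<and> y < m}"
    unfolding rank_def by (rule card_Un_disjoint) (use assms(1) in auto)
  finally have "card {rank S l..<rank S m} = card {y\<in>S. l \<le> y \<and> y < m}" by simp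
  then have "rank S ` {y\<in>S. l \<le> y \<and> y < m} = {rank S l..<rank S m}"
    using sub inj by (intro card_subset_eq) (auto simp: card_image)
  then show ?thesis using inj by (simp add: bij_betw_def)
qed

lemma rank_bij_all:
  assumes "finite S"
  shows "bij_betw (rank S) S {..<card S}"
proof -
  obtain m where m: "\<forall>y\<in>S. y < m" using assms finite_nat_set_iff_bounded by auto
  have 1: "rank S 0 = 0" "rank S m = card S" unfolding rank_def using m by (auto intro!: arg_cong[where f=card])
  have 2: "{y\<in>S. 0 \<le> y \<and> y < m} = S" using m by auto
  show ?thesis using rank_bij[OF assms, of 0 m] unfolding 1 2 by (simp add: lessThan_atLeast0)
qed

lemma pword_alternates:
  assumes "\<alpha> \<le> \<beta>"
  shows "card {\<rho>. 2*\<alpha> \<le> \<rho> \<and> \<rho> < 2*\<beta> \<and> pword h j \<rho> = b} = \<beta> - \<alpha>"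
  using assms
proof (induction \<beta> rule: dec_induct)
  case (step \<beta>)
  define x where "x = (if pword h j (2*\<beta>) = b then 2*\<beta> else 2*\<beta>+1)"
  have A: "pword h j (2*\<beta>+1) \<noteq> pword h j (2*\<beta>)" unfolding pword_def by auto
  have B: "\<rho> < 2 * Suc \<beta> \<longleftrightarrow> \<rho> < 2*\<beta> \<or> \<rho> = 2*\<beta> \<or> \<rho> = 2*\<beta>+1" for \<rho> by auto
  have "{\<rho>. 2*\<alpha> \<le> \<rho> \<and> \<rho> < 2*Suc \<beta> \<and> pword h j \<rho> = b} = insert x {\<rho>. 2*\<alpha> \<le> \<rho> \<and> \<rho> < 2*\<beta> \<and> pword h j \<rho> = b}"
  proof (rule set_eqI)
    fix \<rho>
    consider "\<rho> < 2*\<beta>" | "\<rho> = 2*\<beta>" | "\<rho> = 2*\<beta>+1" | "\<rho> > 2*\<beta>+1" by linarith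
    then show "\<rho> \<in> {\<rho>. 2*\<alpha> \<le> \<rho> \<and> \<rho> < 2*Suc \<beta> \<and> pword h j \<rho> = b} \<longleftrightarrow> \<rho> \<in> insert x {\<rho>. 2*\<alpha> \<le> \<rho> \<and> \<rho> < 2*\<beta> \<and> pword h j \<rho> = b}"
      unfolding x_def mem_Collect_eq insert_iff B using step(1) A by cases auto
  qed
  moreover have "x \<notin> {\<rho>. 2*\<alpha> \<le> \<rho> \<and> \<rho> < 2*\<beta> \<and> pword h j \<rho> = b}" unfolding x_def by auto
  ultimately show ?case using step by (simp add: Suc_diff_le)
qed (auto simp: card_eq_0_iff)

text \<open>The ranks of an interval of S are consecutive; if they begin at an even number and are
  even in number, they form whole pairs, each with one bit of either value.\<close>

lemma halving:
  assumes S: "finite S" and "l \<le> m" and ev: "even (rank S l)" "even (card {y\<in>S. l \<le> y \<and> y < m})"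
  shows "2 * card {y\<in>S. l \<le> y \<and> y < m \<and> pword h j (rank S y) = b} = card {y\<in>S. l \<le> y \<and> y < m}"
proof -
  note bij = rank_bij[OF S \<open>l \<le> m\<close>]
  have c: "card {y\<in>S. l \<le> y \<and> y < m} = rank S m - rank S l" using bij_betw_same_card[OF bij] by simp
  have "rank S l \<le> rank S m" unfolding rank_def using S \<open>l \<le> m\<close> by (intro card_mono) auto
  obtain \<alpha> where a: "rank S l = 2*\<alpha>" using ev(1) by (elim evenE)
  have "even (rank S m - rank S l)" using ev(2) c by simp
  then have "even (rank S m)" using \<open>rank S l \<le> rank S m\<close> ev(1) even_diff_nat[of "rank S m" "rank S l"] by auto
  then obtain \<beta> where b: "rank S m = 2*\<beta>" by (elim evenE)
  have ab: "\<alpha> \<le> \<beta>" using a b \<open>rank S l \<le> rank S m\<close> by simp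
  have "bij_betw (rank S) {y\<in>{y\<in>S. l \<le> y \<and> y < m}. pword h j (rank S y) = b} {\<rho>\<in>{2*\<alpha>..<2*\<beta>}. pword h j \<rho> = b}"
    using bij_betw_Collect[OF bij[unfolded a b], of "\<lambda>\<rho>. pword h j \<rho> = b" "\<lambda>y. pword h j (rank S y) = b"] by simp
  then have "card {y\<in>{y\<in>S. l \<le> y \<and> y < m}. pword h j (rank S y) = b} = card {\<rho>\<in>{2*\<alpha>..<2*\<beta>}. pword h j \<rho> = b}"
    by (rule bij_betw_same_card)
  also have "{\<rho>\<in>{2*\<alpha>..<2*\<beta>}. pword h j \<rho> = b} = {\<rho>. 2*\<alpha> \<le> \<rho> \<and> \<rho> < 2*\<beta> \<and> pword h j \<rho> = b}" by auto
  also have "{y\<in>{y\<in>S. l \<le> y \<and> y < m}. pword h j (rank S y) = b} = {y\<in>S. l \<le> y \<and> y < m \<and> pword h j (rank S y) = b}" by auto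
  finally show ?thesis using pword_alternates[OF ab] c a b by simp
qed

text \<open>Every earlier fibre contributes an even number of elements, so no pair straddles two
  fibres.\<close>

lemma even_rank:
  assumes S: "finite S" and "q > 0" and ev: "\<And>p. even (card {y\<in>S. y div q = p})"
  shows "even (rank S (p*q))"
proof (induction p)
  case (Suc p)
  have "y < Suc p * q \<longleftrightarrow> y < p*q \<or> y div q = p" for y
    using \<open>q > 0\<close> by (metis div_less_iff_less_mult less_Suc_eq)
  then have "rank S (Suc p * q) = card ({y\<in>S. y < p*q} \<union> {y\<in>S. y div q = p})"
    unfolding rank_def by (intro arg_cong[where f=card]) auto
  also have "\<dots> = rank S (p*q) + card {y\<in>S. y div q = p}"
    unfolding rank_def
  proof (rule card_Un_disjoint)
    have "p*q \<le> y" if "y div q = p" for y using that div_times_less_eq_dividend[of y q] by simp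
    then show "{y\<in>S. y < p*q} \<inter> {y\<in>S. y div q = p} = {}" by (auto simp: not_less[symmetric])
  qed (use S in auto)
  finally show ?case using Suc ev by simp
qed (simp add: rank_def)

lemma halving_fibre:
  assumes S: "finite S" and "q > 0" and ev: "\<And>p. even (card {y\<in>S. y div q = p})"
  shows "2 * card {y\<in>S. y div q = p \<and> pword h j (rank S y) = b} = card {y\<in>S. y div q = p}"
proof -
  have eq: "y div q = p \<longleftrightarrow> p*q \<le> y \<and> y < Suc p * q" for y
    using \<open>q > 0\<close> less_eq_div_iff_mult_less_eq[of q p y] div_less_iff_less_mult[of q y "Suc p"] by auto
  show ?thesis
    using halving[of S "p*q" "Suc p * q" h j b] S even_rank[OF assms, of p] ev[of p] unfolding eq by simp
qed

section \<open>The tower of levels\<close>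

text \<open>Binary logarithm of the number of cells; the summand added in a step is the number of
  bits of a codeword index, a quarter of the word length. The start values make level 0 itself a
  full code of words of length 2^15, with 2^13 = 2^15 / 4, and level 1 a set of 2^17 = 4 * 2^15
  cells: two twins for each of the two positions of a letter.\<close>

fun lev_exp :: "nat \<Rightarrow> nat" where
  "lev_exp 0 = 2^13"
| "lev_exp (Suc 0) = 17"
| "lev_exp (Suc (Suc t)) = lev_exp t + 2^(lev_exp (Suc t) - t - 4)"

declare lev_exp.simps [simp del]

definition lev :: "nat \<Rightarrow> nat" where "lev t = 2^lev_exp t"
text \<open>One of the 2^(t+1) colour classes of a cell in the next level has
  \<open>2 * wlen t\<close> members, hence one pair for every letter of a word of length
  \<open>wlen t\<close>.\<close>

definition wlen :: "nat \<Rightarrow> nat" where "wlen t = 2^(lev_exp (Suc t) - t - 2)"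
definition nwords :: "nat \<Rightarrow> nat" where "nwords t = 2^(wlen t div 4)"

lemma lev_exp_Suc_ge: "2*t + 17 \<le> lev_exp (Suc t)"
proof (induction t)
  case (Suc t)
  have a: "2*x + 19 \<le> 2^(x+13)" for x :: nat 
  proof (induction x)
    case (Suc x)
    have "2 * Suc x + 19 \<le> 2 * (2*x+19)" by simp
    also have "\<dots> \<le> 2 * 2^(x+13)" using Suc by simp
    also have "\<dots> = 2^(Suc x+13)" by (simp only: add_Suc power_Suc)
    finally show ?case .
  qed simp
  have "2*t+19 \<le> (2::nat)^(t+13)" by (rule a)
  also have "\<dots> \<le> 2^(lev_exp (Suc t) - t - 4)" using Suc by (intro power_increasing) auto
  finally show ?case by (simp add: lev_exp.simps)
qed (simp add: lev_exp.simps)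

lemma lev_exp_ge: "t + 1 \<le> lev_exp t"
proof (cases t)
  case (Suc s) then show ?thesis using lev_exp_Suc_ge[of s] by simp
qed (simp add: lev_exp.simps)

lemma lev_pos [simp]: "lev t > 0" and wlen_pos [simp]: "wlen t > 0" and nwords_pos [simp]: "nwords t > 0"
  by (simp_all add: lev_def wlen_def nwords_def)

lemma lev_Suc: "lev (Suc t) = wlen t * 2^(t+2)"
proof -
  have "lev_exp (Suc t) = (lev_exp (Suc t) - t - 2) + (t+2)" using lev_exp_Suc_ge[of t] by simp
  then show ?thesis unfolding lev_def wlen_def by (metis power_add)
qed

lemma wlen_div_4: "wlen t div 4 = 2^(lev_exp (Suc t) - t - 4)"
proof -
  have "lev_exp (Suc t) - t - 2 = (lev_exp (Suc t) - t - 4) + 2" using lev_exp_Suc_ge[of t] by simp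
  then have "wlen t = 2^(lev_exp (Suc t) - t - 4) * 2^2" unfolding wlen_def by (metis power_add)
  then show ?thesis by simp
qed

lemma lev_Suc_Suc: "lev (Suc (Suc t)) = lev t * nwords t"
  unfolding lev_def nwords_def wlen_div_4 lev_exp.simps by (rule power_add)

lemma lev_0: "lev 0 = nwords 0"
  unfolding lev_def nwords_def wlen_div_4 by (simp only: lev_exp.simps) simp

lemma wlen_ge: "2^(t+15) \<le> wlen t"
  unfolding wlen_def using lev_exp_Suc_ge[of t] by (intro power_increasing) auto

lemma wlen_0: "wlen 0 = 2^15"
  unfolding wlen_def by (simp add: lev_exp.simps)

lemma wlen_code: "code_ok (wlen t) (word (wlen t))"
  unfolding wlen_def by (rule word_ok) (use lev_exp_Suc_ge[of t] in simp)

lemma nwords_dvd: "4 dvd nwords t"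
proof -
  have "2^2 dvd (2::nat)^(wlen t div 4)"
  proof (rule le_imp_power_dvd)
    have "(8::nat) \<le> 2^(t+15)" by (simp add: power_add)
    then show "2 \<le> wlen t div 4" using wlen_ge[of t] by linarith
  qed
  then show ?thesis unfolding nwords_def by simp
qed

section \<open>Colours, degrees and parities at every level\<close>

definition col_deg :: "nat \<Rightarrow> nat" where "col_deg t = lev t div 2^(t+1)"

lemma lev_col_deg: "lev t = col_deg t * 2^(t+1)"
proof -
  have "2^(t+1) dvd lev t" unfolding lev_def using lev_exp_ge[of t] by (intro le_imp_power_dvd)
  then show ?thesis unfolding col_deg_def by simp
qed

lemma col_deg_Suc: "col_deg (Suc t) = wlen t"
  unfolding col_deg_def lev_Suc by simp

lemma wlen_Suc: "4 * wlen (Suc t) = col_deg t * nwords t"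
proof -
  have "wlen (Suc t) * 2^(Suc t + 2) = col_deg t * 2^(t+1) * nwords t"
    using lev_Suc[of "Suc t"] lev_Suc_Suc[of t] lev_col_deg[of t] by simp
  then show ?thesis by simp
qed

text \<open>The neighbours of a cell in one colour are paired by rank, and a codeword gives the two cells of
  a pair opposite bits.  Pairs stay inside a fibre over the previous level, so every codeword halves
  every fibre exactly; the twins \<open>2*k, 2*k+1\<close> of \<open>{..<lev 1}\<close> make this true at the first step.\<close>

primrec col :: "nat \<Rightarrow> nat \<Rightarrow> nat \<Rightarrow> nat" where
  "col 0 = (\<lambda>x y. of_bool (pword (wlen 0) x (y div 2)))"
| "col (Suc t) = (\<lambda>y z. 2 * col t (z div nwords t) y +
     of_bool (pword (wlen t) (z mod nwords t) (card {y'. y' < y \<and> col t (z div nwords t) y' = col t (z div nwords t) y})))"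

declare col.simps(2) [simp del]

lemma col_lt: "col t x y < 2^(t+1)"
proof (induction t arbitrary: x y)
  case (Suc t)
  show ?case using Suc[of "y div nwords t" x] by (simp add: col.simps(2))
qed simp

definition fwd :: "nat \<Rightarrow> nat \<Rightarrow> nat \<Rightarrow> nat set" where
  "fwd t x c = {y. y < lev (Suc t) \<and> col t x y = c}"

lemma finite_fwd [simp]: "finite (fwd t x c)"
  unfolding fwd_def by (rule finite_subset[of _ "{..<lev (Suc t)}"]) auto

text \<open>Entry t is the size of the fibres of level t+1 over level t-1. Level 1 has nothing below
  it, and its twin pairs take the place of fibres.\<close>

primrec fibre :: "nat \<Rightarrow> nat" where
  "fibre 0 = 2"
| "fibre (Suc t) = nwords t"

lemma fibre_pos: "fibre t > 0"
  by (cases t) auto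

lemma col_Suc_eq:
  assumes "y \<in> fwd t (z div nwords t) c"
  shows "col (Suc t) y z = 2*c + of_bool (pword (wlen t) (z mod nwords t) (rank (fwd t (z div nwords t) c) y))"
proof -
  have "{y'. y' < y \<and> col t (z div nwords t) y' = col t (z div nwords t) y} = {y'\<in>fwd t (z div nwords t) c. y' < y}"
    using assms unfolding fwd_def by auto
  then show ?thesis using assms unfolding col.simps(2) rank_def by (simp add: fwd_def)
qed

lemma col_Suc_div_2: "col (Suc t) y z div 2 = col t (z div nwords t) y"
  by (simp add: col.simps(2))

lemma col_Suc_iff:
  assumes "y < lev (Suc t)"
  shows "col (Suc t) y z = c \<longleftrightarrow> y \<in> fwd t (z div nwords t) (c div 2) \<and>
    pword (wlen t) (z mod nwords t) (rank (fwd t (z div nwords t) (c div 2)) y) = odd c"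
proof (cases "y \<in> fwd t (z div nwords t) (c div 2)")
  case True
  then show ?thesis unfolding col_Suc_eq[OF True] by (auto; presburger)
next
  case False
  then show ?thesis using assms col_Suc_div_2[of t y z] by (auto simp: fwd_def)
qed

text \<open>The third clause is what the next level uses: with even numbers in each fibre, a word of
  the next level can halve each fibre exactly.\<close>

definition regular_level :: "nat \<Rightarrow> bool" where
  "regular_level t \<longleftrightarrow> (\<forall>x<lev t. \<forall>c<2^(t+1). card (fwd t x c) = 2 * wlen t) \<and>
    (\<forall>y<lev (Suc t). \<forall>c<2^(t+1). card {x. x < lev t \<and> col t x y = c} = col_deg t) \<and>
    (\<forall>x<lev t. \<forall>c p. even (card {y\<in>fwd t x c. y div fibre t = p}))"

lemma card_fibre_divmod:
  assumes "K > 0" "p < a"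
  shows "card {z. z < a*K \<and> z div K = p \<and> Q (z mod K)} = card {j::nat. j < K \<and> Q j}"
proof -
  have "card {z. z < a*K \<and> z div K = p \<and> Q (z mod K)} = (\<Sum>x<a. card {j. j < K \<and> x = p \<and> Q j})"
    by (rule card_divmod[OF assms(1), of a "\<lambda>x j. x = p \<and> Q j"])
  also have "\<dots> = (\<Sum>x<a. if x = p then card {j. j < K \<and> Q j} else 0)"
    by (rule sum.cong) auto
  finally show ?thesis using assms(2) by simp
qed

lemma card_by_fibres:
  assumes "K > 0"
  shows "card {z::nat. z < a*K \<and> Q z} = (\<Sum>p<a. card {z. z < a*K \<and> z div K = p \<and> Q z})"
proof -
  have "card {z. z < a*K \<and> Q z} = card (\<Union>p<a. {z. z < a*K \<and> z div K = p \<and> Q z})"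
    using assms by (intro arg_cong[where f=card]) (auto simp: less_mult_imp_div_less)
  also have "\<dots> = (\<Sum>p<a. card {z. z < a*K \<and> z div K = p \<and> Q z})"
    by (rule card_UN_disjoint) auto
  finally show ?thesis .
qed

text \<open>All children of p read the same position of their words at y, namely the rank of y, and
  they run through all words; balance of this coordinate halves them.\<close>

lemma fibre_fwd:
  assumes reg: "regular_level t" and y: "y < lev (Suc t)" and p: "p < lev t"
  shows "2 * card {z. z < lev (Suc (Suc t)) \<and> z div nwords t = p \<and> col (Suc t) y z = c}
    = (if col t p y = c div 2 then nwords t else 0)"
proof (cases "col t p y = c div 2")
  case False
  then have "{z. z < lev (Suc (Suc t)) \<and> z div nwords t = p \<and> col (Suc t) y z = c} = {}"
    using col_Suc_div_2[of t y] by auto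
  then show ?thesis using False by simp
next
  case True
  then have y': "y \<in> fwd t p (c div 2)" using y by (simp add: fwd_def)
  define \<rho> where "\<rho> = rank (fwd t p (c div 2)) y"
  have "c div 2 < 2^(t+1)" using col_lt[of t p y] True by simp
  then have "card (fwd t p (c div 2)) = 2 * wlen t" using reg p unfolding regular_level_def by blast
  moreover have "\<rho> < card (fwd t p (c div 2))" unfolding \<rho>_def rank_def
    by (rule psubset_card_mono) (use y' in auto)
  ultimately have \<rho>: "\<rho> < 2 * wlen t" by simp
  have "{z. z < lev (Suc (Suc t)) \<and> z div nwords t = p \<and> col (Suc t) y z = c} = {z. z < lev t * nwords t \<and> z div nwords t = p \<and> pword (wlen t) (z mod nwords t) \<rho> = odd c}"
    unfolding lev_Suc_Suc using y y' unfolding \<rho>_def by (auto simp: col_Suc_iff)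
  then have "card {z. z < lev (Suc (Suc t)) \<and> z div nwords t = p \<and> col (Suc t) y z = c} = card {j. j < nwords t \<and> pword (wlen t) j \<rho> = odd c}"
    using card_fibre_divmod[OF nwords_pos p, of t "\<lambda>j. pword (wlen t) j \<rho> = odd c"] by simp
  then show ?thesis using pword_balanced[OF wlen_code \<rho>, of "odd c"] True unfolding nwords_def by simp
qed

text \<open>The halving happens separately in each fibre, so it survives any filter Q on the parent.
  Keeping Q is what later allows a whole chain of levels to be traversed.\<close>

lemma forward_lift:
  assumes reg: "regular_level t" and y: "y < lev (Suc t)"
  shows "2 * card {z. z < lev (Suc (Suc t)) \<and> col (Suc t) y z = c \<and> Q (z div nwords t)}
    = nwords t * card {p. p < lev t \<and> col t p y = c div 2 \<and> Q p}"
proof -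
  have "2 * card {z. z < lev (Suc (Suc t)) \<and> col (Suc t) y z = c \<and> Q (z div nwords t)}
      = (\<Sum>p<lev t. 2 * card {z. z < lev (Suc (Suc t)) \<and> z div nwords t = p \<and> col (Suc t) y z = c \<and> Q (z div nwords t)})"
    unfolding lev_Suc_Suc sum_distrib_left[symmetric] by (subst card_by_fibres[OF nwords_pos]) (rule refl)
  also have "\<dots> = (\<Sum>p<lev t. nwords t * of_bool (col t p y = c div 2 \<and> Q p))"
  proof (rule sum.cong[OF refl])
    fix p assume p: "p \<in> {..<lev t}"
    show "2 * card {z. z < lev (Suc (Suc t)) \<and> z div nwords t = p \<and> col (Suc t) y z = c \<and> Q (z div nwords t)}
      = nwords t * of_bool (col t p y = c div 2 \<and> Q p)"
    proof (cases "Q p")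
      case True
      then have "{z. z < lev (Suc (Suc t)) \<and> z div nwords t = p \<and> col (Suc t) y z = c \<and> Q (z div nwords t)}
        = {z. z < lev (Suc (Suc t)) \<and> z div nwords t = p \<and> col (Suc t) y z = c}" by auto
      then show ?thesis using fibre_fwd[OF reg y, of p c] p True by simp
    next
      case False
      then have "{z. z < lev (Suc (Suc t)) \<and> z div nwords t = p \<and> col (Suc t) y z = c \<and> Q (z div nwords t)} = {}" by auto
      then show ?thesis using False by (simp only: card.empty) simp
    qed
  qed
  also have "\<dots> = nwords t * card {p. p < lev t \<and> col t p y = c div 2 \<and> Q p}"
    unfolding card_eq_sum_of_bool sum_distrib_left ..
  finally show ?thesis .
qed

text \<open>Dual to the halving of children: here the word is fixed and the positions vary, and the
  pairing inside fibres replaces the balance of a coordinate.\<close>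

lemma halved_fibre:
  assumes reg: "regular_level t" and z: "z < lev (Suc (Suc t))"
  shows "2 * card {y. y < lev (Suc t) \<and> y div fibre t = p \<and> col (Suc t) y z = c}
    = card {y. y < lev (Suc t) \<and> y div fibre t = p \<and> col t (z div nwords t) y = c div 2}"
proof -
  define S where "S = fwd t (z div nwords t) (c div 2)"
  have x: "z div nwords t < lev t" using z unfolding lev_Suc_Suc by (simp add: less_mult_imp_div_less)
  have ev: "even (card {y\<in>S. y div fibre t = p})" for p using reg x unfolding regular_level_def S_def by blast
  have 1: "{y. y < lev (Suc t) \<and> y div fibre t = p \<and> col (Suc t) y z = c} = {y\<in>S. y div fibre t = p \<and> pword (wlen t) (z mod nwords t) (rank S y) = odd c}"
  proof (rule set_eqI)
    fix y
    have "y < lev (Suc t)" if "y \<in> S" using that unfolding S_def fwd_def by simp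
    then show "y \<in> {y. y < lev (Suc t) \<and> y div fibre t = p \<and> col (Suc t) y z = c} \<longleftrightarrow>
      y \<in> {y\<in>S. y div fibre t = p \<and> pword (wlen t) (z mod nwords t) (rank S y) = odd c}"
      using col_Suc_iff[of y t z c] unfolding S_def by (cases "y < lev (Suc t)") auto
  qed
  have 2: "{y. y < lev (Suc t) \<and> y div fibre t = p \<and> col t (z div nwords t) y = c div 2} = {y\<in>S. y div fibre t = p}"
    unfolding S_def fwd_def by auto
  show ?thesis unfolding 1 2 by (rule halving_fibre) (use ev fibre_pos in \<open>auto simp: S_def\<close>)
qed

lemma lev_Suc_fs: "\<exists>a. lev (Suc t) = a * fibre t"
proof (cases t)
  case 0 then show ?thesis using lev_Suc[of 0] by (intro exI[of _ "2 * wlen 0"]) simp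
next
  case (Suc s) then show ?thesis using lev_Suc_Suc[of s] by auto
qed

lemma halved:
  assumes reg: "regular_level t" and z: "z < lev (Suc (Suc t))"
  shows "2 * card {y. y < lev (Suc t) \<and> col (Suc t) y z = c \<and> Q (y div fibre t)}
    = card {y. y < lev (Suc t) \<and> col t (z div nwords t) y = c div 2 \<and> Q (y div fibre t)}"
proof -
  obtain a where a: "lev (Suc t) = a * fibre t" using lev_Suc_fs by blast
  have e: "{y. y < lev (Suc t) \<and> y div fibre t = p \<and> R y \<and> Q (y div fibre t)} =
     (if Q p then {y. y < lev (Suc t) \<and> y div fibre t = p \<and> R y} else {})" for p and R :: "nat \<Rightarrow> bool"
    by auto
  have "2 * card {y. y < lev (Suc t) \<and> col (Suc t) y z = c \<and> Q (y div fibre t)}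
      = (\<Sum>p<a. 2 * card {y. y < lev (Suc t) \<and> y div fibre t = p \<and> col (Suc t) y z = c \<and> Q (y div fibre t)})"
    unfolding a sum_distrib_left[symmetric] by (subst card_by_fibres[OF fibre_pos]) (rule refl)
  also have "\<dots> = (\<Sum>p<a. card {y. y < lev (Suc t) \<and> y div fibre t = p \<and> col t (z div nwords t) y = c div 2 \<and> Q (y div fibre t)})"
    unfolding e using halved_fibre[OF reg z] by (intro sum.cong) auto
  also have "\<dots> = card {y. y < lev (Suc t) \<and> col t (z div nwords t) y = c div 2 \<and> Q (y div fibre t)}"
    unfolding a by (subst card_by_fibres[OF fibre_pos]) (rule refl)
  finally show ?thesis .
qed

lemma regular_level_0: "regular_level 0"
proof -
  have u1: "lev (Suc 0) = (2 * wlen 0) * 2" using lev_Suc[of 0] by simp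
  have f: "card {y\<in>fwd 0 x c. y div 2 = p} = (if p < 2 * wlen 0 \<and> of_bool (pword (wlen 0) x p) = c then 2 else 0)" for x c p
  proof -
    have "{y\<in>fwd 0 x c. y div 2 = p} = (if p < 2 * wlen 0 \<and> of_bool (pword (wlen 0) x p) = c then {2*p, 2*p+1} else {})"
      unfolding fwd_def u1 by auto
    then show ?thesis by simp
  qed
  have c2: "c < 2^(0+1) \<Longrightarrow> (of_bool b = c) = (b = (c = 1))" for b and c :: nat by auto
  show ?thesis
    unfolding regular_level_def
  proof (intro conjI allI impI)
    fix x and c :: nat assume x: "x < lev 0" and c: "c < 2^(0+1)"
    have "card (fwd 0 x c) = card {y. y < (2 * wlen 0) * 2 \<and> of_bool (pword (wlen 0) x (y div 2)) = c}"
      unfolding fwd_def u1 by simp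
    also have "\<dots> = (\<Sum>\<rho><2 * wlen 0. card {j::nat. j < 2 \<and> of_bool (pword (wlen 0) x \<rho>) = c})"
      by (rule card_divmod) simp
    also have "\<dots> = (\<Sum>\<rho><2 * wlen 0. 2 * of_bool (pword (wlen 0) x \<rho> = (c = 1)))"
      unfolding card_lt_2 c2[OF c] by (intro sum.cong) auto
    also have "\<dots> = 2 * card {\<rho>. 2*0 \<le> \<rho> \<and> \<rho> < 2 * wlen 0 \<and> pword (wlen 0) x \<rho> = (c = 1)}"
      unfolding sum_distrib_left[symmetric] by (simp only: flip: card_eq_sum_of_bool) simp
    also have "\<dots> = 2 * wlen 0" by (subst pword_alternates) auto
    finally show "card (fwd 0 x c) = 2 * wlen 0" .
  next
    fix y and c :: nat assume y: "y < lev (Suc 0)" and c: "c < 2^(0+1)"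
    have "y div 2 < 2 * wlen 0" using y unfolding u1 by auto
    from pword_balanced[OF wlen_code this, of "c = 1"]
    have "2 * card {j. j < lev 0 \<and> pword (wlen 0) j (y div 2) = (c = 1)} = lev 0" unfolding lev_0 nwords_def .
    then show "card {x. x < lev 0 \<and> col 0 x y = c} = col_deg 0" unfolding col_deg_def using c2[OF c] by simp
  qed (simp add: f)
qed

lemma regular_level_Suc:
  assumes reg: "regular_level t"
  shows "regular_level (Suc t)"
  unfolding regular_level_def
proof (intro conjI allI impI)
  fix y and c :: nat assume y: "y < lev (Suc t)" and c: "c < 2^(Suc t+1)"
  have c': "c div 2 < 2^(t+1)" using c by simp
  have "2 * card (fwd (Suc t) y c) = nwords t * card {p. p < lev t \<and> col t p y = c div 2}"
    using forward_lift[OF reg y, of c "\<lambda>_. True"] unfolding fwd_def by simp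
  also have "card {p. p < lev t \<and> col t p y = c div 2} = col_deg t" using reg y c' unfolding regular_level_def by blast
  finally show "card (fwd (Suc t) y c) = 2 * wlen (Suc t)" using wlen_Suc[of t] by (simp add: mult.commute)
next
  fix z and c :: nat assume z: "z < lev (Suc (Suc t))" and c: "c < 2^(Suc t+1)"
  have c': "c div 2 < 2^(t+1)" using c by simp
  have x: "z div nwords t < lev t" using z unfolding lev_Suc_Suc by (simp add: less_mult_imp_div_less)
  have "2 * card {y. y < lev (Suc t) \<and> col (Suc t) y z = c} = card (fwd t (z div nwords t) (c div 2))"
    using halved[OF reg z, of c "\<lambda>_. True"] unfolding fwd_def by simp
  also have "\<dots> = 2 * wlen t" using reg x c' unfolding regular_level_def by blast
  finally show "card {y. y < lev (Suc t) \<and> col (Suc t) y z = c} = col_deg (Suc t)" unfolding col_deg_Suc by simp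
next
  fix y p and c :: nat assume y: "y < lev (Suc t)"
  have eq: "{z\<in>fwd (Suc t) y c. z div fibre (Suc t) = p} = {z. z < lev (Suc (Suc t)) \<and> z div nwords t = p \<and> col (Suc t) y z = c}"
    unfolding fwd_def by auto
  show "even (card {z\<in>fwd (Suc t) y c. z div fibre (Suc t) = p})"
  proof (cases "p < lev t")
    case True
    \<comment> \<open>Half of a fibre has to be even again, hence divisibility by 4.\<close>
    obtain k where "nwords t = 4*k" using nwords_dvd[of t] by (elim dvdE)
    define n where "n = card {z. z < lev (Suc (Suc t)) \<and> z div nwords t = p \<and> col (Suc t) y z = c}"
    have "2 * n = (if col t p y = c div 2 then 4*k else 0)"
      using fibre_fwd[OF reg y True, of c] unfolding \<open>nwords t = 4*k\<close> n_def .
    then have "n = (if col t p y = c div 2 then 2*k else 0)" by (simp split: if_splits)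
    then have "even n" by simp
    then show ?thesis unfolding eq n_def .
  next
    case False
    then have e: "{z. z < lev (Suc (Suc t)) \<and> z div nwords t = p \<and> col (Suc t) y z = c} = {}"
      unfolding lev_Suc_Suc by (auto simp: less_mult_imp_div_less)
    show ?thesis unfolding eq e by simp
  qed
qed

lemma regular_level: "regular_level t"
  by (induction t) (auto intro: regular_level_0 regular_level_Suc)

lemma card_fwd: "x < lev t \<Longrightarrow> c < 2^(t+1) \<Longrightarrow> card (fwd t x c) = 2 * wlen t"
  using regular_level[of t] unfolding regular_level_def by blast

lemma card_bwd: "y < lev (Suc t) \<Longrightarrow> c < 2^(t+1) \<Longrightarrow> card {x. x < lev t \<and> col t x y = c} = col_deg t"
  using regular_level[of t] unfolding regular_level_def by blast

text \<open>Replacing y and z by their parents drops two colour bits: the last one was set by the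
  word of z, the one before by the word of y. Each bit halves exactly.\<close>

lemma backward_lift:
  assumes z: "z < lev (Suc (Suc (Suc t)))"
  shows "4 * card {y. y < lev (Suc (Suc t)) \<and> col (Suc (Suc t)) y z = c \<and> Q (y div nwords t)}
    = nwords t * card {p. p < lev t \<and> col t p (z div nwords (Suc t)) = c div 4 \<and> Q p}"
proof -
  have x: "z div nwords (Suc t) < lev (Suc t)" using z unfolding lev_Suc_Suc by (simp add: less_mult_imp_div_less)
  have "4 * card {y. y < lev (Suc (Suc t)) \<and> col (Suc (Suc t)) y z = c \<and> Q (y div nwords t)} =
     2 * (2 * card {y. y < lev (Suc (Suc t)) \<and> col (Suc (Suc t)) y z = c \<and> Q (y div fibre (Suc t))})" by simp
  also have "\<dots> = 2 * card {y. y < lev (Suc (Suc t)) \<and> col (Suc t) (z div nwords (Suc t)) y = c div 2 \<and> Q (y div nwords t)}"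
    unfolding halved[OF regular_level z] by simp
  also have "\<dots> = nwords t * card {p. p < lev t \<and> col t p (z div nwords (Suc t)) = c div 2 div 2 \<and> Q p}"
    by (rule forward_lift[OF regular_level x])
  also have "c div 2 div 2 = c div 4" by (simp add: div_mult2_eq[symmetric])
  finally show ?thesis .
qed

section \<open>Separation and spectral gap\<close>

lemma rank_bij_fwd:
  assumes "x < lev t" "c < 2^(t+1)"
  shows "bij_betw (rank (fwd t x c)) (fwd t x c) {..<2 * wlen t}"
  using rank_bij_all[of "fwd t x c"] card_fwd[OF assms] by simp

text \<open>This fails for t = 0, since twins of level 1 have the same neighbours in level 0. An
  induction in steps of two therefore has to start from both 1 and 2.\<close>

definition separated :: "nat \<Rightarrow> bool" where
  "separated t \<longleftrightarrow> (\<forall>x<lev (Suc t). \<forall>x'<lev (Suc t). \<forall>c<2^(t+1). x \<noteq> x' \<longrightarrow>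
     col_deg t \<le> 8 * card {p. p < lev t \<and> col t p x = c \<and> col t p x' \<noteq> c})"

text \<open>Siblings recolour the same class of their parent by different codewords, so the distance
  of the code decides.\<close>

lemma separated_same_parent:
  assumes z: "z < lev (Suc (Suc t))" "z' < lev (Suc (Suc t))" "z \<noteq> z'"
    and par: "z div nwords t = z' div nwords t" and c: "c < 2^(Suc t+1)"
  shows "col_deg (Suc t) \<le> 8 * card {y. y < lev (Suc t) \<and> col (Suc t) y z = c \<and> col (Suc t) y z' \<noteq> c}"
proof -
  define S where "S = fwd t (z div nwords t) (c div 2)"
  have x: "z div nwords t < lev t" using z unfolding lev_Suc_Suc by (simp add: less_mult_imp_div_less)
  have c': "c div 2 < 2^(t+1)" using c by simp
  have j: "z mod nwords t \<noteq> z' mod nwords t" using z(3) par by (metis div_mult_mod_eq)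
  have eq: "{y. y < lev (Suc t) \<and> col (Suc t) y z = c \<and> col (Suc t) y z' \<noteq> c}
    = {y\<in>S. pword (wlen t) (z mod nwords t) (rank S y) = odd c \<and> pword (wlen t) (z' mod nwords t) (rank S y) \<noteq> odd c}"
  proof (rule set_eqI)
    fix y
    have "y < lev (Suc t)" if "y \<in> S" using that unfolding S_def fwd_def by simp
    then show "y \<in> {y. y < lev (Suc t) \<and> col (Suc t) y z = c \<and> col (Suc t) y z' \<noteq> c} \<longleftrightarrow>
      y \<in> {y\<in>S. pword (wlen t) (z mod nwords t) (rank S y) = odd c \<and> pword (wlen t) (z' mod nwords t) (rank S y) \<noteq> odd c}"
      using col_Suc_iff[of y t z c] col_Suc_iff[of y t z' c] par unfolding S_def by (cases "y < lev (Suc t)") auto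
  qed
  have "bij_betw (rank S) {y\<in>S. pword (wlen t) (z mod nwords t) (rank S y) = odd c \<and> pword (wlen t) (z' mod nwords t) (rank S y) \<noteq> odd c}
    {\<rho>\<in>{..<2 * wlen t}. pword (wlen t) (z mod nwords t) \<rho> = odd c \<and> pword (wlen t) (z' mod nwords t) \<rho> \<noteq> odd c}"
    unfolding S_def by (rule bij_betw_Collect[OF rank_bij_fwd[OF x c']]) simp
  then have "card {y. y < lev (Suc t) \<and> col (Suc t) y z = c \<and> col (Suc t) y z' \<noteq> c}
     = card {\<rho>\<in>{..<2 * wlen t}. pword (wlen t) (z mod nwords t) \<rho> = odd c \<and> pword (wlen t) (z' mod nwords t) \<rho> \<noteq> odd c}"
    unfolding eq by (rule bij_betw_same_card)
  also have "{\<rho>\<in>{..<2 * wlen t}. pword (wlen t) (z mod nwords t) \<rho> = odd c \<and> pword (wlen t) (z' mod nwords t) \<rho> \<noteq> odd c}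
    = {\<rho>. \<rho> < 2 * wlen t \<and> pword (wlen t) (z mod nwords t) \<rho> = odd c \<and> pword (wlen t) (z' mod nwords t) \<rho> \<noteq> odd c}" by auto
  finally show ?thesis
    using pword_distance[OF wlen_code[of t], of "z mod nwords t" "z' mod nwords t" "odd c"] j
    unfolding col_deg_Suc nwords_def by simp
qed

lemma separated_1: "separated 1"
  unfolding separated_def
proof (intro allI impI)
  fix z z' and c :: nat
  assume z: "z < lev (Suc 1)" "z' < lev (Suc 1)" and c: "c < 2^(1+1)" and ne: "z \<noteq> z'"
  show "col_deg 1 \<le> 8 * card {p. p < lev 1 \<and> col 1 p z = c \<and> col 1 p z' \<noteq> c}"
  proof (cases "z div nwords 0 = z' div nwords 0")
    case True
    then show ?thesis using separated_same_parent[of z 0 z' c] z c ne by simp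
  next
    case False
    define x x' where "x = z div nwords 0" and "x' = z' div nwords 0"
    have x: "x < nwords 0" "x' < nwords 0" "x \<noteq> x'"
      using z False unfolding x_def x'_def lev_0[symmetric] One_nat_def lev_Suc_Suc by (auto simp: less_mult_imp_div_less)
    have u1: "lev (Suc 0) = (2 * wlen 0) * 2" using lev_Suc[of 0] by simp
    \<comment> \<open>It is enough that y already has the wrong first colour bit towards the parent
      of z'. This depends on the twin pair of y alone, so exact halving preserves the count.\<close>
    define Q where "Q p = (of_bool (pword (wlen 0) x' p) \<noteq> c div 2)" for p
    have of: "(of_bool b = c div 2) = (b = (c div 2 = 1))" for b using c by auto
    have "2 * card {y. y < lev (Suc 0) \<and> col (Suc 0) y z = c \<and> Q (y div fibre 0)}
      = card {y. y < lev (Suc 0) \<and> col 0 (z div nwords 0) y = c div 2 \<and> Q (y div fibre 0)}"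
      by (rule halved[OF regular_level]) (use z in simp)
    also have "\<dots> = card {y. y < (2 * wlen 0) * 2 \<and> of_bool (pword (wlen 0) x (y div 2)) = c div 2 \<and> Q (y div 2)}"
      unfolding u1 x_def by simp
    also have "\<dots> = (\<Sum>\<rho><2 * wlen 0. card {j::nat. j < 2 \<and> of_bool (pword (wlen 0) x \<rho>) = c div 2 \<and> Q \<rho>})"
      by (rule card_divmod) simp
    also have "\<dots> = (\<Sum>\<rho><2 * wlen 0. 2 * of_bool (pword (wlen 0) x \<rho> = (c div 2 = 1) \<and> pword (wlen 0) x' \<rho> \<noteq> (c div 2 = 1)))"
      unfolding card_lt_2 Q_def of by (intro sum.cong) auto
    also have "\<dots> = 2 * card {\<rho>. \<rho> < 2 * wlen 0 \<and> pword (wlen 0) x \<rho> = (c div 2 = 1) \<and> pword (wlen 0) x' \<rho> \<noteq> (c div 2 = 1)}"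
      unfolding sum_distrib_left[symmetric] by (simp only: flip: card_eq_sum_of_bool)
    finally have "wlen 0 \<le> 8 * card {y. y < lev (Suc 0) \<and> col (Suc 0) y z = c \<and> Q (y div fibre 0)}"
      using pword_distance[OF wlen_code[of 0], of x x' "c div 2 = 1"] x unfolding nwords_def by simp
    also have "\<dots> \<le> 8 * card {p. p < lev 1 \<and> col 1 p z = c \<and> col 1 p z' \<noteq> c}"
    proof (intro mult_left_mono card_mono)
      show "{y. y < lev (Suc 0) \<and> col (Suc 0) y z = c \<and> Q (y div fibre 0)} \<subseteq> {p. p < lev 1 \<and> col 1 p z = c \<and> col 1 p z' \<noteq> c}"
      proof
        fix y assume y: "y \<in> {y. y < lev (Suc 0) \<and> col (Suc 0) y z = c \<and> Q (y div fibre 0)}"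
        then have "col (Suc 0) y z' div 2 \<noteq> c div 2"
          unfolding col_Suc_div_2 Q_def x'_def by simp
        then have "col (Suc 0) y z' \<noteq> c" by blast
        then show "y \<in> {p. p < lev 1 \<and> col 1 p z = c \<and> col 1 p z' \<noteq> c}" using y by simp
      qed
    qed auto
    finally show ?thesis using col_deg_Suc[of 0] by simp
  qed
qed

text \<open>A wrong prefix towards the parent of z' excludes the colour c, and the cells that
  exhibit it lift from level t with exactly the same proportion.\<close>

lemma separated_lift:
  assumes z: "z < lev (Suc (Suc (Suc t)))"
    and sep: "col_deg t \<le> 8 * card {p. p < lev t \<and> col t p (z div nwords (Suc t)) = c div 4 \<and> col t p (z' div nwords (Suc t)) \<noteq> c div 4}"
  shows "col_deg (Suc (Suc t)) \<le> 8 * card {y. y < lev (Suc (Suc t)) \<and> col (Suc (Suc t)) y z = c \<and> col (Suc (Suc t)) y z' \<noteq> c}"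
proof -
  have "4 * col_deg (Suc (Suc t)) = col_deg t * nwords t" unfolding col_deg_Suc by (rule wlen_Suc)
  also have "\<dots> \<le> 8 * (nwords t * card {p. p < lev t \<and> col t p (z div nwords (Suc t)) = c div 4 \<and> col t p (z' div nwords (Suc t)) \<noteq> c div 4})"
    using mult_right_mono[OF sep, of "nwords t"] by (simp add: mult_ac)
  also have "\<dots> = 8 * (4 * card {y. y < lev (Suc (Suc t)) \<and> col (Suc (Suc t)) y z = c \<and> col t (y div nwords t) (z' div nwords (Suc t)) \<noteq> c div 4})"
    by (simp only: backward_lift[OF z, of c "\<lambda>p. col t p (z' div nwords (Suc t)) \<noteq> c div 4"])
  also have "\<dots> \<le> 8 * (4 * card {y. y < lev (Suc (Suc t)) \<and> col (Suc (Suc t)) y z = c \<and> col (Suc (Suc t)) y z' \<noteq> c})"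
  proof (intro mult_left_mono card_mono)
    have "col (Suc (Suc t)) y z' div 4 = col t (y div nwords t) (z' div nwords (Suc t))" for y
    proof -
      have "col (Suc (Suc t)) y z' div 4 = col (Suc (Suc t)) y z' div 2 div 2" by (simp add: div_mult2_eq[symmetric])
      then show ?thesis by (simp only: col_Suc_div_2)
    qed
    then have "col (Suc (Suc t)) y z' \<noteq> c" if "col t (y div nwords t) (z' div nwords (Suc t)) \<noteq> c div 4" for y
      using that by metis
    then show "{y. y < lev (Suc (Suc t)) \<and> col (Suc (Suc t)) y z = c \<and> col t (y div nwords t) (z' div nwords (Suc t)) \<noteq> c div 4}
      \<subseteq> {y. y < lev (Suc (Suc t)) \<and> col (Suc (Suc t)) y z = c \<and> col (Suc (Suc t)) y z' \<noteq> c}" by blast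
  qed auto
  finally show ?thesis by simp
qed

text \<open>Twins in \<open>{..<lev 1}\<close> have consecutive ranks, so they always receive different colours.\<close>

lemma twins_differ:
  assumes x: "x < lev 1" "x' < lev 1" "x \<noteq> x'" "x div 2 = x' div 2" and y: "y < lev 2"
  shows "col 1 x y \<noteq> col 1 x' y"
proof -
  define p where "p = y div nwords 0"
  have p: "p < lev 0" using y unfolding p_def numeral_2_eq_2 lev_Suc_Suc by (simp add: less_mult_imp_div_less)
  have *: "col 1 (2*a) y \<noteq> col 1 (2*a+1) y" if a: "2*a+1 < lev 1" for a
  proof -
    define c where "c = col 0 p (2*a)"
    define S where "S = fwd 0 p c"
    have c': "col 0 p (2*a+1) = c" unfolding c_def by simp
    have in1: "2*a \<in> S" and in2: "2*a+1 \<in> S" using a c' unfolding S_def fwd_def c_def by auto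
    have "even (rank S (a*fibre 0))"
      by (rule even_rank) (use regular_level[of 0] p in \<open>auto simp: S_def regular_level_def\<close>)
    then have ev: "even (rank S (2*a))" by (simp add: mult.commute)
    have "{y\<in>S. y < 2*a+1} = insert (2*a) {y\<in>S. y < 2*a}" using in1 by auto
    moreover have "finite S" unfolding S_def by simp
    ultimately have r: "rank S (2*a+1) = Suc (rank S (2*a))" unfolding rank_def by simp
    have "pword (wlen 0) (y mod nwords 0) (rank S (2*a)) \<noteq> pword (wlen 0) (y mod nwords 0) (rank S (2*a+1))"
      unfolding r pword_def using ev by simp
    then show ?thesis
      using col_Suc_eq[of "2*a" 0 y c] col_Suc_eq[of "2*a+1" 0 y c] in1 in2 unfolding S_def p_def by auto
  qed
  define a where "a = x div 2"
  have "x = 2*a \<or> x = 2*a+1" "x' = 2*a \<or> x' = 2*a+1" using x(4) unfolding a_def by auto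
  then have "x = 2*a \<and> x' = 2*a+1 \<or> x = 2*a+1 \<and> x' = 2*a" using x(3) by metis
  then show ?thesis
  proof
    assume "x = 2*a \<and> x' = 2*a+1"
    moreover from this have "2*a+1 < lev 1" using x(2) by simp
    ultimately show ?thesis using *[of a] by metis
  next
    assume "x = 2*a+1 \<and> x' = 2*a"
    moreover from this have "2*a+1 < lev 1" using x(1) by simp
    ultimately show ?thesis using *[of a] by metis
  qed
qed

lemma parity_differs: "a div 2 = b div 2 \<Longrightarrow> a \<noteq> b \<Longrightarrow> odd a \<noteq> odd (b::nat)"
  by (metis dvd_mult_div_cancel odd_two_times_div_two_succ)

text \<open>Distinct parents in level 1 are separated in one of three ways: twins never share a
  colour towards level 2, the two positions of one pair always carry opposite bits, and positions of
  different pairs are orthogonal, which leaves a quarter of all words.\<close>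

lemma separated_2: "separated 2"
  unfolding separated_def
proof (intro allI impI)
  fix z z' and c :: nat
  assume z: "z < lev (Suc 2)" "z' < lev (Suc 2)" and c: "c < 2^(2+1)" and ne: "z \<noteq> z'"
  define x x' where "x = z div nwords 1" and "x' = z' div nwords 1"
  have x: "x < lev 1" "x' < lev 1"
    using z unfolding x_def x'_def numeral_2_eq_2 One_nat_def lev_Suc_Suc by (auto simp: less_mult_imp_div_less)
  show "col_deg 2 \<le> 8 * card {p. p < lev 2 \<and> col 2 p z = c \<and> col 2 p z' \<noteq> c}"
  proof (cases "x = x'")
    case True
    then show ?thesis using separated_same_parent[of z 1 z' c] z c ne unfolding x_def x'_def by (simp add: numeral_2_eq_2)
  next
    case ne': False
    show ?thesis
    proof (cases "x div 2 = x' div 2")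
      case True
      have "col 2 y z \<noteq> col 2 y z'" if "y < lev 2" for y
        using twins_differ[OF x ne' True that] col_Suc_div_2[of 1 y z] col_Suc_div_2[of 1 y z']
        unfolding x_def x'_def by (auto simp: numeral_2_eq_2)
      then have "{p. p < lev 2 \<and> col 2 p z = c \<and> col 2 p z' \<noteq> c} = {p. p < lev 2 \<and> col 2 p z = c}" by metis
      then show ?thesis using card_bwd[OF z(1) c] by simp
    next
      case False
      have u1: "lev 1 = (2 * wlen 0) * 2" using lev_Suc[of 0] by simp
      have \<rho>: "x div 2 < 2 * wlen 0" "x' div 2 < 2 * wlen 0" using x unfolding u1 by auto
      have c4: "c div 4 < 2^(0+1)" using c by simp
      have of: "(of_bool b = c div 4) = (b = (c div 4 = 1))" for b using c4 by auto
      let ?b = "c div 4 = 1"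
      have eq: "{p. p < lev 0 \<and> col 0 p x = c div 4 \<and> col 0 p x' \<noteq> c div 4} =
        {j. j < 2^(wlen 0 div 4) \<and> pword (wlen 0) j (x div 2) = ?b \<and> pword (wlen 0) j (x' div 2) \<noteq> ?b}"
        unfolding lev_0 nwords_def using of by simp
      have "lev 0 \<le> 8 * card {p. p < lev 0 \<and> col 0 p x = c div 4 \<and> col 0 p x' \<noteq> c div 4}"
      proof (cases "x div 2 div 2 = x' div 2 div 2")
        case True
        then have "odd (x div 2) \<noteq> odd (x' div 2)" using parity_differs False by blast
        then have "pword (wlen 0) j (x div 2) = ?b \<and> pword (wlen 0) j (x' div 2) \<noteq> ?b \<longleftrightarrow> pword (wlen 0) j (x div 2) = ?b" for j
          unfolding pword_def True by blast
        then have e: "{j. j < 2^(wlen 0 div 4) \<and> pword (wlen 0) j (x div 2) = ?b \<and> pword (wlen 0) j (x' div 2) \<noteq> ?b}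
          = {j. j < 2^(wlen 0 div 4) \<and> pword (wlen 0) j (x div 2) = ?b}" by blast
        have half: "K \<le> 8 * n" if "2 * n = K" for n K :: nat using that by simp
        show ?thesis unfolding eq e unfolding lev_0 nwords_def by (rule half[OF pword_balanced[OF wlen_code \<rho>(1)]])
      next
        case F: False
        have quarter: "K \<le> 8 * n" if "4 * n = K" for n K :: nat using that by simp
        show ?thesis unfolding eq unfolding lev_0 nwords_def by (rule quarter[OF pword_orthogonal[OF wlen_code \<rho> F]])
      qed
      moreover have "col_deg 0 \<le> lev 0" unfolding col_deg_def by simp
      ultimately have "col_deg 0 \<le> 8 * card {p. p < lev 0 \<and> col 0 p x = c div 4 \<and> col 0 p x' \<noteq> c div 4}"
        by linarith
      then show ?thesis using separated_lift[of z 0 c z'] z unfolding x_def x'_def by (simp add: numeral_2_eq_2)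
    qed
  qed
qed

lemma separated_step:
  assumes sep: "separated t"
  shows "separated (Suc (Suc t))"
  unfolding separated_def
proof (intro allI impI)
  fix z z' and c :: nat
  assume z: "z < lev (Suc (Suc (Suc t)))" "z' < lev (Suc (Suc (Suc t)))" and c: "c < 2^(Suc (Suc t)+1)" and ne: "z \<noteq> z'"
  show "col_deg (Suc (Suc t)) \<le> 8 * card {p. p < lev (Suc (Suc t)) \<and> col (Suc (Suc t)) p z = c \<and> col (Suc (Suc t)) p z' \<noteq> c}"
  proof (cases "z div nwords (Suc t) = z' div nwords (Suc t)")
    case True
    then show ?thesis using separated_same_parent[of z "Suc t" z' c] z c ne by simp
  next
    case False
    have x: "z div nwords (Suc t) < lev (Suc t)" "z' div nwords (Suc t) < lev (Suc t)"
      using z unfolding lev_Suc_Suc[of "Suc t"] by (auto simp: less_mult_imp_div_less)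
    have "c div 4 < 2^(t+1)" using c by simp
    then have "col_deg t \<le> 8 * card {p. p < lev t \<and> col t p (z div nwords (Suc t)) = c div 4 \<and> col t p (z' div nwords (Suc t)) \<noteq> c div 4}"
      using sep x False unfolding separated_def by blast
    then show ?thesis by (rule separated_lift[OF z(1)])
  qed
qed

lemma separated: "separated (Suc t)"
proof (induction t rule: less_induct)
  case (less t)
  consider "t = 0" | "t = 1" | s where "t = Suc (Suc s)" by (metis One_nat_def not0_implies_Suc)
  then show ?case
  proof cases
    case 1 then show ?thesis using separated_1 by simp
  next
    case 2 then show ?thesis using separated_2 by (simp add: numeral_2_eq_2)
  next
    case 3 then show ?thesis using separated_step[OF less[of s]] by simp
  qed
qed

section \<open>Spectral gap: squared operator norm of a 0/1 matrix on functions of sum zero\<close>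

definition spectral :: "nat \<Rightarrow> nat \<Rightarrow> (nat \<Rightarrow> nat \<Rightarrow> bool) \<Rightarrow> real \<Rightarrow> bool" where
  "spectral a b D \<kappa> \<longleftrightarrow> (\<forall>f. (\<Sum>y<b. f y) = 0 \<longrightarrow>
     (\<Sum>x<a. (\<Sum>y<b. of_bool (D x y) * f y)^2) \<le> \<kappa> * (\<Sum>y<b. (f y)^2))"

text \<open>Constant row sums make the transposed image F of g sum to zero, so the hypothesis
  applies to F, and |F|^2 = (g, DF) is bounded by Cauchy-Schwarz. The recursion over the levels
  produces the operator in the opposite direction each time.\<close>

lemma spectral_transpose:
  assumes sp: "spectral a b D \<kappa>" and reg: "\<And>x. x < a \<Longrightarrow> card {y. y < b \<and> D x y} = d" and "\<kappa> \<ge> 0"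
  shows "spectral b a (\<lambda>y x. D x y) \<kappa>"
  unfolding spectral_def
proof (intro allI impI)
  fix g :: "nat \<Rightarrow> real" assume g0: "(\<Sum>x<a. g x) = 0"
  define F where "F y = (\<Sum>x<a. of_bool (D x y) * g x)" for y
  define H where "H x = (\<Sum>y<b. of_bool (D x y) * F y)" for x
  have "(\<Sum>y<b. F y) = (\<Sum>x<a. \<Sum>y<b. of_bool (D x y) * g x)"
    unfolding F_def by (rule sum.swap)
  also have "\<dots> = (\<Sum>x<a. real d * g x)"
  proof (rule sum.cong[OF refl])
    fix x assume "x \<in> {..<a}"
    then have "(\<Sum>y<b. of_bool (D x y)) = d" using reg[of x] unfolding card_eq_sum_of_bool by simp
    then have "(\<Sum>y<b. real (of_bool (D x y))) = real d" by (metis of_nat_sum)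
    then show "(\<Sum>y<b. of_bool (D x y) * g x) = real d * g x" by (simp flip: sum_distrib_right)
  qed
  also have "\<dots> = 0" using g0 by (simp flip: sum_distrib_left)
  finally have F0: "(\<Sum>y<b. F y) = 0" .
  have H: "(\<Sum>x<a. (H x)^2) \<le> \<kappa> * (\<Sum>y<b. (F y)^2)"
    using sp F0 unfolding spectral_def H_def by blast
  define SF Sg where "SF = (\<Sum>y<b. (F y)^2)" and "Sg = (\<Sum>x<a. (g x)^2)"
  have pos: "SF \<ge> 0" "Sg \<ge> 0" unfolding SF_def Sg_def by (auto intro: sum_nonneg)
  have "SF = (\<Sum>y<b. \<Sum>x<a. of_bool (D x y) * g x * F y)"
    unfolding SF_def power2_eq_square
    by (intro sum.cong refl) (subst (1) F_def, simp only: sum_distrib_right)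
  also have "\<dots> = (\<Sum>x<a. \<Sum>y<b. of_bool (D x y) * g x * F y)" by (rule sum.swap)
  also have "\<dots> = (\<Sum>x<a. g x * H x)"
    unfolding H_def sum_distrib_left by (intro sum.cong refl) (simp add: mult_ac)
  finally have SF: "SF = (\<Sum>x<a. g x * H x)" .
  have "SF^2 \<le> Sg * (\<Sum>x<a. (H x)^2)"
    unfolding SF Sg_def by (rule Cauchy_Schwarz_ineq_sum)
  also have "\<dots> \<le> Sg * (\<kappa> * SF)" using H pos unfolding SF_def by (intro mult_left_mono) auto
  finally have "SF * SF \<le> (\<kappa> * Sg) * SF" by (simp add: power2_eq_square mult_ac)
  then have "SF \<le> \<kappa> * Sg"
    using pos \<open>\<kappa> \<ge> 0\<close> by (cases "SF = 0") (auto simp: mult_le_cancel_right)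
  then show "(\<Sum>y<b. (\<Sum>x<a. of_bool (D x y) * g x)^2) \<le> \<kappa> * (\<Sum>x<a. (g x)^2)"
    unfolding SF_def Sg_def F_def .
qed

lemma of_bool_eq_sign: "of_bool (x = b) = (1 + sign b * sign x) / (2::real)"
  by (cases x; cases b) (auto simp: sign_def)

text \<open>The squared norm relative to the product of the two degrees, so that it can be compared
  between levels.\<close>

fun spec_gap :: "nat \<Rightarrow> real" where
  "spec_gap 0 = 1 / wlen 0"
| "spec_gap (Suc t) = spec_gap t + 1 / wlen t"

lemma spec_gap_nonneg: "spec_gap t \<ge> 0"
  by (induction t) auto

lemma spec_gap_le: "spec_gap t \<le> 3 / 2^15"
proof -
  \<comment> \<open>Word lengths dominate 2^(t+15), so the increments are bounded by a geometric
    series; the subtracted term is its remaining tail.\<close>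
  have "spec_gap t \<le> 3 / 2^15 - 2 / 2^(t+15)"
  proof (induction t)
    case (Suc t)
    have "real (2^(t+15)) \<le> real (wlen t)" using wlen_ge[of t] by (simp only: of_nat_le_iff)
    then have "1 / real (wlen t) \<le> 1 / 2^(t+15)" by (intro divide_left_mono) auto
    moreover have "2 / 2^(Suc t+15) = (1 / 2^(t+15) :: real)" by (simp add: power_add)
    ultimately show ?case using Suc by simp
  qed (simp add: wlen_0)
  then show ?thesis by (smt (verit) zero_less_power divide_pos_pos)
qed

definition spec_bound :: "nat \<Rightarrow> real" where
  "spec_bound t = spec_gap t * (2 * real (wlen t)) * real (col_deg t)"

lemma spec_bound_nonneg: "spec_bound t \<ge> 0"
  unfolding spec_bound_def using spec_gap_nonneg[of t] by simp

lemma spectral_0: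
  assumes c: "c < 2"
  shows "spectral (lev 0) (lev 1) (\<lambda>x y. col 0 x y = c) (spec_bound 0)"
  unfolding spectral_def
proof (intro allI impI)
  fix f :: "nat \<Rightarrow> real" assume f0: "(\<Sum>y<lev 1. f y) = 0"
  let ?h = "wlen 0"
  have u1: "lev 1 = (2 * ?h) * 2" using lev_Suc[of 0] by simp
  define F where "F \<rho> = f (2*\<rho>) + f (2*\<rho>+1)" for \<rho>
  define b where "b = (c = 1)"
  have eq: "col 0 x y = c \<longleftrightarrow> pword ?h x (y div 2) = b" for x y using c unfolding b_def by auto
  have inner: "(\<Sum>y<lev 1. of_bool (col 0 x y = c) * f y) = sign b / 2 * (\<Sum>\<rho><2 * ?h. sign (pword ?h x \<rho>) * F \<rho>)" for x
  proof -
    have "(\<Sum>y<lev 1. of_bool (col 0 x y = c) * f y) = (\<Sum>y<lev 1. f y) / 2 + sign b / 2 * (\<Sum>y<lev 1. sign (pword ?h x (y div 2)) * f y)"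
      unfolding eq of_bool_eq_sign sum_distrib_left sum_divide_distrib sum.distrib[symmetric]
      by (intro sum.cong refl) (simp add: field_simps)
    also have "(\<Sum>y<lev 1. sign (pword ?h x (y div 2)) * f y) = (\<Sum>y<(2 * ?h) * 2. sign (pword ?h x (y div 2)) * f (2 * (y div 2) + y mod 2))"
      unfolding u1 by simp
    also have "\<dots> = (\<Sum>\<rho><2 * ?h. \<Sum>e<2. sign (pword ?h x \<rho>) * f (2 * \<rho> + e))"
      by (rule sum_divmod[of 2 "\<lambda>\<rho> e. sign (pword ?h x \<rho>) * f (2*\<rho>+e)"]) simp
    also have "\<dots> = (\<Sum>\<rho><2 * ?h. sign (pword ?h x \<rho>) * F \<rho>)"
      unfolding F_def by (intro sum.cong refl) (simp add: numeral_2_eq_2 algebra_simps)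
    finally show ?thesis using f0 by simp
  qed
  have "(\<Sum>x<lev 0. (\<Sum>y<lev 1. of_bool (col 0 x y = c) * f y)^2) = 1/4 * (\<Sum>j<2^(?h div 4). (\<Sum>\<rho><2 * ?h. sign (pword ?h j \<rho>) * F \<rho>)^2)"
  proof -
    have sq: "(sign b / 2 * X)^2 = 1/4 * X^2" for X by (simp add: power2_eq_square sign_def)
    show ?thesis unfolding inner sq lev_0 nwords_def by (rule sum_distrib_left[symmetric])
  qed
  also have "\<dots> \<le> 1/4 * (2 * 2^(?h div 4) * (\<Sum>\<rho><2 * ?h. (F \<rho>)^2))"
    by (intro mult_left_mono pword_sum_square[OF wlen_code]) auto
  also have "\<dots> \<le> 1/4 * (2 * 2^(?h div 4) * (2 * (\<Sum>y<2 * (2 * ?h). (f y)^2)))"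
    unfolding F_def by (intro mult_left_mono sum_pairs_square_le) auto
  also have "\<dots> = real (lev 0) * (\<Sum>y<lev 1. (f y)^2)"
    unfolding u1 lev_0 nwords_def by (simp add: mult.commute)
  also have "real (lev 0) = spec_bound 0"
    using lev_col_deg[of 0] unfolding spec_bound_def by simp
  finally show "(\<Sum>x<lev 0. (\<Sum>y<lev 1. of_bool (col 0 x y = c) * f y)^2) \<le> spec_bound 0 * (\<Sum>y<lev 1. (f y)^2)" .
qed

text \<open>On the children of x the operator is half the old one at x plus a fluctuation determined
  by the codeword. Summed over all codewords, the mixed terms vanish by balance and the squared
  fluctuations are bounded by orthogonality through f on the class of x alone. Relative to the
  degrees, the old bound is inherited and \<open>1 / wlen t\<close> is added.\<close>

lemma spectral_step:
  assumes IH: "spectral (lev t) (lev (Suc t)) (\<lambda>x y. col t x y = c div 2) (spec_bound t)" and c: "c < 2^(Suc t+1)"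
  shows "spectral (lev (Suc (Suc t))) (lev (Suc t)) (\<lambda>z y. col (Suc t) y z = c) (spec_bound (Suc t))"
  unfolding spectral_def
proof (intro allI impI)
  fix f :: "nat \<Rightarrow> real" assume f0: "(\<Sum>y<lev (Suc t). f y) = 0"
  let ?h = "wlen t" let ?K = "2^(?h div 4) :: nat"
  define c' where "c' = c div 2"
  have c': "c' < 2^(t+1)" using c unfolding c'_def by simp
  define S where "S x = fwd t x c'" for x
  define Fx where "Fx x = (\<Sum>y<lev (Suc t). of_bool (col t x y = c') * f y)" for x
  define G where "G x \<rho> = f (inv_into (S x) (rank (S x)) \<rho>)" for x \<rho>
  define T where "T x j = (\<Sum>\<rho><2 * ?h. sign (pword ?h j \<rho>) * G x \<rho>)" for x j
  have sumS: "(\<Sum>y<lev (Suc t). of_bool (y \<in> S x) * k y) = (\<Sum>y\<in>S x. k y)" for x and k :: "nat \<Rightarrow> real"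
  proof -
    have "S x = {..<lev (Suc t)} \<inter> S x" unfolding S_def fwd_def by auto
    then have "(\<Sum>y\<in>S x. k y) = (\<Sum>y<lev (Suc t). if y \<in> S x then k y else 0)"
      by (metis finite_lessThan sum.inter_restrict)
    also have "\<dots> = (\<Sum>y<lev (Suc t). of_bool (y \<in> S x) * k y)" by (intro sum.cong) auto
    finally show ?thesis ..
  qed
  have colS: "col t x y = c' \<longleftrightarrow> y \<in> S x" if "y < lev (Suc t)" for x y using that unfolding S_def fwd_def by simp
  have FxS: "Fx x = (\<Sum>y\<in>S x. f y)" for x
    unfolding Fx_def sumS[symmetric] by (intro sum.cong refl) (simp add: colS)
  have reindex: "(\<Sum>y\<in>S x. k (rank (S x) y) (f y)) = (\<Sum>\<rho><2 * ?h. k \<rho> (G x \<rho>))" if x: "x < lev t" for x and k :: "nat \<Rightarrow> real \<Rightarrow> real"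
  proof -
    note bij = rank_bij_fwd[OF x c', folded S_def]
    have "(\<Sum>\<rho><2 * ?h. k \<rho> (G x \<rho>)) = (\<Sum>y\<in>S x. k (rank (S x) y) (G x (rank (S x) y)))"
      by (rule sum.reindex_bij_betw[OF bij, symmetric])
    also have "\<dots> = (\<Sum>y\<in>S x. k (rank (S x) y) (f y))"
      unfolding G_def using bij by (intro sum.cong refl) (simp add: bij_betw_def)
    finally show ?thesis ..
  qed
  have inner: "(\<Sum>y<lev (Suc t). of_bool (col (Suc t) y z = c) * f y) = 1/2 * (Fx (z div ?K) + sign (odd c) * T (z div ?K) (z mod ?K))"
    if z: "z < lev t * ?K" for z
  proof -
    define x where "x = z div ?K"
    have x: "x < lev t" using z unfolding x_def by (simp add: less_mult_imp_div_less)
    have "(\<Sum>y<lev (Suc t). of_bool (col (Suc t) y z = c) * f y) = (\<Sum>y<lev (Suc t). of_bool (y \<in> S x) * (of_bool (pword ?h (z mod ?K) (rank (S x) y) = odd c) * f y))"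
      by (intro sum.cong refl) (simp add: col_Suc_iff S_def c'_def x_def nwords_def)
    also have "\<dots> = (\<Sum>y\<in>S x. of_bool (pword ?h (z mod ?K) (rank (S x) y) = odd c) * f y)" by (rule sumS)
    also have "\<dots> = 1/2 * ((\<Sum>y\<in>S x. f y) + sign (odd c) * (\<Sum>y\<in>S x. sign (pword ?h (z mod ?K) (rank (S x) y)) * f y))"
      unfolding of_bool_eq_sign sum_distrib_left sum.distrib[symmetric]
      by (intro sum.cong refl) (simp add: field_simps)
    also have "(\<Sum>y\<in>S x. sign (pword ?h (z mod ?K) (rank (S x) y)) * f y) = T x (z mod ?K)"
      unfolding T_def by (rule reindex[OF x, of "\<lambda>\<rho> v. sign (pword ?h (z mod ?K) \<rho>) * v"])
    finally show ?thesis unfolding FxS x_def .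
  qed
  have "(\<Sum>z<lev (Suc (Suc t)). (\<Sum>y<lev (Suc t). of_bool (col (Suc t) y z = c) * f y)^2)
    = (\<Sum>z<lev t * ?K. (1/2 * (Fx (z div ?K) + sign (odd c) * T (z div ?K) (z mod ?K)))^2)"
    unfolding lev_Suc_Suc nwords_def by (rule sum.cong[OF refl], simp only: lessThan_iff inner)
  also have "\<dots> = (\<Sum>x<lev t. \<Sum>j<?K. (1/2 * (Fx x + sign (odd c) * T x j))^2)"
    by (rule sum_divmod[of ?K "\<lambda>x j. (1/2 * (Fx x + sign (odd c) * T x j))^2"]) simp
  also have "\<dots> \<le> (\<Sum>x<lev t. real ?K / 4 * (Fx x)^2 + real ?K / 2 * (\<Sum>y\<in>S x. (f y)^2))"
  proof (rule sum_mono)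
    fix x assume "x \<in> {..<lev t}" then have x: "x < lev t" by simp
    have "(\<Sum>j<?K. (1/2 * (Fx x + sign (odd c) * T x j))^2)
      = (\<Sum>j<?K. 1/4 * (Fx x)^2 + (sign (odd c) * Fx x / 2) * T x j + 1/4 * (T x j)^2)"
      by (intro sum.cong refl) (simp add: power2_eq_square algebra_simps sign_def)
    also have "\<dots> = real ?K / 4 * (Fx x)^2 + (sign (odd c) * Fx x / 2) * (\<Sum>j<?K. T x j) + 1/4 * (\<Sum>j<?K. (T x j)^2)"
      by (simp add: sum.distrib sum_distrib_left)
    also have "(\<Sum>j<?K. T x j) = 0" unfolding T_def by (rule pword_sum_zero[OF wlen_code])
    also have "(\<Sum>j<?K. (T x j)^2) \<le> 2 * 2^(?h div 4) * (\<Sum>\<rho><2 * ?h. (G x \<rho>)^2)"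
      unfolding T_def by (rule pword_sum_square[OF wlen_code])
    also have "(\<Sum>\<rho><2 * ?h. (G x \<rho>)^2) = (\<Sum>y\<in>S x. (f y)^2)"
      by (rule reindex[OF x, of "\<lambda>\<rho> v. v^2", symmetric])
    finally show "(\<Sum>j<?K. (1/2 * (Fx x + sign (odd c) * T x j))^2) \<le> real ?K / 4 * (Fx x)^2 + real ?K / 2 * (\<Sum>y\<in>S x. (f y)^2)"
      by (simp add: mult.commute)
  qed
  also have "\<dots> = real ?K / 4 * (\<Sum>x<lev t. (Fx x)^2) + real ?K / 2 * (\<Sum>x<lev t. \<Sum>y\<in>S x. (f y)^2)"
    by (simp add: sum.distrib sum_distrib_left)
  also have "(\<Sum>x<lev t. \<Sum>y\<in>S x. (f y)^2) = (\<Sum>y<lev (Suc t). real (col_deg t) * (f y)^2)"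
  proof -
    have "(\<Sum>x<lev t. \<Sum>y\<in>S x. (f y)^2) = (\<Sum>x<lev t. \<Sum>y<lev (Suc t). of_bool (col t x y = c') * (f y)^2)"
      unfolding sumS[symmetric] by (intro sum.cong refl) (simp add: colS)
    also have "\<dots> = (\<Sum>y<lev (Suc t). (\<Sum>x<lev t. of_bool (col t x y = c')) * (f y)^2)"
      by (subst sum.swap) (simp add: sum_distrib_right)
    also have "\<dots> = (\<Sum>y<lev (Suc t). real (col_deg t) * (f y)^2)"
    proof (rule sum.cong[OF refl])
      fix y assume "y \<in> {..<lev (Suc t)}"
      then have "(\<Sum>x<lev t. of_bool (col t x y = c')) = col_deg t"
        using card_bwd[of y t c'] c' unfolding card_eq_sum_of_bool by simp
      then have "(\<Sum>x<lev t. real (of_bool (col t x y = c'))) = real (col_deg t)" by (metis of_nat_sum)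
      then show "(\<Sum>x<lev t. of_bool (col t x y = c')) * (f y)^2 = real (col_deg t) * (f y)^2" by simp
    qed
    finally show ?thesis .
  qed
  also have "real ?K / 4 * (\<Sum>x<lev t. (Fx x)^2) \<le> real ?K / 4 * (spec_bound t * (\<Sum>y<lev (Suc t). (f y)^2))"
    using IH f0 unfolding spectral_def Fx_def c'_def by (intro mult_left_mono) auto
  also have "real ?K / 4 * (spec_bound t * (\<Sum>y<lev (Suc t). (f y)^2)) + real ?K / 2 * (\<Sum>y<lev (Suc t). real (col_deg t) * (f y)^2)
    = (real ?K / 4 * spec_bound t + real ?K / 2 * real (col_deg t)) * (\<Sum>y<lev (Suc t). (f y)^2)"
    by (simp add: sum_distrib_left[symmetric] algebra_simps)
  also have "real ?K / 4 * spec_bound t + real ?K / 2 * real (col_deg t) = spec_bound (Suc t)"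
  proof -
    have "4 * real (wlen (Suc t)) = real (col_deg t) * real ?K"
      using wlen_Suc[of t] unfolding nwords_def by (metis of_nat_mult of_nat_numeral)
    then have "2 * real (wlen (Suc t)) = real (col_deg t) * real ?K / 2" by simp
    then show ?thesis unfolding spec_bound_def col_deg_Suc spec_gap.simps by (simp add: field_simps)
  qed
  finally show "(\<Sum>z<lev (Suc (Suc t)). (\<Sum>y<lev (Suc t). of_bool (col (Suc t) y z = c) * f y)^2) \<le> spec_bound (Suc t) * (\<Sum>y<lev (Suc t). (f y)^2)"
    by simp
qed

lemma spectral_backward:
  assumes "spectral (lev (Suc t)) (lev t) (\<lambda>y x. col t x y = c) (spec_bound t)" "c < 2^(t+1)"
  shows "spectral (lev t) (lev (Suc t)) (\<lambda>x y. col t x y = c) (spec_bound t)"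
  by (rule spectral_transpose[OF assms(1) _ spec_bound_nonneg]) (use card_bwd assms(2) in auto)

lemma spectral_col:
  assumes "c < 2^(t+1)"
  shows "spectral (lev t) (lev (Suc t)) (\<lambda>x y. col t x y = c) (spec_bound t)"
  using assms
proof (induction t arbitrary: c)
  case 0 then show ?case using spectral_0[of c] by simp
next
  case (Suc t)
  then have "spectral (lev (Suc (Suc t))) (lev (Suc t)) (\<lambda>z y. col (Suc t) y z = c) (spec_bound (Suc t))"
    by (intro spectral_step) auto
  then show ?case using Suc.prems by (intro spectral_backward) auto
qed

section \<open>Blowing up a level\<close>

text \<open>Cauchy-Schwarz costs the square of the number of colours, which is exactly the growth of
  the product of the degrees; the relative bound is unchanged.\<close>

lemma spectral_union:
  assumes sp: "\<And>c. c \<in> C \<Longrightarrow> spectral a b (\<lambda>x y. M x y = c) \<kappa>" and C: "finite C"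
  shows "spectral a b (\<lambda>x y. M x y \<in> C) (real (card C)^2 * \<kappa>)"
  unfolding spectral_def
proof (intro allI impI)
  fix f :: "nat \<Rightarrow> real" assume f0: "(\<Sum>y<b. f y) = 0"
  define T where "T c x = (\<Sum>y<b. of_bool (M x y = c) * f y)" for c x
  have inner: "(\<Sum>y<b. of_bool (M x y \<in> C) * f y) = (\<Sum>c\<in>C. T c x)" for x
  proof -
    have "of_bool (M x y \<in> C) = (\<Sum>c\<in>C. of_bool (M x y = c) :: real)" for y
      using C by (auto simp: of_bool_def)
    then show ?thesis unfolding T_def by (subst sum.swap) (simp only: sum_distrib_right)
  qed
  have "(\<Sum>x<a. (\<Sum>y<b. of_bool (M x y \<in> C) * f y)^2) \<le> (\<Sum>x<a. real (card C) * (\<Sum>c\<in>C. (T c x)^2))"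
    unfolding inner
  proof (rule sum_mono)
    fix x show "(\<Sum>c\<in>C. T c x)^2 \<le> real (card C) * (\<Sum>c\<in>C. (T c x)^2)"
      using Cauchy_Schwarz_ineq_sum[of "\<lambda>_. 1" "\<lambda>c. T c x" C] by simp
  qed
  also have "\<dots> = real (card C) * (\<Sum>c\<in>C. \<Sum>x<a. (T c x)^2)"
    by (subst sum.swap) (simp only: sum_distrib_left)
  also have "\<dots> \<le> real (card C) * (\<Sum>c\<in>C. \<kappa> * (\<Sum>y<b. (f y)^2))"
    using sp f0 unfolding spectral_def T_def by (intro mult_left_mono sum_mono) auto
  also have "\<dots> = real (card C)^2 * \<kappa> * (\<Sum>y<b. (f y)^2)" by (simp add: power2_eq_square)
  finally show "(\<Sum>x<a. (\<Sum>y<b. of_bool (M x y \<in> C) * f y)^2) \<le> real (card C)^2 * \<kappa> * (\<Sum>y<b. (f y)^2)" .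
qed

lemma spectral_blowup:
  assumes sp: "spectral a b D \<kappa>" and kl: "k > 0" "l > 0" and "\<kappa> \<ge> 0"
  shows "spectral (a*k) (b*l) (\<lambda>x y. D (x div k) (y div l)) (real k * real l * \<kappa>)"
  unfolding spectral_def
proof (intro allI impI)
  fix f :: "nat \<Rightarrow> real" assume f0: "(\<Sum>y<b*l. f y) = 0"
  define F where "F y = (\<Sum>j<l. f (y*l+j))" for y
  have split: "(\<Sum>y<b*l. g (y div l) * f y) = (\<Sum>y<b. g y * F y)" for g
  proof -
    have "(\<Sum>y<b*l. g (y div l) * f y) = (\<Sum>y<b*l. g (y div l) * f (y div l * l + y mod l))" by simp
    also have "\<dots> = (\<Sum>y<b. \<Sum>j<l. g y * f (y*l+j))" by (rule sum_divmod[OF kl(2), of "\<lambda>y j. g y * f (y*l+j)"])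
    finally show ?thesis unfolding F_def by (simp only: sum_distrib_left)
  qed
  have F0: "(\<Sum>y<b. F y) = 0" using split[of "\<lambda>_. 1"] f0 by simp
  have "(\<Sum>y<b. (F y)^2) \<le> (\<Sum>y<b. real l * (\<Sum>j<l. (f (y*l+j))^2))"
  proof (rule sum_mono)
    fix y show "(F y)^2 \<le> real l * (\<Sum>j<l. (f (y*l+j))^2)"
      unfolding F_def using Cauchy_Schwarz_ineq_sum[of "\<lambda>_. 1" "\<lambda>j. f (y*l+j)" "{..<l}"] by simp
  qed
  also have "\<dots> = real l * (\<Sum>y<b*l. (f (y div l * l + y mod l))^2)"
    unfolding sum_distrib_left[symmetric] by (simp only: sum_divmod[OF kl(2), of "\<lambda>y j. (f (y*l+j))^2"])
  finally have F2: "(\<Sum>y<b. (F y)^2) \<le> real l * (\<Sum>y<b*l. (f y)^2)" by simp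
  have "(\<Sum>x<a*k. (\<Sum>y<b*l. of_bool (D (x div k) (y div l)) * f y)^2) = (\<Sum>x<a*k. (\<Sum>y<b. of_bool (D (x div k) y) * F y)^2)"
  proof -
    have "(\<Sum>y<b*l. of_bool (D x (y div l)) * f y) = (\<Sum>y<b. of_bool (D x y) * F y)" for x
      by (rule split)
    then show ?thesis by simp
  qed
  also have "\<dots> = (\<Sum>x<a. \<Sum>j<k. (\<Sum>y<b. of_bool (D x y) * F y)^2)"
    by (rule sum_divmod[OF kl(1), of "\<lambda>x j. (\<Sum>y<b. of_bool (D x y) * F y)^2"])
  also have "\<dots> = real k * (\<Sum>x<a. (\<Sum>y<b. of_bool (D x y) * F y)^2)" by (simp add: sum_distrib_left)
  also have "\<dots> \<le> real k * (\<kappa> * (\<Sum>y<b. (F y)^2))"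
    using sp F0 unfolding spectral_def by (intro mult_left_mono) auto
  also have "\<dots> \<le> real k * (\<kappa> * (real l * (\<Sum>y<b*l. (f y)^2)))"
    using F2 \<open>\<kappa> \<ge> 0\<close> by (intro mult_left_mono) auto
  finally show "(\<Sum>x<a*k. (\<Sum>y<b*l. of_bool (D (x div k) (y div l)) * f y)^2) \<le> real k * real l * \<kappa> * (\<Sum>y<b*l. (f y)^2)"
    by (simp add: mult_ac)
qed

text \<open>An expected neighbourhood meets S in at most D/32 vertices, so an overloaded vertex
  deviates by at least D/32. The second moment is at most 3/2^15 times D^2 |S|, which leaves at most
  3|S|/32, hence at most 3n/1024, overloaded vertices.\<close>

lemma spectral_overload:
  assumes sp: "spectral n n J (\<tau> * (real D)^2)" and \<tau>: "\<tau> \<le> 3 / 2^15" and D: "D > 0"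
    and deg: "\<And>u. u < n \<Longrightarrow> card {v. v < n \<and> J u v} = D" and S: "S \<subseteq> {..<n}" "32 * card S \<le> n"
  shows "256 * card {u. u < n \<and> D \<le> 16 * card {v\<in>S. J u v}} \<le> n"
proof (cases "n = 0")
  case False
  then have n: "real n > 0" by simp
  have finS: "finite S" using S(1) finite_subset by blast
  define \<eta> where "\<eta> = real (card S) / real n"
  have \<eta>: "\<eta> \<le> 1/32" "\<eta> \<ge> 0" unfolding \<eta>_def using S(2) n by (auto simp: divide_le_eq)
  define f where "f v = of_bool (v \<in> S) - \<eta>" for v
  have sumS: "(\<Sum>v<n. of_bool (v \<in> S)) = real (card S)"
  proof -
    have "{..<n} \<inter> S = S" using S(1) by auto
    then show ?thesis by simp
  qed
  have f0: "(\<Sum>v<n. f v) = 0" unfolding f_def sum_subtractf sumS \<eta>_def using n by simp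
  have "(\<Sum>v<n. (f v)^2) = (\<Sum>v<n. of_bool (v \<in> S) - 2 * \<eta> * of_bool (v \<in> S) + \<eta>^2)"
    unfolding f_def by (intro sum.cong refl) (auto simp: of_bool_def power2_eq_square algebra_simps)
  also have "\<dots> = real (card S) - 2 * \<eta> * real (card S) + real n * \<eta>^2"
    unfolding sum.distrib sum_subtractf sum_distrib_left[symmetric] sumS by simp
  also have "\<dots> = real (card S) - \<eta> * real (card S)"
    unfolding \<eta>_def using n by (simp add: power2_eq_square field_simps)
  also have "\<dots> \<le> real (card S)" using \<eta> by simp
  finally have f2: "(\<Sum>v<n. (f v)^2) \<le> real (card S)" .
  define Ov where "Ov = {u. u < n \<and> D \<le> 16 * card {v\<in>S. J u v}}"
  have finOv: "finite Ov" unfolding Ov_def by simp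
  have inner: "(\<Sum>v<n. of_bool (J u v) * f v) = real (card {v\<in>S. J u v}) - \<eta> * real D" if u: "u < n" for u
  proof -
    have "(\<Sum>v<n. of_bool (J u v) * f v) = (\<Sum>v<n. of_bool (v \<in> S \<and> J u v)) - \<eta> * (\<Sum>v<n. of_bool (J u v))"
      unfolding f_def sum_distrib_left sum_subtractf[symmetric] by (intro sum.cong refl) (simp add: of_bool_conj algebra_simps)
    also have "(\<Sum>v<n. of_bool (J u v)) = real D"
      using card_filter_sum[of "{..<n}" "\<lambda>v. J u v"] deg[OF u] by simp
    also have "(\<Sum>v<n. of_bool (v \<in> S \<and> J u v)) = real (card {v\<in>{..<n}. v \<in> S \<and> J u v})"
      by (rule card_filter_sum[symmetric]) simp
    also have "{v\<in>{..<n}. v \<in> S \<and> J u v} = {v\<in>S. J u v}" using S(1) by auto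
    finally show ?thesis .
  qed
  have "real (card Ov) * (real D / 32)^2 = (\<Sum>u\<in>Ov. (real D / 32)^2)" by simp
  also have "\<dots> \<le> (\<Sum>u\<in>Ov. (\<Sum>v<n. of_bool (J u v) * f v)^2)"
  proof (intro sum_mono power_mono)
    fix u assume "u \<in> Ov"
    then have u: "u < n" and o: "D \<le> 16 * card {v\<in>S. J u v}" unfolding Ov_def by auto
    have "\<eta> * real D \<le> 1/32 * real D" using \<eta> by (intro mult_right_mono) auto
    then show "real D / 32 \<le> (\<Sum>v<n. of_bool (J u v) * f v)" unfolding inner[OF u] using o by linarith
  qed simp
  also have "\<dots> \<le> (\<Sum>u<n. (\<Sum>v<n. of_bool (J u v) * f v)^2)"
    by (rule sum_mono2) (auto simp: Ov_def)
  also have "\<dots> \<le> \<tau> * (real D)^2 * (\<Sum>v<n. (f v)^2)" using sp f0 unfolding spectral_def by blast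
  also have "\<dots> \<le> 3 / 2^15 * (real D)^2 * real (card S)"
    using f2 \<tau> by (intro mult_mono mult_right_mono) (auto intro: sum_nonneg)
  finally have "real (card Ov) * ((real D)^2 / 1024) \<le> (3 * 1024 / 2^15 * real (card S)) * ((real D)^2 / 1024)"
    by (simp add: power_divide mult_ac)
  then have "real (card Ov) \<le> 3 * 1024 / 2^15 * real (card S)"
    using D by (simp add: mult_le_cancel_right)
  then show ?thesis using S(2) unfolding Ov_def by simp
qed simp

section \<open>Cells of all levels on one vertex set\<close>

lemma prefix_lt:
  assumes "r \<le> S" "c < 2^(S+1)"
  shows "c div 2^(S-r) < (2::nat)^(r+1)"
proof (rule less_mult_imp_div_less)
  have "S + 1 = (r+1) + (S-r)" using assms(1) by simp
  then have "(2::nat)^(S+1) = 2^(r+1) * 2^(S-r)" by (metis power_add)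
  then show "c < 2^(r+1) * 2^(S-r)" using assms(2) by simp
qed

lemma lev_dvd: "lev t dvd lev (t + 2*k)"
proof (induction k)
  case (Suc k)
  have "lev (t + 2 * Suc k) = lev (t + 2*k) * nwords (t + 2*k)" using lev_Suc_Suc[of "t+2*k"] by simp
  then show ?case using Suc by simp
qed simp

lemma lev_dvd_parity:
  assumes "r \<le> t" "even (t - r)"
  shows "lev r dvd lev t"
proof -
  obtain k where "t - r = 2*k" using assms(2) by (elim evenE)
  then have "t = r + 2*k" using assms(1) by simp
  then show ?thesis using lev_dvd[of r k] by simp
qed

locale blowup =
  fixes m S :: nat
  assumes m_pos: "m > 0" and S_even: "even S" and S_pos: "S \<ge> 2"
begin

text \<open>Levels divide each other only within a parity class, so one factor is taken from each
  class. The factor m makes n^2 / m an integer, the number of edges of each graph.\<close>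

definition n :: nat where "n = m * lev S * lev (Suc S)"

definition N :: "nat \<Rightarrow> nat" where "N r = n div lev r"

text \<open>Cells are intervals of length \<open>N r\<close>, nested within each parity class, so
  passing to an ancestor is integer division.\<close>

definition anc :: "nat \<Rightarrow> nat \<Rightarrow> nat" where "anc r v = v div N r"

lemma n_pos: "n > 0"
  unfolding n_def using m_pos by simp

lemma lev_dvd_n: "r \<le> Suc S \<Longrightarrow> lev r dvd n"
proof (cases "even r")
  case True
  assume "r \<le> Suc S"
  then have "r \<le> S" using True S_even by (metis even_Suc le_SucE)
  then have "lev r dvd lev S" using True S_even by (intro lev_dvd_parity) auto
  then show ?thesis unfolding n_def by auto
next
  case False
  assume "r \<le> Suc S"
  then have "lev r dvd lev (Suc S)" using False S_even by (intro lev_dvd_parity) auto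
  then show ?thesis unfolding n_def by auto
qed

lemma n_eq: "r \<le> Suc S \<Longrightarrow> n = lev r * N r"
  unfolding N_def using lev_dvd_n by simp

lemma N_pos: "r \<le> Suc S \<Longrightarrow> N r > 0"
  using n_eq[of r] n_pos by (cases "N r = 0") auto

lemma N_parent: "Suc (Suc r) \<le> Suc S \<Longrightarrow> N r = N (Suc (Suc r)) * nwords r"
proof -
  assume r: "Suc (Suc r) \<le> Suc S"
  have "lev r * N r = n" using n_eq[of r] r by simp
  also have "n = lev (Suc (Suc r)) * N (Suc (Suc r))" by (rule n_eq[OF r])
  also have "\<dots> = lev r * (N (Suc (Suc r)) * nwords r)" unfolding lev_Suc_Suc by (simp only: mult_ac)
  finally have "lev r * N r = lev r * (N (Suc (Suc r)) * nwords r)" .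
  then show ?thesis using nat_mult_eq_cancel1[OF lev_pos] by blast
qed

lemma anc_parent: "Suc (Suc r) \<le> Suc S \<Longrightarrow> anc r v = anc (Suc (Suc r)) v div nwords r"
  unfolding anc_def by (subst N_parent) (simp_all add: div_mult2_eq)

lemma anc_lt: "r \<le> Suc S \<Longrightarrow> v < n \<Longrightarrow> anc r v < lev r"
  unfolding anc_def by (rule less_mult_imp_div_less) (use n_eq[of r] in linarith)

lemma anc_ancestor: "r + 2*k \<le> Suc S \<Longrightarrow> \<exists>d. \<forall>v. anc r v = anc (r + 2*k) v div d"
proof (induction k)
  case 0 show ?case by (intro exI[of _ 1]) simp
next
  case (Suc k)
  then obtain d where d: "\<forall>v. anc r v = anc (r + 2*k) v div d" by auto
  have "anc (r + 2*k) v = anc (r + 2 * Suc k) v div nwords (r + 2*k)" for v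
    using anc_parent[of "r + 2*k" v] Suc.prems by simp
  then have "\<forall>v. anc r v = anc (r + 2 * Suc k) v div (nwords (r + 2*k) * d)"
    using d by (simp add: div_mult2_eq)
  then show ?case by blast
qed

lemma card_cl: "r \<le> Suc S \<Longrightarrow> card {v. v < n \<and> Q (anc r v)} = N r * card {y. y < lev r \<and> Q y}"
proof -
  assume r: "r \<le> Suc S"
  have "card {v. v < n \<and> Q (anc r v)} = card {v. v < lev r * N r \<and> Q (v div N r)}"
    unfolding anc_def using n_eq[OF r] by simp
  also have "\<dots> = (\<Sum>x<lev r. card {j. j < N r \<and> Q x})" by (rule card_divmod[OF N_pos[OF r]])
  also have "\<dots> = (\<Sum>x<lev r. N r * of_bool (Q x))" by (rule sum.cong) auto
  finally show ?thesis unfolding card_eq_sum_of_bool by (simp only: sum_distrib_left)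
qed

text \<open>Here a lives on the side of the even levels and b on the side of the odd ones; the
  parity of t decides which of them belongs to the lower level.\<close>

definition pcol :: "nat \<Rightarrow> nat \<Rightarrow> nat \<Rightarrow> nat" where
  "pcol t a b = (if even t then col t (anc t a) (anc (Suc t) b) else col t (anc t b) (anc (Suc t) a))"

lemma pcol_Suc_div_2: "Suc t \<le> S \<Longrightarrow> pcol (Suc t) a b div 2 = pcol t a b"
  unfolding pcol_def using anc_parent[of t] by (simp add: col_Suc_div_2)

lemma pcol_prefix: "r + k \<le> S \<Longrightarrow> pcol (r + k) a b div 2^k = pcol r a b"
proof (induction k)
  case (Suc k)
  have "pcol (r + Suc k) a b div 2^Suc k = pcol (Suc (r+k)) a b div 2 div 2^k" by (simp add: div_mult2_eq)
  then show ?case using Suc pcol_Suc_div_2[of "r+k"] by simp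
qed simp

section \<open>Equidistribution of the finest colours\<close>

lemma backward_chain_step:
  assumes t: "Suc (Suc t) \<le> S" and z: "z < n"
  shows "4 * card {v. v < n \<and> col (Suc (Suc t)) (anc (Suc (Suc t)) v) (anc (Suc (Suc (Suc t))) z) = c \<and> Q (anc t v)}
    = card {v. v < n \<and> col t (anc t v) (anc (Suc t) z) = c div 4 \<and> Q (anc t v)}"
proof -
  let ?Z = "anc (Suc (Suc (Suc t))) z"
  have Z: "?Z < lev (Suc (Suc (Suc t)))" using t z by (intro anc_lt) auto
  have "4 * card {v. v < n \<and> col (Suc (Suc t)) (anc (Suc (Suc t)) v) ?Z = c \<and> Q (anc t v)}
    = 4 * card {v. v < n \<and> (\<lambda>y. col (Suc (Suc t)) y ?Z = c \<and> Q (y div nwords t)) (anc (Suc (Suc t)) v)}"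
    using t by (simp add: anc_parent[of t])
  also have "\<dots> = N (Suc (Suc t)) * (4 * card {y. y < lev (Suc (Suc t)) \<and> col (Suc (Suc t)) y ?Z = c \<and> Q (y div nwords t)})"
    using t by (subst card_cl) auto
  also have "\<dots> = N t * card {p. p < lev t \<and> col t p (?Z div nwords (Suc t)) = c div 4 \<and> Q p}"
    unfolding backward_lift[OF Z] using N_parent[of t] t by simp
  also have "\<dots> = card {v. v < n \<and> (\<lambda>p. col t p (?Z div nwords (Suc t)) = c div 4 \<and> Q p) (anc t v)}"
    using t by (subst card_cl) auto
  also have "?Z div nwords (Suc t) = anc (Suc t) z" using anc_parent[of "Suc t"] t by simp
  finally show ?thesis .
qed

lemma backward_chain:
  assumes "r + 2*k \<le> S" and z: "z < n"
  shows "4^k * card {v. v < n \<and> col (r+2*k) (anc (r+2*k) v) (anc (Suc (r+2*k)) z) = c \<and> Q (anc r v)}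
    = card {v. v < n \<and> col r (anc r v) (anc (Suc r) z) = c div 4^k \<and> Q (anc r v)}"
  using assms(1)
proof (induction k arbitrary: c)
  case (Suc k)
  let ?t = "r + 2*k"
  obtain d where d: "\<forall>v. anc r v = anc ?t v div d" using anc_ancestor[of r k] Suc.prems by auto
  have "4^Suc k * card {v. v < n \<and> col (r+2*Suc k) (anc (r+2*Suc k) v) (anc (Suc (r+2*Suc k)) z) = c \<and> Q (anc r v)}
    = 4^k * (4 * card {v. v < n \<and> col (Suc (Suc ?t)) (anc (Suc (Suc ?t)) v) (anc (Suc (Suc (Suc ?t))) z) = c \<and> (\<lambda>y. Q (y div d)) (anc ?t v)})"
    using d by simp
  also have "\<dots> = 4^k * card {v. v < n \<and> col ?t (anc ?t v) (anc (Suc ?t) z) = c div 4 \<and> (\<lambda>y. Q (y div d)) (anc ?t v)}"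
    using Suc.prems by (subst backward_chain_step[OF _ z]) auto
  also have "\<dots> = 4^k * card {v. v < n \<and> col ?t (anc ?t v) (anc (Suc ?t) z) = c div 4 \<and> Q (anc r v)}"
    using d by simp
  also have "\<dots> = card {v. v < n \<and> col r (anc r v) (anc (Suc r) z) = c div 4 div 4^k \<and> Q (anc r v)}"
    using Suc.prems by (intro Suc.IH) simp
  also have "c div 4 div 4^k = c div 4^Suc k" by (simp add: div_mult2_eq)
  finally show ?case .
qed simp

lemma forward_chain_step:
  assumes t: "Suc t \<le> S" and z: "z < n"
  shows "2 * card {v. v < n \<and> col (Suc t) (anc (Suc t) z) (anc (Suc (Suc t)) v) = c \<and> Q (anc t v)}
    = card {v. v < n \<and> col t (anc t v) (anc (Suc t) z) = c div 2 \<and> Q (anc t v)}"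
proof -
  let ?y = "anc (Suc t) z"
  have y: "?y < lev (Suc t)" using t z by (intro anc_lt) auto
  have "2 * card {v. v < n \<and> col (Suc t) ?y (anc (Suc (Suc t)) v) = c \<and> Q (anc t v)}
    = 2 * card {v. v < n \<and> (\<lambda>w. col (Suc t) ?y w = c \<and> Q (w div nwords t)) (anc (Suc (Suc t)) v)}"
    using t by (simp add: anc_parent[of t])
  also have "\<dots> = N (Suc (Suc t)) * (2 * card {w. w < lev (Suc (Suc t)) \<and> col (Suc t) ?y w = c \<and> Q (w div nwords t)})"
    using t by (subst card_cl) auto
  also have "\<dots> = N t * card {p. p < lev t \<and> col t p ?y = c div 2 \<and> Q p}"
    unfolding forward_lift[OF regular_level y] using N_parent[of t] t by simp
  also have "\<dots> = card {v. v < n \<and> (\<lambda>p. col t p ?y = c div 2 \<and> Q p) (anc t v)}"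
    using t by (subst card_cl) auto
  finally show ?thesis .
qed

text \<open>The finest colour with its arguments arranged so that v is always on the side of level r
  and u on that of level r+1.\<close>

definition scol :: "nat \<Rightarrow> nat \<Rightarrow> nat \<Rightarrow> nat" where
  "scol r u v = (if even r then pcol S v u else pcol S u v)"

text \<open>For even r the chain descends from S to r two levels at a time, with a factor 4 each.
  For odd r the vertex v lies at level S+1, and one forward step with a factor 2 brings it to the
  odd level S-1 before the same chain applies.\<close>

lemma scol_uniform:
  assumes r: "r \<le> S" and z: "z < n"
  shows "2^(S-r) * card {v. v < n \<and> scol r z v = c \<and> Q (anc r v)}
    = card {v. v < n \<and> col r (anc r v) (anc (Suc r) z) = c div 2^(S-r) \<and> Q (anc r v)}"
proof (cases "even r")
  case True
  then obtain k where k: "S - r = 2*k" using S_even by (metis dvd_diff_nat evenE)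
  then have S: "S = r + 2*k" using r by simp
  have p: "(4::nat)^k = 2^(S-r)" unfolding k power_mult by simp
  show ?thesis using backward_chain[of r k z c Q] z True S_even unfolding p S[symmetric] scol_def pcol_def by simp
next
  case False
  obtain t where t: "S = Suc t" using S_pos by (cases S) auto
  have rt: "r \<le> t" using r False S_even t by (metis le_SucE)
  have "even (t - r)" using False S_even t rt by simp
  then obtain k where k: "t - r = 2*k" by (elim evenE)
  then have tk: "t = r + 2*k" using rt by simp
  obtain d where d: "\<forall>v. anc r v = anc t v div d" using anc_ancestor[of r k] tk t by auto
  have p: "2^(S-r) = 4^k * (2::nat)" using t rt k by (simp add: Suc_diff_le power_mult)
  have labS: "scol r z v = col S (anc S z) (anc (Suc S) v)" for v using False S_even by (simp add: scol_def pcol_def)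
  note step = forward_chain_step[of t z c "\<lambda>y. Q (y div d)", OF _ z, unfolded t[symmetric]]
  note chain = backward_chain[of r k z "c div 2" Q, unfolded tk[symmetric] t[symmetric]]
  have "2^(S-r) * card {v. v < n \<and> scol r z v = c \<and> Q (anc r v)}
     = 4^k * (2 * card {v. v < n \<and> col S (anc S z) (anc (Suc S) v) = c \<and> Q (anc t v div d)})"
    unfolding p labS d[rule_format] by (rule mult.assoc)
  also have "\<dots> = 4^k * card {v. v < n \<and> col t (anc t v) (anc S z) = c div 2 \<and> Q (anc r v)}"
    unfolding step[OF order.refl] d[rule_format] ..
  also have "\<dots> = card {v. v < n \<and> col r (anc r v) (anc (Suc r) z) = c div 2 div 4^k \<and> Q (anc r v)}"
    by (rule chain[OF _ z]) (simp add: t)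
  also have "c div 2 div 4^k = c div 2^(S-r)" unfolding p by (simp add: div_mult2_eq mult.commute)
  finally show ?thesis .
qed

lemma cell_degree:
  assumes r: "r \<le> S" and z: "z < n" and c: "c < 2^(r+1)"
  shows "card {v. v < n \<and> col r (anc r v) (anc (Suc r) z) = c} = N r * col_deg r"
proof -
  have "card {v. v < n \<and> col r (anc r v) (anc (Suc r) z) = c} = N r * card {y. y < lev r \<and> col r y (anc (Suc r) z) = c}"
    using r by (intro card_cl) simp
  also have "card {y. y < lev r \<and> col r y (anc (Suc r) z) = c} = col_deg r"
    using r z c by (intro card_bwd anc_lt) auto
  finally show ?thesis .
qed

lemma separated_cells:
  assumes r: "1 \<le> r" "r \<le> S" and z: "z < n" "z' < n" and ne: "anc (Suc r) z \<noteq> anc (Suc r) z'" and c: "c < 2^(r+1)"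
  shows "card {v. v < n \<and> col r (anc r v) (anc (Suc r) z) = c} \<le>
    8 * card {v. v < n \<and> col r (anc r v) (anc (Suc r) z) = c \<and> col r (anc r v) (anc (Suc r) z') \<noteq> c}"
proof -
  obtain t where t: "r = Suc t" using r(1) by (cases r) auto
  have "anc (Suc r) z < lev (Suc r)" "anc (Suc r) z' < lev (Suc r)" using r z by (auto intro: anc_lt)
  then have sep: "col_deg r \<le> 8 * card {p. p < lev r \<and> col r p (anc (Suc r) z) = c \<and> col r p (anc (Suc r) z') \<noteq> c}"
    using separated[of t] ne c unfolding separated_def t by blast
  have "N r * col_deg r \<le> 8 * (N r * card {p. p < lev r \<and> col r p (anc (Suc r) z) = c \<and> col r p (anc (Suc r) z') \<noteq> c})"
    using mult_le_mono2[OF sep, of "N r"] unfolding mult.left_commute[of "N r" 8] .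
  also have "N r * card {p. p < lev r \<and> col r p (anc (Suc r) z) = c \<and> col r p (anc (Suc r) z') \<noteq> c}
    = card {v. v < n \<and> col r (anc r v) (anc (Suc r) z) = c \<and> col r (anc r v) (anc (Suc r) z') \<noteq> c}"
    using r by (subst card_cl) auto
  finally show ?thesis using cell_degree[OF r(2) z(1) c] by simp
qed

text \<open>Equidistribution, applied once without a filter and once with the filter that z' sees
  the wrong colour, carries the fraction 1/8 from level r to the finest colour c.\<close>

lemma distinguish:
  assumes r: "1 \<le> r" "r \<le> S" and z: "z < n" "z' < n" and ne: "anc (Suc r) z \<noteq> anc (Suc r) z'" and c: "c < 2^(S+1)"
  shows "card {v. v < n \<and> scol r z v = c} \<le> 8 * card {v. v < n \<and> scol r z v = c \<and> col r (anc r v) (anc (Suc r) z') \<noteq> c div 2^(S-r)}"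
proof -
  have c': "c div 2^(S-r) < 2^(r+1)" by (rule prefix_lt[OF r(2) c])
  have "2^(S-r) * card {v. v < n \<and> scol r z v = c} \<le> 2^(S-r) *
      (8 * card {v. v < n \<and> scol r z v = c \<and> col r (anc r v) (anc (Suc r) z') \<noteq> c div 2^(S-r)})"
    using separated_cells[OF r z ne c'] scol_uniform[OF r(2) z(1), of c "\<lambda>_. True"]
      scol_uniform[OF r(2) z(1), of c "\<lambda>y. col r y (anc (Suc r) z') \<noteq> c div 2^(S-r)"] by simp
  then show ?thesis by simp
qed

end

section \<open>The bipartite graph of a set of finest colours\<close>

lemma card_pairs_of_family:
  fixes F :: "nat set set"
  assumes "finite F"
  shows "finite {(u,v). {u,v} \<in> F}" and "card {(u,v). {u,v} \<in> F} \<le> 2 * card F"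
proof -
  have one: "finite {(u,v). {u,v} = e} \<and> card {(u,v). {u,v} = e} \<le> 2" for e :: "nat set"
  proof (cases "\<exists>a b. e = {a,b}")
    case True
    then obtain a b where e: "e = {a,b}" by auto
    have sub: "{(u,v). {u,v} = e} \<subseteq> {(a,b),(b,a)}" unfolding e by (auto simp: doubleton_eq_iff)
    then have "card {(u,v). {u,v} = e} \<le> card {(a,b),(b,a)}" by (intro card_mono) auto
    also have "\<dots> \<le> 2" using card_length[of "[(a,b),(b,a)]"] by simp
    finally show ?thesis using finite_subset[OF sub] by simp
  next
    case False
    then have "{(u,v). {u,v} = e} = {}" by auto
    then show ?thesis by (simp only:) simp
  qed
  have eq: "{(u,v). {u,v} \<in> F} = (\<Union>e\<in>F. {(u,v). {u,v} = e})" by auto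
  show "finite {(u,v). {u,v} \<in> F}" unfolding eq using assms one by blast
  have "card {(u,v). {u,v} \<in> F} \<le> (\<Sum>e\<in>F. card {(u,v). {u,v} = e})" unfolding eq by (rule card_UN_le[OF assms])
  also have "\<dots> \<le> (\<Sum>e\<in>F. 2)" using one by (intro sum_mono) blast
  finally show "card {(u,v). {u,v} \<in> F} \<le> 2 * card F" by simp
qed

context blowup
begin

definition side :: "nat \<Rightarrow> nat set" where
  "side r = (if even r then {..<n} else {n..<2*n})"

definition cell :: "nat \<Rightarrow> nat \<Rightarrow> nat" where "cell r v = anc r (v mod n)"

definition joined :: "nat set \<Rightarrow> nat \<Rightarrow> nat \<Rightarrow> bool" where
  "joined C u v \<longleftrightarrow> (u < n \<and> n \<le> v \<and> v < 2*n \<and> pcol S u (v-n) \<in> C) \<or>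
    (v < n \<and> n \<le> u \<and> u < 2*n \<and> pcol S v (u-n) \<in> C)"

definition edges :: "nat set \<Rightarrow> nat set set" where
  "edges C = {{u, v} |u v. joined C u v}"

lemma joined_commute: "joined C u v = joined C v u"
  unfolding joined_def by auto

lemma edges_iff: "{u, v} \<in> edges C \<longleftrightarrow> joined C u v"
proof -
  have "joined C u v" if "{u,v} = {u',v'}" "joined C u' v'" for u' v'
    using that joined_commute[of C u v] by (auto simp: doubleton_eq_iff)
  then show ?thesis unfolding edges_def by blast
qed

lemma finite_edges: "finite (edges C)"
proof (rule finite_subset)
  show "edges C \<subseteq> Pow {..<2*n}" unfolding edges_def joined_def by auto
qed simp

lemma finite_side: "finite (side r)" and card_side: "card (side r) = n"
  unfolding side_def by auto

lemma mod_upper: "n \<le> x \<Longrightarrow> x < 2*n \<Longrightarrow> x mod n = x - n"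
  using le_mod_geq[of n x] by simp

lemma side_bij: "bij_betw (\<lambda>v. v mod n) (side r) {..<n}"
proof (cases "even r")
  case True
  then show ?thesis unfolding side_def by (auto simp: bij_betw_def inj_on_def)
next
  case False
  have "(\<lambda>v. v mod n) ` {n..<2*n} = {..<n}"
  proof
    show "(\<lambda>v. v mod n) ` {n..<2*n} \<subseteq> {..<n}" using n_pos by auto
    show "{..<n} \<subseteq> (\<lambda>v. v mod n) ` {n..<2*n}"
    proof
      fix x assume "x \<in> {..<n}"
      then have "x = (n + x) mod n" "n + x \<in> {n..<2*n}" by auto
      then show "x \<in> (\<lambda>v. v mod n) ` {n..<2*n}" by blast
    qed
  qed
  moreover have "inj_on (\<lambda>v. v mod n) {n..<2*n}"
  proof (rule inj_onI)
    fix x y assume "x \<in> {n..<2*n}" "y \<in> {n..<2*n}" "x mod n = y mod n"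
    then show "x = y" using mod_upper[of x] mod_upper[of y] by auto
  qed
  ultimately show ?thesis using False unfolding side_def bij_betw_def by simp
qed

lemma card_side_filter: "card {v\<in>side r. Q (v mod n)} = card {v. v < n \<and> Q v}"
proof -
  have "bij_betw (\<lambda>v. v mod n) {v\<in>side r. Q (v mod n)} {v\<in>{..<n}. Q v}"
    by (rule bij_betw_Collect[OF side_bij]) simp
  then have "card {v\<in>side r. Q (v mod n)} = card {v\<in>{..<n}. Q v}" by (rule bij_betw_same_card)
  also have "{v\<in>{..<n}. Q v} = {v. v < n \<and> Q v}" by auto
  finally show ?thesis .
qed

lemma joined_lab:
  assumes "u \<in> side (Suc r)" "v \<in> side r"
  shows "joined C u v \<longleftrightarrow> scol r (u mod n) (v mod n) \<in> C"
proof (cases "even r")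
  case True
  then have "n \<le> u" "u < 2*n" "v < n" using assms unfolding side_def by auto
  then show ?thesis using True mod_upper[of u] unfolding joined_def scol_def by simp
next
  case False
  then have "n \<le> v" "v < 2*n" "u < n" using assms unfolding side_def by auto
  then show ?thesis using False mod_upper[of v] unfolding joined_def scol_def by simp
qed

lemma joined_sides:
  assumes "joined C u v" "v \<in> side r"
  shows "u \<in> side (Suc r)"
  using assms unfolding joined_def side_def by (auto split: if_splits)

lemma scol_prefix:
  assumes "r \<le> S"
  shows "scol r u v div 2^(S-r) = col r (anc r v) (anc (Suc r) u)"
  using pcol_prefix[of r "S-r"] assms unfolding scol_def by (simp add: pcol_def)

lemma degree_eqs:
  shows "N (Suc S) * (2 * wlen S) = N S * col_deg S" and "N S * col_deg S * 2^(S+1) = n"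
proof -
  have "n = (col_deg S * 2^(S+1)) * N S" using n_eq[of S] unfolding lev_col_deg[of S, symmetric] by simp
  then have 1: "n = (N S * col_deg S) * 2^(S+1)" by (simp only: mult_ac)
  have "n = (N (Suc S) * (2 * wlen S)) * 2^(S+1)" using n_eq[of "Suc S"] lev_Suc[of S] by simp
  then show "N (Suc S) * (2 * wlen S) = N S * col_deg S" using 1 by (simp add: mult_ac)
  show "N S * col_deg S * 2^(S+1) = n" using 1 by (simp only:)
qed

lemma scol_degree_1:
  assumes z: "z < n" and c: "c < 2^(S+1)"
  shows "card {v. v < n \<and> scol r z v = c} = N S * col_deg S"
proof (cases "even r")
  case True
  then show ?thesis using cell_degree[OF order.refl z c] S_even unfolding scol_def by (simp add: pcol_def)
next
  case False
  have "card {v. v < n \<and> scol r z v = c} = card {v. v < n \<and> col S (anc S z) (anc (Suc S) v) = c}"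
    using False S_even unfolding scol_def by (simp add: pcol_def)
  also have "\<dots> = N (Suc S) * card {y. y < lev (Suc S) \<and> col S (anc S z) y = c}" by (rule card_cl) simp
  also have "card {y. y < lev (Suc S) \<and> col S (anc S z) y = c} = 2 * wlen S"
    using card_fwd[OF anc_lt[OF _ z] c] unfolding fwd_def by simp
  finally show ?thesis using degree_eqs(1) by simp
qed

lemma card_filter_colours:
  assumes "finite C"
  shows "card {v::nat. v < k \<and> f v \<in> C \<and> Q v} = (\<Sum>c\<in>C. card {v. v < k \<and> f v = c \<and> Q v})"
proof -
  have "{v. v < k \<and> f v \<in> C \<and> Q v} = (\<Union>c\<in>C. {v. v < k \<and> f v = c \<and> Q v})" by auto
  then show ?thesis using assms by (simp only:) (rule card_UN_disjoint, auto)
qed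

definition deg :: "nat set \<Rightarrow> nat" where "deg C = card C * (N S * col_deg S)"

lemma deg_eq: "deg C * 2^(S+1) = card C * n"
  unfolding deg_def by (simp only: mult.assoc[of "card C"] degree_eqs(2))

lemma scol_degree:
  assumes C: "C \<subseteq> {..<2^(S+1)}" and z: "z < n"
  shows "card {v. v < n \<and> scol r z v \<in> C} = deg C"
proof -
  have finC: "finite C" using C finite_subset by blast
  have "card {v. v < n \<and> scol r z v \<in> C} = (\<Sum>c\<in>C. card {v. v < n \<and> scol r z v = c})"
    using card_filter_colours[OF finC, of n "scol r z" "\<lambda>_. True"] by simp
  also have "\<dots> = (\<Sum>c\<in>C. N S * col_deg S)" using C by (intro sum.cong scol_degree_1[OF z]) auto
  finally show ?thesis unfolding deg_def by simp
qed

lemma spectral_lab: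
  assumes C: "C \<subseteq> {..<2^(S+1)}"
  shows "spectral n n (\<lambda>u v. scol r u v \<in> C) (spec_gap S * (real (deg C))^2)"
proof -
  have finC: "finite C" using C finite_subset by blast
  define \<kappa> where "\<kappa> = real (N S) * real (N (Suc S)) * spec_bound S"
  have "spectral (lev S * N S) (lev (Suc S) * N (Suc S)) (\<lambda>x y. col S (x div N S) (y div N (Suc S)) = c) \<kappa>" if "c \<in> C" for c
    unfolding \<kappa>_def using that C by (intro spectral_blowup spectral_col N_pos spec_bound_nonneg) auto
  then have "spectral n n (\<lambda>a b. pcol S a b = c) \<kappa>" if "c \<in> C" for c
    using that S_even n_eq[of S] n_eq[of "Suc S"] by (simp add: pcol_def anc_def)
  then have "spectral n n (\<lambda>a b. pcol S a b \<in> C) (real (card C)^2 * \<kappa>)"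
    using finC by (intro spectral_union)
  also have "real (card C)^2 * \<kappa> = spec_gap S * (real (deg C))^2"
  proof -
    have "real (N (Suc S)) * (2 * real (wlen S)) = real (N S) * real (col_deg S)"
      using degree_eqs(1) by (metis of_nat_mult of_nat_numeral)
    then have "\<kappa> = spec_gap S * (real (N S) * real (col_deg S)) * (real (N S) * real (col_deg S))"
      unfolding \<kappa>_def spec_bound_def by (simp add: mult_ac)
    then show ?thesis unfolding deg_def by (simp add: power2_eq_square)
  qed
  finally have sp: "spectral n n (\<lambda>a b. pcol S a b \<in> C) (spec_gap S * (real (deg C))^2)" .
  show ?thesis
  proof (cases "even r")
    case True
    have "spectral n n (\<lambda>y x. pcol S x y \<in> C) (spec_gap S * (real (deg C))^2)"
      by (rule spectral_transpose[OF sp, of "deg C"]) (use scol_degree[OF C, of _ 1] spec_gap_nonneg in \<open>auto simp: scol_def\<close>)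
    then show ?thesis using True unfolding scol_def by simp
  next
    case False then show ?thesis using sp unfolding scol_def by simp
  qed
qed

lemma deg_pos: "C \<noteq> {} \<Longrightarrow> finite C \<Longrightarrow> deg C > 0"
  using deg_eq[of C] n_pos by (metis card_gt_0_iff mult_is_0 gr0I not_gr_zero)

lemma side_overload:
  assumes C: "C \<subseteq> {..<2^(S+1)}" "C \<noteq> {}" and T: "T \<subseteq> side r" "32 * card T \<le> n"
  shows "256 * card {u\<in>side (Suc r). deg C \<le> 16 * card {v\<in>T. joined C u v}} \<le> n"
proof -
  have finC: "finite C" using C finite_subset by blast
  define T' where "T' = (\<lambda>v. v mod n) ` T"
  have inj: "inj_on (\<lambda>v. v mod n) T" using side_bij[of r] T(1) unfolding bij_betw_def by (blast intro: inj_on_subset)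
  have T': "T' \<subseteq> {..<n}" "32 * card T' \<le> n"
    using T(2) card_image[OF inj] n_pos unfolding T'_def by auto
  have eq: "card {v\<in>T. scol r x (v mod n) \<in> C} = card {v\<in>T'. scol r x v \<in> C}" for x
  proof -
    have "bij_betw (\<lambda>v. v mod n) T T'" unfolding T'_def bij_betw_def using inj by simp
    then have "bij_betw (\<lambda>v. v mod n) {v\<in>T. scol r x (v mod n) \<in> C} {v\<in>T'. scol r x v \<in> C}"
      by (rule bij_betw_Collect) simp
    then show ?thesis by (rule bij_betw_same_card)
  qed
  have "{u\<in>side (Suc r). deg C \<le> 16 * card {v\<in>T. joined C u v}} = {u\<in>side (Suc r). deg C \<le> 16 * card {v\<in>T'. scol r (u mod n) v \<in> C}}"
  proof (rule Collect_cong, rule conj_cong[OF refl])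
    fix u assume "u \<in> side (Suc r)"
    then have "{v\<in>T. joined C u v} = {v\<in>T. scol r (u mod n) (v mod n) \<in> C}"
      using T(1) joined_lab by blast
    then show "deg C \<le> 16 * card {v\<in>T. joined C u v} \<longleftrightarrow> deg C \<le> 16 * card {v\<in>T'. scol r (u mod n) v \<in> C}"
      using eq by simp
  qed
  then have "card {u\<in>side (Suc r). deg C \<le> 16 * card {v\<in>T. joined C u v}}
    = card {u. u < n \<and> deg C \<le> 16 * card {v\<in>T'. scol r u v \<in> C}}"
    using card_side_filter[of "Suc r" "\<lambda>x. deg C \<le> 16 * card {v\<in>T'. scol r x v \<in> C}"] by simp
  then show ?thesis
    using spectral_overload[OF spectral_lab[OF C(1)] spec_gap_le deg_pos[OF C(2) finC] scol_degree[OF C(1)] T'] by simp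
qed

lemma side_distinguish:
  assumes C: "C \<subseteq> {..<2^(S+1)}" and r: "1 \<le> r" "r \<le> S" and pf: "\<And>c. c \<in> C \<Longrightarrow> c div 2^(S-r) = q"
    and x: "x \<in> side (Suc r)" and x': "x' \<notin> side (Suc r) \<or> cell (Suc r) x' \<noteq> cell (Suc r) x"
  shows "deg C \<le> 8 * card {v\<in>side r. joined C x v \<and> \<not> (x' \<in> side (Suc r) \<and> col r (cell r v) (cell (Suc r) x') = q)}"
proof -
  have finC: "finite C" using C finite_subset by blast
  have xn: "x mod n < n" "x' mod n < n" using n_pos by auto
  have eq: "card {v\<in>side r. joined C x v \<and> Q (v mod n)} = card {v. v < n \<and> scol r (x mod n) v \<in> C \<and> Q v}" for Q
  proof -
    have "{v\<in>side r. joined C x v \<and> Q (v mod n)} = {v\<in>side r. scol r (x mod n) (v mod n) \<in> C \<and> Q (v mod n)}"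
      using joined_lab[OF x] by blast
    then show ?thesis using card_side_filter[of r "\<lambda>v. scol r (x mod n) v \<in> C \<and> Q v"] by simp
  qed
  show ?thesis
  proof (cases "x' \<in> side (Suc r)")
    \<comment> \<open>A vertex on the wrong side satisfies the coarse relation with nothing, so all
      neighbours of x count.\<close>
    case False
    then have "card {v\<in>side r. joined C x v \<and> \<not> (x' \<in> side (Suc r) \<and> col r (cell r v) (cell (Suc r) x') = q)} = deg C"
      using eq[of "\<lambda>_. True"] scol_degree[OF C xn(1)] by simp
    then show ?thesis by simp
  next
    case True
    then have ne: "anc (Suc r) (x mod n) \<noteq> anc (Suc r) (x' mod n)" using x' unfolding cell_def by auto
    let ?Q = "\<lambda>v. col r (anc r v) (anc (Suc r) (x' mod n)) \<noteq> q"
    have "deg C = (\<Sum>c\<in>C. card {v. v < n \<and> scol r (x mod n) v = c})"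
      using scol_degree[OF C xn(1)] card_filter_colours[OF finC, of n "scol r (x mod n)" "\<lambda>_. True"] by simp
    also have "\<dots> \<le> (\<Sum>c\<in>C. 8 * card {v. v < n \<and> scol r (x mod n) v = c \<and> ?Q v})"
    proof (rule sum_mono)
      fix c assume c: "c \<in> C"
      then show "card {v. v < n \<and> scol r (x mod n) v = c} \<le> 8 * card {v. v < n \<and> scol r (x mod n) v = c \<and> ?Q v}"
        using distinguish[OF r xn ne, of c] C pf[OF c] by auto
    qed
    also have "\<dots> = 8 * card {v. v < n \<and> scol r (x mod n) v \<in> C \<and> ?Q v}"
      unfolding sum_distrib_left[symmetric] card_filter_colours[OF finC] ..
    also have "\<dots> = 8 * card {v\<in>side r. joined C x v \<and> ?Q (v mod n)}" by (simp only: eq[of ?Q])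
    also have "{v\<in>side r. joined C x v \<and> ?Q (v mod n)} = {v\<in>side r. joined C x v \<and> \<not> (x' \<in> side (Suc r) \<and> col r (cell r v) (cell (Suc r) x') = q)}"
      using True unfolding cell_def by simp
    finally show ?thesis .
  qed
qed

text \<open>An edge of E may lie inside \<open>side r\<close> and then appears as two ordered pairs,
  hence the factor 2; a missing edge of the graph joins the two sides and appears once.\<close>

lemma side_difference:
  assumes E: "finite E"
  shows "card {(u,v). u \<in> V \<and> v \<in> side r \<and> {u,v} \<in> E \<and> \<not> joined C u v}
    + card {(u,v). u \<in> side (Suc r) \<and> v \<in> side r \<and> joined C u v \<and> {u,v} \<notin> E} \<le> 2 * card (sym_diff E (edges C))"
proof -
  have fin: "finite (E - edges C)" "finite (edges C - E)" using E finite_edges by auto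
  have "card {(u,v). u \<in> V \<and> v \<in> side r \<and> {u,v} \<in> E \<and> \<not> joined C u v} \<le> card {(u,v). {u,v} \<in> E - edges C}"
    by (rule card_mono[OF card_pairs_of_family(1)[OF fin(1)]]) (auto simp: edges_iff)
  also have "\<dots> \<le> 2 * card (E - edges C)" by (rule card_pairs_of_family(2)[OF fin(1)])
  finally have 1: "card {(u,v). u \<in> V \<and> v \<in> side r \<and> {u,v} \<in> E \<and> \<not> joined C u v} \<le> 2 * card (E - edges C)" .
  have disj: "side (Suc r) \<inter> side r = {}" unfolding side_def by auto
  have 2: "card {(u,v). u \<in> side (Suc r) \<and> v \<in> side r \<and> joined C u v \<and> {u,v} \<notin> E} \<le> card (edges C - E)"
  proof (rule card_inj_on_le[where f="\<lambda>(u,v). {u,v}"])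
    show "inj_on (\<lambda>(u,v). {u,v}) {(u,v). u \<in> side (Suc r) \<and> v \<in> side r \<and> joined C u v \<and> {u,v} \<notin> E}"
      using disj by (auto simp: inj_on_def doubleton_eq_iff)
  qed (use fin in \<open>auto simp: edges_iff\<close>)
  have "card (sym_diff E (edges C)) = card (E - edges C) + card (edges C - E)"
    by (rule card_Un_disjoint) (use fin in auto)
  then show ?thesis using 1 2 by simp
qed

text \<open>The coarse relation says that x is on the correct side and sees the cell of v in colour
  q, the common prefix of C. The badness is at most n/256 for overloaded vertices plus n/128 for
  wasted edges, below n/64.\<close>

lemma level_step:
  assumes C: "C \<subseteq> {..<2^(S+1)}" "C \<noteq> {}" and r: "1 \<le> r" "r \<le> S" and pf: "\<And>c. c \<in> C \<Longrightarrow> c div 2^(S-r) = q"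
    and P: "equipartition {..<2*n} P" "eps_regular_partition \<epsilon> E P" and eps: "0 < \<epsilon>" "\<epsilon> \<le> 1" and E: "finite E"
    and close: "2 * real (card (sym_diff E (edges C))) + 24 * \<epsilon> * (real n)^2 \<le> real (deg C) * real n / 2048"
    and ng: "32 * card (nongood P (side r) (cell r) \<epsilon>) \<le> n"
  shows "badness P (side (Suc r)) (cell (Suc r)) \<le> real n / 64"
proof -
  have finC: "finite C" using C finite_subset by blast
  have V: "{..<2*n} = side (Suc r) \<union> side r" "side (Suc r) \<inter> side r = {}" unfolding side_def by auto
  have "real (deg C) / 16 * (badness P (side (Suc r)) (cell (Suc r)) - real n / 256)
    \<le> 2 * real (card (sym_diff E (edges C))) + 24 * \<epsilon> * (real n)^2"
  proof (rule regularity_step[OF V finite_side finite_side card_side card_side P eps,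
      where J="joined C" and cY="cell r" and R="\<lambda>x y. x \<in> side (Suc r) \<and> col r y (cell (Suc r) x) = q"])
    fix x v assume xv: "v \<in> side r" "joined C x v"
    then have x: "x \<in> side (Suc r)" by (rule joined_sides[rotated])
    then have "scol r (x mod n) (v mod n) \<in> C" using joined_lab xv by blast
    then show "x \<in> side (Suc r) \<and> col r (cell r v) (cell (Suc r) x) = q"
      using x scol_prefix[OF r(2), of "x mod n" "v mod n"] pf unfolding cell_def by metis
  next
    fix T assume "T \<subseteq> side r" "32 * card T \<le> n"
    then show "256 * card {u\<in>side (Suc r). deg C \<le> 16 * card {v\<in>T. joined C u v}} \<le> n"
      by (rule side_overload[OF C])
  next
    fix x x' assume "x \<in> side (Suc r)" "x' \<notin> side (Suc r) \<or> cell (Suc r) x' \<noteq> cell (Suc r) x"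
    then show "deg C \<le> 8 * card {v\<in>side r. joined C x v \<and> \<not> (x' \<in> side (Suc r) \<and> col r (cell r v) (cell (Suc r) x') = q)}"
      by (intro side_distinguish[OF C(1) r] pf)
  next
    show "real (card {(u, v). u \<in> {..<2*n} \<and> v \<in> side r \<and> {u, v} \<in> E \<and> \<not> joined C u v})
      + real (card {(u, v). u \<in> side (Suc r) \<and> v \<in> side r \<and> joined C u v \<and> {u, v} \<notin> E})
      \<le> 2 * real (card (sym_diff E (edges C)))"
      using side_difference[OF E, of "{..<2*n}" r C] by linarith
  qed (rule ng)
  also have "\<dots> \<le> real (deg C) / 16 * (real n / 128)" using close by simp
  finally have "badness P (side (Suc r)) (cell (Suc r)) - real n / 256 \<le> real n / 128"
    using deg_pos[OF C(2) finC] by (simp add: mult_le_cancel_left)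
  then show ?thesis by simp
qed

text \<open>Since C lies inside one colour of level s, its prefix is unique at every level r up to
  s, which is what each step requires. The last badness bound n/64 is far below the n/2 that limits
  the size of the parts.\<close>

theorem many_parts:
  assumes C: "C \<subseteq> {..<2^(S+1)}" "C \<noteq> {}" and s: "2 \<le> s" "s \<le> S" and pf: "\<And>c. c \<in> C \<Longrightarrow> c div 2^(S-s) = q"
    and P: "equipartition {..<2*n} P" "eps_regular_partition \<epsilon> E P" and eps: "0 < \<epsilon>" "\<epsilon> \<le> 1 / 2^23" and E: "finite E"
    and close: "2 * real (card (sym_diff E (edges C))) + 24 * \<epsilon> * (real n)^2 \<le> real (deg C) * real n / 2048"
  shows "lev s \<le> 2 * card P"
proof -
  have eps': "\<epsilon> \<le> 1/2" "\<epsilon> \<le> 1" using eps(2) by simp_all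
  have V: "side r \<subseteq> {..<2*n}" for r unfolding side_def by auto
  have pf': "c div 2^(S-r) = q div 2^(s-r)" if "c \<in> C" "r \<le> s" for c r
  proof -
    have "S - r = (S - s) + (s - r)" using that s by simp
    then have "c div 2^(S-r) = c div 2^(S-s) div 2^(s-r)" by (metis div_mult2_eq power_add)
    then show ?thesis using pf[OF that(1)] by simp
  qed
  have bad: "badness P (side (Suc r)) (cell (Suc r)) \<le> real n / 64"
    if "32 * card (nongood P (side r) (cell r) \<epsilon>) \<le> n" "1 \<le> r" "r \<le> s" for r
    using that s by (intro level_step[OF C _ _ _ P eps(1) eps'(2) E close, where q="q div 2^(s-r)"] pf') auto
  have ng: "32 * card (nongood P (side r) (cell r) \<epsilon>) \<le> n" if "1 \<le> r" "r \<le> s" for r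
    using that
  proof (induction r rule: dec_induct)
    case base
    have "cell 1 ` side 1 \<subseteq> {..<lev 1}" using n_pos unfolding cell_def by (auto intro!: anc_lt)
    then have "card (cell 1 ` side 1) \<le> lev 1" by (metis card_lessThan card_mono finite_lessThan)
    then have "real (card (nongood P (side 1) (cell 1) \<epsilon>)) \<le> \<epsilon> * real (lev 1) * real (card {..<2*n})"
      using eps by (intro nongood_few_cells[OF P(1) _ V]) auto
    \<comment> \<open>Level 1 has 2^17 cells, so \<epsilon> up to 2^-23 leaves at most n/32 unusable
      vertices.\<close>
    also have "\<dots> = \<epsilon> * 2^17 * (2 * real n)"
      unfolding lev_def by (simp add: lev_exp.simps)
    also have "\<dots> \<le> 1 / 2^23 * 2^17 * (2 * real n)"
      using eps by (intro mult_right_mono) auto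
    finally show ?case by simp
  next
    case (step r)
    then have "real (card (nongood P (side (Suc r)) (cell (Suc r)) \<epsilon>)) \<le> 2 * (real n / 64)"
      using nongood_le_badness[OF P(1) _ V eps'(1), of "Suc r" "cell (Suc r)"] bad[of r] by simp
    then show ?case by simp
  qed
  obtain r where r: "s = Suc r" "1 \<le> r" using s by (cases s) auto
  have b: "badness P (side s) (cell s) \<le> real n / 64" using bad[OF ng] r by simp
  have "card {..<2*n} \<le> card P * (2 * N s + 1)"
  proof (rule card_parts_ge[OF P(1) _ V])
    show "side s \<noteq> {}" using card_side[of s] n_pos by auto
    show "2 * badness P (side s) (cell s) < real (card (side s))" using b n_pos unfolding card_side by simp
    fix y
    have "card {x\<in>side s. cell s x = y} = N s * card {y'. y' < lev s \<and> y' = y}"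
      unfolding cell_def using card_side_filter[of s "\<lambda>v. anc s v = y"] card_cl[of s "\<lambda>c. c = y"] s by simp
    also have "\<dots> \<le> N s * 1" by (intro mult_left_mono) (auto simp: card_le_Suc0_iff_eq)
    finally show "card {x\<in>side s. cell s x = y} \<le> N s" by simp
  qed simp
  then have "2 * (lev s * N s) \<le> card P * (2 * N s + 1)" using n_eq[of s] s by simp
  also have "\<dots> \<le> card P * (4 * N s)" using N_pos[of s] s by (intro mult_left_mono) auto
  finally have "(2 * lev s) * N s \<le> (4 * card P) * N s" by (simp only: mult_ac)
  then show ?thesis using N_pos[of s] s by simp
qed

end

section \<open>Witness families\<close>

text \<open>The slack t + 16 pays for the t + 4 subtracted in the exponent at the next step of the
  recursion.\<close>

lemma lev_exp_ge_twr: "twr t + t + 16 \<le> lev_exp (Suc t)"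
proof (induction t)
  case (Suc t)
  have tw: "t + 1 \<le> twr (Suc t)" for t
  proof (induction t)
    case (Suc t)
    have "Suc t + 1 \<le> 2^(t+1)" by (induction t) auto
    also have "\<dots> \<le> 2^twr (Suc t)" using Suc by (intro power_increasing) auto
    finally show ?case by simp
  qed simp
  have "twr (Suc t) + Suc t + 16 \<le> 4096 * twr (Suc t)" using tw[of t] by linarith
  also have "\<dots> = 2^(twr t + 12)" by (simp add: power_add)
  also have "\<dots> \<le> 2^(lev_exp (Suc t) - t - 4)" using Suc by (intro power_increasing) auto
  finally show ?case by (simp add: lev_exp.simps)
qed (simp add: lev_exp.simps)

lemma lev_ge_twr: "2 * twr t \<le> lev t"
proof (cases t)
  case 0
  have "(2::nat)^1 \<le> 2^lev_exp 0" using lev_exp_ge[of 0] by (intro power_increasing) auto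
  then show ?thesis using 0 by (simp add: lev_def)
next
  case (Suc s)
  have "(2::nat)^(twr s + 1) \<le> 2^lev_exp (Suc s)" using lev_exp_ge_twr[of s] by (intro power_increasing) auto
  then show ?thesis using Suc by (simp add: lev_def)
qed

lemma twr_mono: "a \<le> b \<Longrightarrow> twr a \<le> twr b"
proof (induction b rule: dec_induct)
  case (step k)
  have "twr k < 2^twr k" by (rule less_exp)
  then show ?case using step unfolding twr.simps by linarith
qed simp

text \<open>One set is filled up to size K with elements outside all the others; the others occupy
  at most \<open>m * K\<close> elements, so enough remain.\<close>

lemma extend_disjoint_family:
  fixes J :: "nat \<Rightarrow> 'a set"
  assumes "finite E" "card E = m * K" "\<And>i. i < m \<Longrightarrow> J i \<subseteq> E" "\<And>i. i < m \<Longrightarrow> card (J i) \<le> K"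
    and "\<And>i j. i < m \<Longrightarrow> j < m \<Longrightarrow> i \<noteq> j \<Longrightarrow> J i \<inter> J j = {}"
  shows "\<exists>G. (\<forall>i<m. J i \<subseteq> G i \<and> card (G i) = K) \<and> (\<forall>i<m. \<forall>j<m. i \<noteq> j \<longrightarrow> G i \<inter> G j = {}) \<and> (\<Union>i<m. G i) = E"
  using assms
proof (induction m arbitrary: E)
  case (Suc m)
  define U where "U = (\<Union>i<m. J i)"
  have JE: "J m \<subseteq> E" by (rule Suc.prems(3)) simp
  have UE: "U \<subseteq> E" unfolding U_def by (rule UN_least, rule Suc.prems(3)) simp
  have "J m \<inter> J i = {}" if "i < m" for i by (rule Suc.prems(5)) (use that in auto)
  then have JU: "J m \<inter> U = {}" unfolding U_def by blast
  have finU: "finite U" "finite (J m)" using UE JE Suc.prems(1) finite_subset by auto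
  have "card U \<le> (\<Sum>i<m. card (J i))" unfolding U_def by (rule card_UN_le) simp
  also have "\<dots> \<le> (\<Sum>i<m. K)" using Suc.prems(4) by (intro sum_mono) simp
  finally have cU: "card U \<le> m * K" by simp
  have "card (E - U - J m) = card E - card U - card (J m)"
    using UE JE JU finU by (subst card_Diff_subset) (auto simp: card_Diff_subset)
  then have "K - card (J m) \<le> card (E - U - J m)" using cU Suc.prems(2) by simp
  then obtain T where T: "T \<subseteq> E - U - J m" "card T = K - card (J m)" "finite T"
    by (rule obtain_subset_with_card_n)
  define H where "H = J m \<union> T"
  have cH: "card H = K"
    unfolding H_def using T finU Suc.prems(4)[of m] by (subst card_Un_disjoint) auto
  have HE: "H \<subseteq> E" unfolding H_def using T JE by auto
  have finH: "finite H" using HE Suc.prems(1) finite_subset by auto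
  have HU: "H \<inter> U = {}" unfolding H_def using T JU by auto
  have "\<exists>G. (\<forall>i<m. J i \<subseteq> G i \<and> card (G i) = K) \<and> (\<forall>i<m. \<forall>j<m. i \<noteq> j \<longrightarrow> G i \<inter> G j = {}) \<and> (\<Union>i<m. G i) = E - H"
  proof (rule Suc.IH)
    show "card (E - H) = m * K" using card_Diff_subset[OF finH HE] cH Suc.prems(2) by simp
    fix i assume i: "i < m"
    then have "J i \<subseteq> U" "J i \<subseteq> E" using Suc.prems(3)[of i] unfolding U_def by auto
    then show "J i \<subseteq> E - H" using HU by blast
  qed (use Suc.prems in auto)
  then obtain G where G: "\<forall>i<m. J i \<subseteq> G i \<and> card (G i) = K" "\<forall>i<m. \<forall>j<m. i \<noteq> j \<longrightarrow> G i \<inter> G j = {}" "(\<Union>i<m. G i) = E - H"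
    by auto
  have GH: "G i \<inter> H = {}" if "i < m" for i using G(3) that by auto
  show ?case
  proof (intro exI[of _ "G(m := H)"] conjI allI impI)
    fix i assume "i < Suc m" then show "J i \<subseteq> (G(m := H)) i" "card ((G(m := H)) i) = K"
      using G(1) cH unfolding H_def by (auto simp: less_Suc_eq)
  next
    fix i j assume "i < Suc m" "j < Suc m" "i \<noteq> j"
    then consider "i = m" "j < m" | "i < m" "j = m" | "i < m" "j < m" "i \<noteq> j" by linarith
    then show "(G(m := H)) i \<inter> (G(m := H)) j = {}"
    proof cases
      case 1 then show ?thesis using GH[of j] by (simp add: Int_commute)
    next
      case 2 then show ?thesis using GH[of i] by simp
    next
      case 3 then show ?thesis using G(2) by simp
    qed
  next
    have "(\<Union>i<m. (G(m := H)) i) = (\<Union>i<m. G i)" by (rule SUP_cong) auto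
    then show "(\<Union>i<Suc m. (G(m := H)) i) = E" unfolding lessThan_Suc using G(3) HE by auto
  qed
qed simp

text \<open>All \<epsilon> up to (1/m)^5 are covered, because the bound on S uses these graphs with
  p^5 for a density p below 1/m.\<close>

definition witness :: "nat \<Rightarrow> nat \<Rightarrow> nat \<Rightarrow> (nat \<Rightarrow> nat set set) \<Rightarrow> bool" where
  "witness m k n G \<longleftrightarrow> n > 0 \<and> (\<Union>i<m. G i) = complete_bipartite {..<n} {n..<2*n} \<and>
    (\<forall>i<m. \<forall>j<m. i \<noteq> j \<longrightarrow> G i \<inter> G j = {}) \<and> (\<forall>i<m. m * card (G i) = n^2) \<and>
    (\<forall>i<m. \<forall>E P \<epsilon>. finite E \<longrightarrow> real (card (sym_diff (G i) E)) \<le> 1 / 2^15 * real (card (G i)) \<longrightarrow>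
      0 < \<epsilon> \<longrightarrow> \<epsilon> \<le> (1 / real m)^5 \<longrightarrow> equipartition {..<2*n} P \<longrightarrow> eps_regular_partition \<epsilon> E P \<longrightarrow> k \<le> card P)"

lemma complete_bipartite_iff:
  assumes "u < n" "n \<le> v" "v < 2*n"
  shows "{u,v} \<in> complete_bipartite {..<n} {n..<2*n}"
proof -
  have "{u,v} \<in> complete_bipartite X Y" if "u \<in> X" "v \<in> Y" for X Y
    unfolding complete_bipartite_def using that by blast
  then show ?thesis using assms by simp
qed

lemma card_complete_bipartite: "card (complete_bipartite {..<n} {n..<2*n}) = n^2"
  and finite_complete_bipartite: "finite (complete_bipartite {..<n} {n..<2*n})"
proof -
  have "complete_bipartite X Y = (\<lambda>(u,v). {u,v}) ` (X \<times> Y)" for X Y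
    unfolding complete_bipartite_def by force
  then have eq: "complete_bipartite {..<n} {n..<2*n} = (\<lambda>(u,v). {u,v}) ` ({..<n} \<times> {n..<2*n})" .
  have "inj_on (\<lambda>(u,v). {u,v}) ({..<n} \<times> {n..<2*n})"
    by (auto simp: inj_on_def doubleton_eq_iff)
  then show "card (complete_bipartite {..<n} {n..<2*n}) = n^2"
    unfolding eq by (simp add: card_image card_cartesian_product power2_eq_square)
  show "finite (complete_bipartite {..<n} {n..<2*n})" unfolding eq by simp
qed

lemma witness_edges:
  assumes "witness m k n G" "i < m"
  shows "G i \<subseteq> complete_bipartite {..<n} {n..<2*n}" and "finite (G i)"
    and "real (card (G i)) = (real n)^2 / real m"
proof -
  show sub: "G i \<subseteq> complete_bipartite {..<n} {n..<2*n}" using assms unfolding witness_def by auto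
  then show "finite (G i)" using finite_complete_bipartite finite_subset by blast
  have "m * card (G i) = n^2" using assms unfolding witness_def by blast
  then have "real m * real (card (G i)) = (real n)^2" by (metis of_nat_mult of_nat_power)
  then show "real (card (G i)) = (real n)^2 / real m" using assms(2) by (simp add: field_simps)
qed

lemma witness_simple:
  assumes "witness m k n G" "i < m"
  shows "simple_graph {..<2*n} (G i)"
  unfolding simple_graph_def
proof (intro conjI ballI)
  fix e assume "e \<in> G i"
  then have "e \<in> complete_bipartite {..<n} {n..<2*n}" using witness_edges(1)[OF assms] by auto
  then obtain u v where "e = {u,v}" "u < n" "n \<le> v" "v < 2*n" unfolding complete_bipartite_def by auto
  then show "\<exists>u v. u \<noteq> v \<and> u \<in> {..<2*n} \<and> v \<in> {..<2*n} \<and> e = {u,v}"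
    by (intro exI[of _ u] exI[of _ v]) auto
qed simp

lemma witness_density:
  assumes "witness m k n G" "i < m"
  shows "d_G (G i) {..<n} {n..<2*n} = 1 / real m"
proof -
  have "bij_betw (\<lambda>(u,v). {u,v}) {(u,v). u \<in> {..<n} \<and> v \<in> {n..<2*n} \<and> {u,v} \<in> G i} (G i)"
    unfolding bij_betw_def
  proof
    show "inj_on (\<lambda>(u,v). {u,v}) {(u,v). u \<in> {..<n} \<and> v \<in> {n..<2*n} \<and> {u,v} \<in> G i}"
      by (auto simp: inj_on_def doubleton_eq_iff)
    show "(\<lambda>(u,v). {u,v}) ` {(u,v). u \<in> {..<n} \<and> v \<in> {n..<2*n} \<and> {u,v} \<in> G i} = G i"
    proof (intro subset_antisym subsetI)
      fix e assume e: "e \<in> G i"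
      then have "e \<in> complete_bipartite {..<n} {n..<2*n}" using witness_edges(1)[OF assms] by auto
      then obtain u v where "e = {u,v}" "u \<in> {..<n}" "v \<in> {n..<2*n}" unfolding complete_bipartite_def by auto
      then show "e \<in> (\<lambda>(u,v). {u,v}) ` {(u,v). u \<in> {..<n} \<and> v \<in> {n..<2*n} \<and> {u,v} \<in> G i}" using e by force
    qed auto
  qed
  then have "e_G (G i) {..<n} {n..<2*n} = card (G i)" unfolding e_G_def by (rule bij_betw_same_card)
  moreover have "n > 0" using assms unfolding witness_def by simp
  ultimately show ?thesis using witness_edges(3)[OF assms] by (simp add: d_G_def power2_eq_square)
qed

text \<open>Only the partition into a single part has to be excluded, so any split of the complete
  bipartite graph into m graphs with m edges serves. One side spans almost no edges, while the
  density of the whole vertex set is of order 1/m, and \<epsilon> is below their difference.\<close>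

lemma witness_small:
  assumes m: "m \<ge> 2"
  shows "\<exists>G. witness m 2 m G"
proof -
  have "\<exists>G. (\<forall>i<m. {} \<subseteq> G i \<and> card (G i) = m) \<and> (\<forall>i<m. \<forall>j<m. i \<noteq> j \<longrightarrow> G i \<inter> G j = {})
      \<and> (\<Union>i<m. G i) = complete_bipartite {..<m} {m..<2*m}"
    by (rule extend_disjoint_family) (simp_all add: finite_complete_bipartite card_complete_bipartite power2_eq_square)
  then obtain G where G: "\<And>i. i < m \<Longrightarrow> card (G i) = m" "\<forall>i<m. \<forall>j<m. i \<noteq> j \<longrightarrow> G i \<inter> G j = {}"
    "(\<Union>i<m. G i) = complete_bipartite {..<m} {m..<2*m}" by auto
  have "2 \<le> card P"
    if i: "i < m" and E: "finite E" and close: "real (card (sym_diff (G i) E)) \<le> 1 / 2^15 * real (card (G i))"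
      and eps: "0 < \<epsilon>" "\<epsilon> \<le> (1 / real m)^5" and P: "equipartition {..<2*m} P" "eps_regular_partition \<epsilon> E P"
    for i :: nat and E P \<epsilon>
  proof (rule ccontr)
    assume "\<not> 2 \<le> card P"
    note parts = equipartition_parts[OF P(1) finite_lessThan]
    have rm: "real m \<ge> 2" using m by simp
    have "0 \<in> \<Union>P" unfolding parts(4) using m by simp
    then have "card P \<noteq> 0" using parts(1) by auto
    then have "card P = 1" using \<open>\<not> 2 \<le> card P\<close> by simp
    then obtain Z where "P = {Z}" by (metis card_1_singletonE)
    then have PV: "P = {{..<2*m}}" using parts(4) by simp
    have m4: "real m ^ 4 \<ge> 16" using power_mono[OF rm, of 4] by simp
    have e8: "(1 / real m)^5 \<le> 1 / (16 * real m)"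
    proof -
      have "16 * real m \<le> real m ^ 4 * real m" using m4 by (intro mult_right_mono) auto
      also have "\<dots> = real m ^ 5" by (simp flip: power_Suc2)
      finally show ?thesis using rm by (simp add: power_divide frac_le)
    qed
    have "1 / (16 * real m) \<le> 1 / 32" using rm by (simp add: field_simps)
    then have eps1: "\<epsilon> \<le> 1/32" using eps e8 by linarith
    have reg: "eps_regular_pair \<epsilon> E {..<2*m} {..<2*m}"
    proof (rule ccontr)
      assume "\<not> ?thesis"
      then have "{(X, Y). X \<in> P \<and> Y \<in> P \<and> \<not> eps_regular_pair \<epsilon> E X Y} = {({..<2*m}, {..<2*m})}"
        unfolding PV by auto
      then show False using P(2) eps1 unfolding eps_regular_partition_def PV by simp
    qed
    have "\<epsilon> * real (card {..<2*m}) \<le> real (card {..<m})"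
      using mult_right_mono[OF eps1, of "2 * real m"] by simp
    then have d: "\<bar>d_G E {..<2*m} {..<2*m} - d_G E {..<m} {..<m}\<bar> \<le> \<epsilon>"
      using reg unfolding eps_regular_pair_def by simp
    have sub: "G i \<subseteq> complete_bipartite {..<m} {m..<2*m}" using G(3) i by auto
    then have finG: "finite (G i)" using finite_complete_bipartite finite_subset by blast
    have x: "real (card (sym_diff (G i) E)) \<le> real m / 2^15" using close G(1)[OF i] by simp
    have "card (E - G i) \<le> card (sym_diff (G i) E)" "card (G i - E) \<le> card (sym_diff (G i) E)"
      using E finG by (auto intro!: card_mono)
    then have x1: "real (card (E - G i)) \<le> real m / 2^15" and x2: "real (card (G i - E)) \<le> real m / 2^15"
      using x by linarith+
    have "e_G E {..<m} {..<m} \<le> card {(u,v). {u,v} \<in> E - G i}"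
      unfolding e_G_def
    proof (rule card_mono[OF card_pairs_of_family(1)])
      have "{u,v} \<notin> G i" if "u < m" "v < m" for u v
      proof
        assume "{u,v} \<in> G i"
        then have "{u,v} \<in> complete_bipartite {..<m} {m..<2*m}" using sub by auto
        then show False using that unfolding complete_bipartite_def by (auto simp: doubleton_eq_iff)
      qed
      then show "{(u,v). u \<in> {..<m} \<and> v \<in> {..<m} \<and> {u,v} \<in> E} \<subseteq> {(u,v). {u,v} \<in> E - G i}" by auto
    qed (use E in simp)
    also have "\<dots> \<le> 2 * card (E - G i)" using E by (intro card_pairs_of_family(2)) simp
    finally have "real (e_G E {..<m} {..<m}) \<le> 2 * (real m / 2^15)" using x1 by linarith
    then have "d_G E {..<m} {..<m} \<le> 2 * (real m / 2^15) / (real m * real m)"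
      unfolding d_G_def card_lessThan by (intro divide_right_mono) auto
    also have "\<dots> = (1 / 2^14) * (real m / (real m * real m))" by simp
    also have "real m / (real m * real m) = 1 / real m" using rm by simp
    finally have dA: "d_G E {..<m} {..<m} \<le> (1 / 16384) * (1 / real m)" by simp
    have "card (G i \<inter> E) \<le> e_G E {..<2*m} {..<2*m}"
      unfolding e_G_def
    proof (rule surj_card_le[where f="\<lambda>(u,v). {u,v}"])
      show "finite {(u, v). u \<in> {..<2*m} \<and> v \<in> {..<2*m} \<and> {u, v} \<in> E}"
        by (rule finite_subset[OF _ card_pairs_of_family(1)[OF E]]) auto
      show "G i \<inter> E \<subseteq> (\<lambda>(u,v). {u,v}) ` {(u, v). u \<in> {..<2*m} \<and> v \<in> {..<2*m} \<and> {u, v} \<in> E}"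
      proof
        fix e assume e: "e \<in> G i \<inter> E"
        then have "e \<in> complete_bipartite {..<m} {m..<2*m}" using sub by auto
        then obtain u v where "e = {u,v}" "u < m" "m \<le> v" "v < 2*m" unfolding complete_bipartite_def by auto
        then have "(u,v) \<in> {(u, v). u \<in> {..<2*m} \<and> v \<in> {..<2*m} \<and> {u, v} \<in> E}" using e by auto
        then show "e \<in> (\<lambda>(u,v). {u,v}) ` {(u, v). u \<in> {..<2*m} \<and> v \<in> {..<2*m} \<and> {u, v} \<in> E}"
          by (rule image_eqI[where x="(u,v)", rotated]) (simp add: \<open>e = {u,v}\<close>)
      qed
    qed
    moreover have "card (G i) = card (G i - E) + card (G i \<inter> E)"
      using finG by (metis Int_Diff_Un Int_Diff_disjoint card_Un_disjoint finite_Diff finite_Int add.commute)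
    ultimately have "real m - real m / 2^15 \<le> real (e_G E {..<2*m} {..<2*m})" using x2 G(1)[OF i] by linarith
    then have "1/2 * real m \<le> real (e_G E {..<2*m} {..<2*m})" using rm by (simp add: field_simps)
    then have "1/2 * real m / (real (2*m) * real (2*m)) \<le> d_G E {..<2*m} {..<2*m}"
      unfolding d_G_def card_lessThan by (intro divide_right_mono) auto
    moreover have "1/2 * real m / (real (2*m) * real (2*m)) = 1/8 * (1 / real m)" using rm by simp
    ultimately have dV: "1/8 * (1 / real m) \<le> d_G E {..<2*m} {..<2*m}" by simp
    have "\<epsilon> \<le> 1/16 * (1 / real m)" using eps(2) e8 by simp
    moreover have "1 / real m > 0" using rm by simp
    ultimately show False using abs_le_D1[OF d] dA dV by linarith
  qed
  then have "witness m 2 m G" unfolding witness_def using G m by (auto simp: power2_eq_square)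
  then show ?thesis by blast
qed

section \<open>Equal shares of the complete bipartite graph\<close>

context blowup
begin

lemma card_edges:
  assumes C: "C \<subseteq> {..<2^(S+1)}"
  shows "card (edges C) = n * deg C"
proof -
  define X where "X = (SIGMA u:{..<n}. {v\<in>side 1. joined C u v})"
  have "edges C = (\<lambda>(u,v). {u,v}) ` X"
  proof (intro subset_antisym subsetI)
    fix e assume "e \<in> edges C"
    then obtain u v where e: "e = {u,v}" "joined C u v" unfolding edges_def by auto
    then have "(u,v) \<in> X \<or> (v,u) \<in> X" unfolding X_def side_def joined_def by auto
    then show "e \<in> (\<lambda>(u,v). {u,v}) ` X" using e(1) by (force simp: insert_commute)
  qed (auto simp: X_def edges_iff)
  moreover have "inj_on (\<lambda>(u,v). {u,v}) X"
    unfolding X_def side_def by (auto simp: inj_on_def doubleton_eq_iff)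
  ultimately have "card (edges C) = card X" by (simp add: card_image)
  also have "\<dots> = (\<Sum>u<n. card {v\<in>side 1. joined C u v})"
    unfolding X_def by (rule card_SigmaI) (use finite_side in auto)
  also have "\<dots> = (\<Sum>u<n. deg C)"
  proof (rule sum.cong[OF refl])
    fix u assume u: "u \<in> {..<n}"
    then have "u \<in> side (Suc 1)" unfolding side_def by simp
    then have "{v\<in>side 1. joined C u v} = {v\<in>side 1. scol 1 u (v mod n) \<in> C}"
      using joined_lab[of u 1 _ C] u by auto
    then have "card {v\<in>side 1. joined C u v} = card {v. v < n \<and> scol 1 u v \<in> C}"
      using card_side_filter[of 1 "\<lambda>v. scol 1 u v \<in> C"] by simp
    then show "card {v\<in>side 1. joined C u v} = deg C" using scol_degree[OF C] u by simp
  qed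
  finally show ?thesis by simp
qed

lemma edges_disjoint: "C \<inter> C' = {} \<Longrightarrow> edges C \<inter> edges C' = {}"
proof -
  assume "C \<inter> C' = {}"
  then have "\<not> (joined C u v \<and> joined C' u v)" for u v unfolding joined_def by auto
  moreover have "\<exists>u v. e = {u,v} \<and> joined C u v \<and> joined C' u v" if "e \<in> edges C" "e \<in> edges C'" for e
  proof -
    obtain u v where "e = {u,v}" "joined C u v" using \<open>e \<in> edges C\<close> unfolding edges_def by auto
    then show ?thesis using \<open>e \<in> edges C'\<close> edges_iff by blast
  qed
  ultimately show ?thesis by blast
qed

lemma edges_subset: "edges C \<subseteq> complete_bipartite {..<n} {n..<2*n}"
proof
  fix e assume "e \<in> edges C"
  then obtain u v where e: "e = {u,v}" "joined C u v" unfolding edges_def by auto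
  then show "e \<in> complete_bipartite {..<n} {n..<2*n}"
    using complete_bipartite_iff[of u n v] complete_bipartite_iff[of v n u]
    unfolding joined_def by (auto simp: insert_commute)
qed

end

text \<open>The finest colours below one colour of level s form an interval of length w. It is cut
  into Q blocks of equal length with a remainder left over; \<open>j div Q\<close> selects the
  interval and \<open>j mod Q\<close> the block.\<close>

definition colours :: "nat \<Rightarrow> nat \<Rightarrow> nat \<Rightarrow> nat set" where
  "colours w Q j = (\<lambda>l. (j div Q) * w + ((j mod Q) * (w div Q) + l)) ` {..<w div Q}"

lemma colours_elem:
  assumes "c \<in> colours w Q j" and Q: "Q > 0"
  shows "c div w = j div Q" "c mod w div (w div Q) = j mod Q"
proof -
  obtain l where l: "l < w div Q" "c = (j div Q) * w + ((j mod Q) * (w div Q) + l)"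
    using assms unfolding colours_def by auto
  have "(j mod Q) * (w div Q) + l < Suc (j mod Q) * (w div Q)" using l by simp
  also have "\<dots> \<le> Q * (w div Q)" using Q by (intro mult_right_mono) (auto simp: Suc_le_eq)
  also have "\<dots> \<le> w" by simp
  finally have lt: "(j mod Q) * (w div Q) + l < w" .
  then show "c div w = j div Q" unfolding l by simp
  have "c mod w = (j mod Q) * (w div Q) + l" unfolding l using lt by simp
  then show "c mod w div (w div Q) = j mod Q" using l by simp
qed

lemma colours_disjoint: "Q > 0 \<Longrightarrow> i \<noteq> j \<Longrightarrow> colours w Q i \<inter> colours w Q j = {}"
  using colours_elem[of _ w Q i] colours_elem[of _ w Q j] by (metis disjoint_iff div_mult_mod_eq)

lemma card_colours: "card (colours w Q j) = w div Q"
  unfolding colours_def by (subst card_image) (auto simp: inj_on_def)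

text \<open>At most Q graphs share a colour of level s. Rounding Q up and rounding w down to a
  multiple of Q lose a fraction of at most 2^-17 each, so a block of colours supplies all but a
  2^-15 fraction of the edges of a graph, and padding costs no more than the permitted
  modification.\<close>

lemma witness_large:
  assumes s: "2 \<le> s" and m: "2^(s+18) \<le> m"
  shows "\<exists>n G. witness m (twr s) n G"
proof -
  \<comment> \<open>Even, and so far above s that each colour of level s has at least 2^18 m
    descendants.\<close>
  define S where "S = 2 * (m + s)"
  have m0: "m > 0" using m by (metis gr0I le_zero_eq power_not_zero zero_neq_numeral)
  interpret blowup m S by unfold_locales (use m0 s in \<open>auto simp: S_def\<close>)
  define w Q L where "w = (2::nat)^(S - s)" and "Q = m div 2^(s+1) + 1" and "L = w div Q"
  have Q0: "Q > 0" unfolding Q_def by simp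
  have sS: "s \<le> S" unfolding S_def by simp
  have total: "2^(s+1) * w = 2^(S+1)" unfolding w_def power_add[symmetric] using sS by simp
  have w_big: "2^18 * m \<le> w"
  proof -
    have "(2::nat)^18 \<le> 2^m"
    proof -
      have "(2::nat)^18 \<le> m" using power_increasing[of 18 "s+18" "2::nat"] m by simp
      then have "18 \<le> m" by simp
      then show ?thesis by (intro power_increasing) auto
    qed
    then have "2^18 * m \<le> 2^m * 2^m" using less_exp[of m] by (intro mult_mono) auto
    also have "\<dots> = 2^(m+m)" by (simp add: power_add)
    also have "\<dots> \<le> w" unfolding w_def S_def by (intro power_increasing) auto
    finally show ?thesis .
  qed
  have Q_big: "2^17 \<le> Q"
  proof -
    have "(2::nat)^17 * 2^(s+1) = 2^(s+18)" by (simp add: power_add)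
    then have "2^17 \<le> m div 2^(s+1)" using m by (simp add: less_eq_div_iff_mult_less_eq)
    then show ?thesis unfolding Q_def by simp
  qed
  have mQ: "m \<le> 2^(s+1) * Q"
  proof -
    have "m = 2^(s+1) * (m div 2^(s+1)) + m mod 2^(s+1)" by simp
    moreover have "m mod 2^(s+1) \<le> 2^(s+1)" by (simp add: order_less_imp_le)
    ultimately show ?thesis unfolding Q_def distrib_left mult_1_right by linarith
  qed
  have Qm: "Q \<le> 2 * m" unfolding Q_def using m0 div_le_dividend[of m "2^(s+1)"] by linarith
  have LQ: "L * Q \<le> w" "w < L * Q + Q"
  proof -
    show "L * Q \<le> w" unfolding L_def by simp
    have "w = L * Q + w mod Q" unfolding L_def by simp
    moreover have "w mod Q < Q" using Q0 by simp
    ultimately show "w < L * Q + Q" by linarith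
  qed
  have mL_le: "m * L \<le> 2^(S+1)"
  proof -
    have "m * L \<le> 2^(s+1) * Q * L" using mQ by (rule mult_right_mono) simp
    also have "\<dots> \<le> 2^(s+1) * w" using LQ(1) by (simp add: mult_ac)
    finally show ?thesis using total by simp
  qed
  have mL_ge: "(1 - 1/2^15) * 2^(S+1) \<le> real m * real L"
  proof -
    have "2^(s+1) * (m div 2^(s+1)) \<le> m" by simp
    then have "2^(s+1) * (m div 2^(s+1)) * L \<le> m * L" by (rule mult_right_mono) simp
    then have "2^(s+1) * (Q * L - L) \<le> m * L" unfolding Q_def by (simp add: algebra_simps)
    then have "real (2^(s+1) * (Q * L - L)) \<le> real (m * L)" by (simp only: of_nat_le_iff)
    moreover have "L \<le> Q * L" using Q0 by simp
    ultimately have 1: "2^(s+1) * (real Q * real L - real L) \<le> real m * real L"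
      by (simp add: of_nat_diff)
    have "L * 2^17 \<le> L * Q" using Q_big by simp
    then have "L * 2^17 \<le> w" using LQ(1) by linarith
    then have "real (L * 2^17) \<le> real w" by (simp only: of_nat_le_iff)
    then have "real L \<le> real w / 2^17" by simp
    moreover have "real Q \<le> real w / 2^17" using Qm w_big by simp
    moreover have "real w \<le> real L * real Q + real Q" using LQ(2) by (metis of_nat_add of_nat_le_iff of_nat_mult order_less_imp_le)
    ultimately have "(1 - 1/2^15) * real w \<le> real Q * real L - real L" by (simp add: mult.commute)
    then have "2^(s+1) * ((1 - 1/2^15) * real w) \<le> 2^(s+1) * (real Q * real L - real L)"
      by (intro mult_left_mono) auto
    moreover have "2^(s+1) * ((1 - 1/2^15) * real w) = (1 - 1/2^15) * 2^(S+1)"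
    proof -
      have "real (2^(s+1) * w) = real (2^(S+1))" unfolding total ..
      then show ?thesis by simp
    qed
    ultimately show ?thesis using 1 by linarith
  qed
  have L0: "L > 0"
  proof (rule ccontr)
    assume "\<not> L > 0"
    then show False using LQ(2) Qm w_big m0 by simp
  qed
  define C where "C j = colours w Q j" for j
  have cardC: "card (C j) = L" for j unfolding C_def L_def by (rule card_colours)
  have prefC: "c div 2^(S-s) = j div Q" if "c \<in> C j" for c j
    using colours_elem(1)[OF _ Q0] that unfolding C_def w_def by blast
  have subC: "C j \<subseteq> {..<2^(S+1)}" if j: "j < m" for j
  proof
    fix c assume c: "c \<in> C j"
    have "j div Q < 2^(s+1)" using j mQ by (intro less_mult_imp_div_less) simp
    then have "c div w < 2^(s+1)" using prefC[OF c] unfolding w_def by simp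
    moreover have "w > 0" unfolding w_def by simp
    ultimately have "c < 2^(s+1) * w" by (simp add: div_less_iff_less_mult)
    then show "c \<in> {..<2^(S+1)}" using total by simp
  qed
  define K where "K = lev S * lev (Suc S) * n"
  have nK: "n^2 = m * K" unfolding K_def power2_eq_square by (subst (1) n_def) (simp add: mult_ac)
  have cardE: "card (edges (C j)) * 2^(S+1) = L * n^2" if "j < m" for j
    using deg_eq[of "C j"] card_edges[OF subC[OF that]] cardC by (simp add: power2_eq_square)
  have cardE_le: "card (edges (C j)) \<le> K" if j: "j < m" for j
  proof -
    have "(card (edges (C j)) * 2^(S+1)) * 1 = (m * L) * K" using cardE[OF j] nK by simp
    also have "\<dots> \<le> 2^(S+1) * K" using mL_le by (rule mult_right_mono) simp
    finally show ?thesis by simp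
  qed
  have cardE_ge: "(1 - 1/2^15) * real K \<le> real (card (edges (C j)))" if j: "j < m" for j
  proof -
    have "real (card (edges (C j)) * 2^(S+1)) = real (L * (m * K))" using cardE[OF j] nK by simp
    then have "real (card (edges (C j))) * 2^(S+1) = (real m * real L) * real K" by simp
    also have "\<dots> \<ge> ((1 - 1/2^15) * 2^(S+1)) * real K" using mL_ge by (rule mult_right_mono) simp
    finally have "((1 - 1/2^15) * real K) * 2^(S+1) \<le> real (card (edges (C j))) * 2^(S+1)" by (simp add: mult_ac)
    then show ?thesis by (rule mult_right_le_imp_le) simp
  qed
  have "\<exists>G. (\<forall>i<m. edges (C i) \<subseteq> G i \<and> card (G i) = K) \<and> (\<forall>i<m. \<forall>j<m. i \<noteq> j \<longrightarrow> G i \<inter> G j = {})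
    \<and> (\<Union>i<m. G i) = complete_bipartite {..<n} {n..<2*n}"
  proof (rule extend_disjoint_family)
    show "card (complete_bipartite {..<n} {n..<2*n}) = m * K" using nK by (simp add: card_complete_bipartite)
    fix i j :: nat assume "i \<noteq> j"
    then show "edges (C i) \<inter> edges (C j) = {}" unfolding C_def by (intro edges_disjoint colours_disjoint Q0)
  qed (use finite_complete_bipartite edges_subset cardE_le in auto)
  then obtain G where G': "\<forall>i<m. edges (C i) \<subseteq> G i \<and> card (G i) = K"
    and G3: "\<forall>i<m. \<forall>j<m. i \<noteq> j \<longrightarrow> G i \<inter> G j = {}"
    and G4: "(\<Union>i<m. G i) = complete_bipartite {..<n} {n..<2*n}" by (elim exE conjE)
  have G1: "edges (C i) \<subseteq> G i" and G2: "card (G i) = K" if "i < m" for i using G' that by auto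
  note G = G1 G2 G3 G4
  have m5: "real m \<ge> 2^5"
  proof -
    have "(2::nat)^5 \<le> 2^(s+18)" by (intro power_increasing) auto
    then have "(2::nat)^5 \<le> m" using m by linarith
    then show ?thesis by simp
  qed
  have "twr s \<le> card P"
    if i: "i < m" and E: "finite E" and close: "real (card (sym_diff (G i) E)) \<le> 1 / 2^15 * real (card (G i))"
      and eps: "0 < \<epsilon>" "\<epsilon> \<le> (1 / real m)^5" and P: "equipartition {..<2*n} P" "eps_regular_partition \<epsilon> E P"
    for i :: nat and E P \<epsilon>
  proof -
    let ?J = "edges (C i)"
    have finG: "finite (G i)" using G(4) i finite_complete_bipartite[of n] by (metis UN_upper finite_subset lessThan_iff)
    have "card (sym_diff E ?J) \<le> card (sym_diff (G i) E \<union> (G i - ?J))"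
      using E finG G(1)[OF i] by (intro card_mono) auto
    also have "\<dots> \<le> card (sym_diff (G i) E) + card (G i - ?J)" by (rule card_Un_le)
    also have "card (G i - ?J) = K - card ?J"
      using G(1,2)[OF i] finite_edges by (simp add: card_Diff_subset)
    finally have "real (card (sym_diff E ?J)) \<le> real (card (sym_diff (G i) E)) + (real K - real (card ?J))"
      using cardE_le[OF i] by linarith
    also have "\<dots> \<le> 2 / 2^15 * real K" using close cardE_ge[OF i] G(2)[OF i] by (simp add: algebra_simps)
    finally have \<Delta>: "real (card (sym_diff E ?J)) \<le> 2 / 2^15 * real K" .
    have inv: "1 / real m \<le> 1 / 2^5" using m5 by (intro divide_left_mono) auto
    have "(1 / real m)^4 \<le> (1 / 2^5)^4" by (rule power_mono[OF inv]) simp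
    also have "\<dots> = 1 / 2^20" by (simp add: power_divide)
    finally have m4: "(1 / real m)^4 \<le> 1 / 2^20" .
    have "\<epsilon> * real m \<le> (1 / real m)^5 * real m" using eps(2) by (rule mult_right_mono) simp
    also have "\<dots> = (1 / real m)^4" using m0 by (simp add: power_divide eval_nat_numeral)
    finally have em: "\<epsilon> * real m \<le> 1 / 2^20" using m4 by linarith
    have "(real n)^2 = real m * real K" using nK by (metis of_nat_mult of_nat_power)
    then have "24 * \<epsilon> * (real n)^2 = 24 * (\<epsilon> * real m) * real K" by simp
    also have "\<dots> \<le> 24 * (1 / 2^20) * real K" using em by (intro mult_right_mono mult_left_mono) auto
    finally have e24: "24 * \<epsilon> * (real n)^2 \<le> 24 / 2^20 * real K" by simp
    have J: "real (deg (C i)) * real n = real (card ?J)"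
      using card_edges[OF subC[OF i]] by (simp add: mult.commute)
    \<comment> \<open>Padding and modification change at most K/2^15 edges each; doubled they cost
      K/8192, and regularity costs 24 K/2^20. The budget is about K/2048.\<close>
    have main: "2 * real (card (sym_diff E ?J)) + 24 * \<epsilon> * (real n)^2 \<le> real (deg (C i)) * real n / 2048"
    proof -
      have "real (card (sym_diff E ?J)) \<le> real K / 16384" "24 * \<epsilon> * (real n)^2 \<le> 24 / 1048576 * real K"
        "32767 / 32768 * real K \<le> real (card ?J)" using \<Delta> e24 cardE_ge[OF i] by simp_all
      then show ?thesis unfolding J using of_nat_0_le_iff[of K, where 'a=real] by linarith
    qed
    have e23: "\<epsilon> \<le> 1 / 2^23"
    proof -
      have "(1 / real m)^5 \<le> (1 / 2^5)^5" by (rule power_mono[OF inv]) simp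
      also have "\<dots> \<le> 1 / 2^23" by (simp add: power_divide)
      finally have "(1 / real m)^5 \<le> 1 / 2^23" .
      then show ?thesis using eps(2) by simp
    qed
    have "C i \<noteq> {}" using cardC[of i] L0 by auto
    then have "lev s \<le> 2 * card P"
      using many_parts[OF subC[OF i] _ s sS prefC P eps(1) e23 E main] by blast
    then show ?thesis using lev_ge_twr[of s] by simp
  qed
  then have "witness m (twr s) n G" unfolding witness_def using G n_pos nK by auto
  then show ?thesis by blast
qed

section \<open>The exponent constant and the final bounds\<close>

definition expo :: real where "expo = 1 / (80 * ln 2)"

lemma expo_pos: "expo > 0"
  unfolding expo_def by simp

lemma expo_ln: "expo * ln x = log 2 x / 80"
  unfolding expo_def log_def by simp

lemma witness_mono: "witness m k n G \<Longrightarrow> k' \<le> k \<Longrightarrow> witness m k' n G"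
  unfolding witness_def by (meson order.trans)

lemma twr_real_le_2:
  assumes "x \<le> 1"
  shows "twr_real x \<le> 2"
proof -
  have "nat \<lceil>x\<rceil> \<le> 1" using assms by (simp add: ceiling_le_one)
  then have "twr_real x \<le> twr 1" unfolding twr_real_def by (rule twr_mono)
  then show ?thesis by simp
qed

text \<open>With s one above the rounded height, s + 18 is at most log(m)/80 + 20 in base 2, which
  is below log(m) from 2^78 on. The additional unit of height pays for the loss between m and 1/p
  below.\<close>

lemma witness_tower:
  assumes m: "2^78 \<le> real m"
  shows "\<exists>n G. witness m (twr (nat \<lceil>expo * ln m\<rceil> + 1)) n G"
proof -
  define l where "l = log 2 (real m)"
  have m0: "real m > 0" using m by (smt (verit) zero_less_power)
  have "log 2 (2 powr 78) \<le> l" unfolding l_def using m m0 by (intro log_mono) (auto simp: powr_numeral)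
  moreover have "log 2 (2 powr 78) = (78::real)" by (rule log_powr_cancel) auto
  ultimately have l: "l \<ge> 78" by linarith
  define s where "s = nat \<lceil>l / 80\<rceil> + 1"
  have c1: "\<lceil>l/80\<rceil> \<ge> 1" using l by (simp add: less_ceiling_iff)
  have s2: "2 \<le> s" unfolding s_def using c1 by linarith
  have "real_of_int \<lceil>l/80\<rceil> \<le> l / 80 + 1" by (rule of_int_ceiling_le_add_one)
  moreover have "real (nat \<lceil>l/80\<rceil>) = real_of_int \<lceil>l/80\<rceil>" using c1 by (intro of_nat_nat) linarith
  moreover have "real (s + 18) = real (nat \<lceil>l/80\<rceil>) + 19" unfolding s_def by simp
  ultimately have "real (s + 18) \<le> l / 80 + 20" by linarith
  also have "\<dots> \<le> l" using l by simp
  finally have "2 powr real (s+18) \<le> 2 powr l" by simp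
  also have "2 powr l = real m" unfolding l_def using m0 by simp
  also have "2 powr real (s+18) = 2^(s+18)" by (rule powr_realpow) simp
  finally have "real (2^(s+18)) \<le> real m" by simp
  then have "2^(s+18) \<le> m" by (simp only: of_nat_le_iff)
  from witness_large[OF s2 this] show ?thesis unfolding s_def l_def expo_ln by simp
qed

lemma witness_exists:
  assumes m: "m \<ge> 2"
  shows "\<exists>n G. witness m (twr_real (expo * ln (real m))) n G"
proof (cases "2^78 \<le> real m")
  case True
  then obtain n G where "witness m (twr (nat \<lceil>expo * ln m\<rceil> + 1)) n G" using witness_tower by blast
  then show ?thesis unfolding twr_real_def by (meson witness_mono twr_mono le_add1)
next
  case False
  have "log 2 (real m) \<le> log 2 (2 powr 78)" using False m by (intro log_mono) (auto simp: powr_numeral)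
  moreover have "log 2 (2 powr 78) = (78::real)" by (rule log_powr_cancel) auto
  ultimately have "twr_real (expo * ln (real m)) \<le> 2" unfolding expo_ln by (intro twr_real_le_2) linarith
  then show ?thesis using witness_small[OF m] witness_mono by blast
qed

lemma equipartition_trivial: "V \<noteq> {} \<Longrightarrow> equipartition V {V}"
  unfolding equipartition_def by auto

text \<open>A single edge whose ends are separated by the prescribed partition forces two parts;
  this settles all p for which the tower is at most 2.\<close>

lemma admissible_ge_2:
  assumes p: "0 < p" "p \<le> 1/2" and S: "S_admissible (p^5) \<delta> p S"
  shows "2 \<le> S"
proof -
  define V E P0 where "V = {0, 1::nat}" and "E = {{0, 1::nat}}" and "P0 = {{0}, {1::nat}}"
  have "simple_graph V E" unfolding simple_graph_def V_def E_def by auto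
  moreover have "graph_density V E \<ge> p" unfolding graph_density_def V_def E_def using p by simp
  moreover have "equipartition V P0" unfolding equipartition_def V_def P0_def by auto
  moreover have "real (card P0) \<le> 1 / p^5"
  proof -
    have "p^5 \<le> (1/2)^5" using p by (intro power_mono) auto
    also have "\<dots> \<le> 1/2" by (simp add: power_divide)
    finally have "2 * p^5 \<le> 1" by simp
    then show ?thesis using p unfolding P0_def by (simp add: pos_le_divide_eq)
  qed
  ultimately obtain E' P where P: "equipartition V P" "Defs.refines P P0" "card P \<le> S"
    using S unfolding S_admissible_def by meson
  have "\<exists>X\<in>P. x \<in> X \<and> X \<subseteq> {x}" if x: "x \<in> V" for x
  proof -
    have "\<Union>P = V" using P(1) unfolding equipartition_def by simp
    then obtain X where X: "X \<in> P" "x \<in> X" using x by blast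
    then obtain Y where Y: "Y \<in> P0" "X \<subseteq> Y" using P(2) unfolding Defs.refines_def by auto
    then have "Y = {x}" using X unfolding P0_def by auto
    then show ?thesis using X Y by auto
  qed
  then have "{0} \<in> P" "{1} \<in> P" unfolding V_def by (metis insertI1 insertI2 subset_singletonD empty_iff)+
  then have "{{0},{1}} \<subseteq> P" by auto
  moreover have "finite P" using P(1) unfolding equipartition_def by simp
  ultimately have "card {{0},{1::nat}} \<le> card P" by (intro card_mono)
  then show ?thesis using P(3) by simp
qed

lemma admissible_ge_tower:
  assumes p: "0 < p" "p \<le> 1/2" and S: "S_admissible (p^5) (1/2^15) p S"
  shows "twr_real (expo * ln (1/p)) \<le> S"
proof (cases "1/p \<le> 2^80")
  case True
  have "log 2 (1/p) \<le> log 2 (2 powr 80)" using True p by (intro log_mono) (auto simp: powr_numeral)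
  moreover have "log 2 (2 powr 80) = (80::real)" by (rule log_powr_cancel) auto
  ultimately have "twr_real (expo * ln (1/p)) \<le> 2" unfolding expo_ln by (intro twr_real_le_2) linarith
  then show ?thesis using admissible_ge_2[OF p S] by simp
next
  case False
  \<comment> \<open>The density of the whole graph is taken over all 2n vertices, so bipartite
    density 1/m becomes 1/(2m), which must be at least p.\<close>
  define m where "m = nat \<lfloor>1 / (2*p)\<rfloor>"
  have fl: "real m \<le> 1 / (2*p)" "1 / (2*p) < real m + 1"
    unfolding m_def using p by (auto simp: of_nat_floor)
  have m78: "2^78 \<le> real m" using False fl(2) by simp
  then have m1: "real m \<ge> 1" by simp
  then have m0: "m > 0" by simp
  obtain n G where W: "witness m (twr (nat \<lceil>expo * ln m\<rceil> + 1)) n G" using witness_tower[OF m78] by blast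
  have n0: "n > 0" using W unfolding witness_def by simp
  have "simple_graph {..<2*n} (G 0)" by (rule witness_simple[OF W m0])
  moreover have "graph_density {..<2*n} (G 0) \<ge> p"
  proof -
    have "graph_density {..<2*n} (G 0) = 1 / (2 * real m)"
      unfolding graph_density_def witness_edges(3)[OF W m0] using n0 by (simp add: power2_eq_square)
    moreover have "p \<le> 1 / (2 * real m)" using fl(1) p m1 by (simp add: field_simps)
    ultimately show ?thesis by simp
  qed
  moreover have "equipartition {..<2*n} {{..<2*n}}" using n0 by (intro equipartition_trivial) (auto simp: lessThan_empty_iff)
  moreover have "real (card {{..<2*n}}) \<le> 1 / p^5" using p power_le_one[of p 5] by (simp add: pos_le_divide_eq)
  ultimately obtain E P where E: "simple_graph {..<2*n} E" "real (card (G 0 - E \<union> (E - G 0))) \<le> 1/2^15 * real (card (G 0))"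
    and P: "equipartition {..<2*n} P" "eps_regular_partition (p^5) E P" "card P \<le> S"
    using S unfolding S_admissible_def by meson
  have "finite E"
  proof (rule finite_subset)
    show "E \<subseteq> Pow {..<2*n}" using E(1) unfolding simple_graph_def by fastforce
  qed simp
  moreover have "p^5 \<le> (1 / real m)^5"
  proof (intro power_mono)
    show "p \<le> 1 / real m" using fl(1) p m1 by (simp add: field_simps)
  qed (use p in simp)
  moreover have "0 < p^5" using p by simp
  ultimately have "twr (nat \<lceil>expo * ln m\<rceil> + 1) \<le> card P"
    using W m0 E(2) P(1,2) unfolding witness_def by blast
  moreover have "twr_real (expo * ln (1/p)) \<le> twr (nat \<lceil>expo * ln m\<rceil> + 1)"
    unfolding twr_real_def
  proof (rule twr_mono)
    \<comment> \<open>The halved density and the rounding lose a factor of at most 4 in 1/p, that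
      is, 2/80 in the height, which is less than the one spare unit.\<close>
    have "1/p = 2 * (1 / (2*p))" by simp
    then have "1/p \<le> 4 * real m" using fl(2) m1 by linarith
    then have "log 2 (1/p) \<le> log 2 (4 * real m)" using p by (intro log_mono) auto
    also have "\<dots> = log 2 4 + log 2 (real m)" using m1 by (simp add: log_mult)
    also have "log 2 4 = (2::real)" using log_powr_cancel[of 2 2] by simp
    finally have "expo * ln (1/p) \<le> expo * ln (real m) + 1" unfolding expo_ln by simp
    then have "\<lceil>expo * ln (1/p)\<rceil> \<le> \<lceil>expo * ln (real m)\<rceil> + 1" by linarith
    then show "nat \<lceil>expo * ln (1/p)\<rceil> \<le> nat \<lceil>expo * ln (real m)\<rceil> + 1" by linarith
  qed
  ultimately show ?thesis using P(3) by simp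
qed

theorem theorem1p7:
  shows "\<exists>\<delta>0 c :: real. \<delta>0 > 0 \<and> c > 0 \<and>
    (\<forall>p :: real. 0 < p \<and> p \<le> 1/2 \<longrightarrow>
        enat (twr_real (c * ln (1 / p))) \<le> reg_S (p ^ 5) \<delta>0 p) \<and>
    (\<forall>m :: nat. m \<ge> 2 \<longrightarrow>
       (\<exists>A B (G :: nat \<Rightarrow> nat set set).
          finite A \<and> finite B \<and> A \<noteq> {} \<and> B \<noteq> {} \<and> A \<inter> B = {} \<and>
          (\<Union>i<m. G i) = complete_bipartite A B \<and>
          (\<forall>i<m. \<forall>j<m. i \<noteq> j \<longrightarrow> G i \<inter> G j = {}) \<and>
          (\<forall>i<m. simple_graph (A \<union> B) (G i) \<and> d_G (G i) A B = 1 / real m) \<and>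
          (\<forall>i<m. \<forall>E'. simple_graph (A \<union> B) E' \<and>
               real (card (G i - E' \<union> (E' - G i))) \<le> \<delta>0 * real (card (G i)) \<longrightarrow>
               \<not> (\<exists>P. equipartition (A \<union> B) P \<and>
                      eps_regular_partition ((1 / real m) ^ 5) E' P \<and>
                      card P < twr_real (c * ln (1 / (1 / real m)))))))"
proof (rule exI[of _ "1/2^15"], rule exI[of _ expo], intro conjI allI impI, goal_cases)
  case 1 show ?case by simp
next
  case 2 show ?case by (rule expo_pos)
next
  case (3 p)
  then show ?case
    \<comment> \<open>Every admissible value is bounded below; if there is none, the infimum is
      infinite and the bound holds as well.\<close>
    unfolding reg_S_def by (intro INF_greatest) (auto intro: admissible_ge_tower)
next
  case (4 m)
  then have m: "m \<ge> 2" .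
  obtain n G where W: "witness m (twr_real (expo * ln (real m))) n G" using witness_exists[OF m] by blast
  have n0: "n > 0" using W unfolding witness_def by simp
  have V: "{..<n} \<union> {n..<2*n} = {..<2*n}" by auto
  have ln: "ln (1 / (1 / real m)) = ln (real m)" by simp
  have regular: "card P \<ge> twr_real (expo * ln (real m))"
    if i: "i < m" and E: "simple_graph {..<2*n} E" "real (card (G i - E \<union> (E - G i))) \<le> 1/2^15 * real (card (G i))"
      and P: "equipartition {..<2*n} P" "eps_regular_partition ((1 / real m) ^ 5) E P" for i E P
  proof -
    have "finite E"
    proof (rule finite_subset)
      show "E \<subseteq> Pow {..<2*n}" using E(1) unfolding simple_graph_def by fastforce
    qed simp
    moreover have "0 < (1 / real m)^5" using m by simp
    ultimately show ?thesis using W i E(2) P unfolding witness_def by blast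
  qed
  show ?case
  proof (rule exI[of _ "{..<n}"], rule exI[of _ "{n..<2*n}"], rule exI[of _ G], unfold V ln, intro conjI allI impI)
    show "{..<n} \<noteq> {}" "{n..<2*n} \<noteq> {}" using n0 by (auto simp: lessThan_empty_iff)
    show "(\<Union>i<m. G i) = complete_bipartite {..<n} {n..<2*n}" using W unfolding witness_def by blast
    fix i assume i: "i < m"
    show "simple_graph {..<2*n} (G i)" "d_G (G i) {..<n} {n..<2*n} = 1 / real m"
      by (rule witness_simple[OF W i], rule witness_density[OF W i])
    show "G i \<inter> G j = {}" if "j < m" "i \<noteq> j" for j using W i that unfolding witness_def by blast
    fix E assume "simple_graph {..<2*n} E \<and> real (card (G i - E \<union> (E - G i))) \<le> 1/2^15 * real (card (G i))"
    then show "\<not> (\<exists>P. equipartition {..<2*n} P \<and> eps_regular_partition ((1 / real m) ^ 5) E P \<and>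
      card P < twr_real (expo * ln (real m)))"
      using regular[OF i] by (meson linorder_not_less)
  qed auto
qed

end
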